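(* Let $K$ be one of $\mathcal{M}(\mathbf{C})$, $\mathbf{C}(\{z\})$ (convergent case) or $\mathbf{C}((z))$ (formal case). Let $P\in\mathcal{D}_{q,K}$ be an operator of order $n$ which is pure of slope $\mu\ne0$ ($\mu\in\mathbf{Q}$, not necessarily an integer), and regard $P$ as the $\mathbf{C}$-linear map $f\mapsto P.f$ from $K$ to $K$. (i) In the formal case, $\dim_{\mathbf{C}}\ker P=\dim_{\mathbf{C}}\operatorname{coker}P=0$. (ii) In the convergent case, $\dim_{\mathbf{C}}\ker P=0$ and $\dim_{\mathbf{C}}\operatorname{coker}P=n\max(0,\mu)$.
   Context: Fix $q\in\mathbf{C}$ with $|q|>1$. $\mathcal{M}(\mathbf{C})$ is the field of meromorphic functions on $\mathbf{C}$, $\mathbf{C}(\{z\})$ the field of germs of meromorphic functions at $0$, $\mathbf{C}((z))$ the field of formal Laurent series; $v_0$ is the $z$-adic valuation and $\sigma_q:f(z)\mapsto f(qz)$. $\mathcal{D}_{q,K}=K\langle\sigma_q,\sigma_q^{-1}\rangle$ is the ring of non-commutative Laurent polynomials $\sum a_i\sigma_q^i$ with $\sigma_q^kx=\sigma_q^k(x)\sigma_q^k$; it acts on $K$ by $P.f=\sum a_i\sigma_q^i(f)$. The order of $P=\sum_{\alpha\le i\le\beta}a_i\sigma_q^i$ with $a_\alpha a_\beta\ne0$ is $\beta-\alpha$. The Newton polygon $N(P)$ is the convex hull of $\{(i,j)\in\mathbf{Z}^2: j\ge v_0(a_i)\}$; its boundary consists of two vertical half-lines and finitely many non-vertical edges,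 whose slopes are the slopes of $P$. $P$ is pure of slope $\mu$ if $\mu$ is its only slope. *)

theory Defs
  imports
    "HOL-Complex_Analysis.Complex_Analysis"
    "HOL-Library.Poly_Mapping"
    "HOL-Algebra.AbelCoset"
    "Jordan_Normal_Form.Missing_VectorSpace"
begin

section \<open>Quotients of vector spaces\<close>

text \<open>
  Vector spaces, their dimension and finite-dimensionality are those of
  \<^locale>\<open>vectorspace\<close>. The ring multiplication fields of a module record are
  irrelevant to its module structure and are left undefined below.
\<close>

definition complex_ring :: "complex ring" where
  "complex_ring = \<lparr>carrier = UNIV, monoid.mult = (*), one = 1, ring.zero = 0, add = (+)\<rparr>"

definition quotient_space ::
    "('a, 'b, 'c) module_scheme \<Rightarrow> 'b set \<Rightarrow> ('a, 'b set) module" where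
  "quotient_space V W =
     \<lparr>carrier = a_rcosets\<^bsub>V\<^esub> W, monoid.mult = undefined, one = undefined,
      ring.zero = W, add = set_add V,
      smult = (\<lambda>a X. \<Union>x\<in>X. W +>\<^bsub>V\<^esub> (a \<odot>\<^bsub>V\<^esub> x))\<rparr>"

lemma field_complex_ring: "field complex_ring"
proof -
  have neg: "\<exists>y. y + x = 0" for x :: complex
    by (rule exI[of _ "- x"]) simp
  have ag: "abelian_group complex_ring"
    by (rule abelian_groupI) (simp_all add: complex_ring_def neg)
  have cm: "Group.comm_monoid complex_ring"
    by (rule comm_monoidI) (simp_all add: complex_ring_def)
  have "cring complex_ring"
    by (rule cringI[OF ag cm]) (simp add: complex_ring_def distrib_right)
  then show ?thesis
  proof (rule cring.cring_fieldI2)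
    show "\<zero>\<^bsub>complex_ring\<^esub> \<noteq> \<one>\<^bsub>complex_ring\<^esub>"
      by (simp add: complex_ring_def)
  next
    fix a assume "a \<in> carrier complex_ring" "a \<noteq> \<zero>\<^bsub>complex_ring\<^esub>"
    then have "a * inverse a = 1" by (simp add: complex_ring_def)
    then show "\<exists>b\<in>carrier complex_ring. a \<otimes>\<^bsub>complex_ring\<^esub> b = \<one>\<^bsub>complex_ring\<^esub>"
      by (auto simp: complex_ring_def)
  qed
qed

lemma vectorspace_quotient_space:
  assumes "vectorspace K V" and "VectorSpace.subspace K W V"
  shows "vectorspace K (quotient_space V W)"
proof -
  interpret vectorspace K V by fact
  interpret sm: submodule K W V using assms(2) by (simp add: VectorSpace.subspace_def)
  have neg: "\<ominus>\<^bsub>V\<^esub> w \<in> W" if "w \<in> W" for w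
  proof -
    have "\<ominus>\<^bsub>K\<^esub> \<one>\<^bsub>K\<^esub> \<in> carrier K" by simp
    then have "(\<ominus>\<^bsub>K\<^esub> \<one>\<^bsub>K\<^esub>) \<odot>\<^bsub>V\<^esub> w \<in> W"
      using that by (rule sm.smult_closed)
    moreover have "w \<in> carrier V" using that sm.subset by blast
    ultimately show ?thesis by (simp only: smult_minus_1)
  qed
  have "additive_subgroup W V"
    by (intro additive_subgroupI subgroup.intro)
       (use sm.subset neg in \<open>auto simp: a_inv_def[symmetric]\<close>)
  then interpret W: abelian_subgroup W V
    by (intro abelian_subgroupI3) (auto simp: M.abelian_group_axioms)
  let ?Q = "quotient_space V W"
  have cosetE: "\<exists>x\<in>carrier V. X = W +>\<^bsub>V\<^esub> x" if "X \<in> carrier ?Q" for X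
    using that by (auto simp: quotient_space_def A_RCOSETS_def')
  have cosetI: "W +>\<^bsub>V\<^esub> x \<in> carrier ?Q" if "x \<in> carrier V" for x
    using that by (auto simp: quotient_space_def A_RCOSETS_def')
  have addQ: "(W +>\<^bsub>V\<^esub> x) \<oplus>\<^bsub>?Q\<^esub> (W +>\<^bsub>V\<^esub> y) = W +>\<^bsub>V\<^esub> (x \<oplus>\<^bsub>V\<^esub> y)"
    if "x \<in> carrier V" "y \<in> carrier V" for x y
    using W.a_rcos_sum[OF that] by (simp add: quotient_space_def)
  have zeroQ: "\<zero>\<^bsub>?Q\<^esub> = W +>\<^bsub>V\<^esub> \<zero>\<^bsub>V\<^esub>"
    by (simp add: quotient_space_def W.a_rcos_const)
  have ag: "abelian_group ?Q"
  proof (rule abelian_groupI)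
    show "\<zero>\<^bsub>?Q\<^esub> \<in> carrier ?Q" by (simp add: zeroQ cosetI)
  next
    fix X Y Z assume "X \<in> carrier ?Q" "Y \<in> carrier ?Q" "Z \<in> carrier ?Q"
    then show "X \<oplus>\<^bsub>?Q\<^esub> Y \<oplus>\<^bsub>?Q\<^esub> Z = X \<oplus>\<^bsub>?Q\<^esub> (Y \<oplus>\<^bsub>?Q\<^esub> Z)"
      using cosetE[of X] cosetE[of Y] cosetE[of Z] by (auto simp: addQ M.a_assoc)
  next
    fix X Y assume "X \<in> carrier ?Q" "Y \<in> carrier ?Q"
    then show "X \<oplus>\<^bsub>?Q\<^esub> Y = Y \<oplus>\<^bsub>?Q\<^esub> X" and "X \<oplus>\<^bsub>?Q\<^esub> Y \<in> carrier ?Q"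
      using cosetE[of X] cosetE[of Y] by (auto simp: addQ M.a_comm cosetI)
  next
    fix X assume "X \<in> carrier ?Q"
    then obtain x where x: "x \<in> carrier V" "X = W +>\<^bsub>V\<^esub> x" using cosetE by blast
    then show "\<zero>\<^bsub>?Q\<^esub> \<oplus>\<^bsub>?Q\<^esub> X = X" by (simp add: zeroQ addQ)
    show "\<exists>Y\<in>carrier ?Q. Y \<oplus>\<^bsub>?Q\<^esub> X = \<zero>\<^bsub>?Q\<^esub>"
      by (rule bexI[of _ "W +>\<^bsub>V\<^esub> (\<ominus>\<^bsub>V\<^esub> x)"])
         (use x in \<open>simp_all add: zeroQ addQ cosetI M.l_neg\<close>)
  qed
  have smQ: "a \<odot>\<^bsub>?Q\<^esub> (W +>\<^bsub>V\<^esub> x) = W +>\<^bsub>V\<^esub> (a \<odot>\<^bsub>V\<^esub> x)"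
    if a: "a \<in> carrier K" and x: "x \<in> carrier V" for a x
  proof -
    have key: "W +>\<^bsub>V\<^esub> (a \<odot>\<^bsub>V\<^esub> y) = W +>\<^bsub>V\<^esub> (a \<odot>\<^bsub>V\<^esub> x)" if y: "y \<in> W +>\<^bsub>V\<^esub> x" for y
    proof -
      from y obtain w where w: "w \<in> W" "y = w \<oplus>\<^bsub>V\<^esub> x"
        by (auto simp: a_r_coset_def')
      have wc: "w \<in> carrier V" using w sm.subset by auto
      have "a \<odot>\<^bsub>V\<^esub> y = a \<odot>\<^bsub>V\<^esub> w \<oplus>\<^bsub>V\<^esub> a \<odot>\<^bsub>V\<^esub> x"
        using a x wc w by (simp add: smult_r_distr)
      moreover have "a \<odot>\<^bsub>V\<^esub> w \<in> W" using a w by simp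
      ultimately have "a \<odot>\<^bsub>V\<^esub> y \<in> W +>\<^bsub>V\<^esub> (a \<odot>\<^bsub>V\<^esub> x)"
        by (auto simp: a_r_coset_def')
      then show ?thesis
        using W.a_repr_independence' a x by auto
    qed
    have "(\<Union>y\<in>W +>\<^bsub>V\<^esub> x. W +>\<^bsub>V\<^esub> (a \<odot>\<^bsub>V\<^esub> y)) = W +>\<^bsub>V\<^esub> (a \<odot>\<^bsub>V\<^esub> x)"
      by (rule UN_constant_eq[OF W.a_rcos_self[OF x] ballI[OF key]])
    then show ?thesis by (simp add: quotient_space_def)
  qed
  have "Module.module K ?Q"
  proof (rule Module.moduleI)
    show "cring K" ..
    show "abelian_group ?Q" by (fact ag)
  next
    fix a X assume "a \<in> carrier K" "X \<in> carrier ?Q"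
    then show "a \<odot>\<^bsub>?Q\<^esub> X \<in> carrier ?Q"
      using cosetE[of X] by (auto simp: smQ cosetI)
  next
    fix a b X assume "a \<in> carrier K" "b \<in> carrier K" "X \<in> carrier ?Q"
    then show "(a \<oplus>\<^bsub>K\<^esub> b) \<odot>\<^bsub>?Q\<^esub> X = a \<odot>\<^bsub>?Q\<^esub> X \<oplus>\<^bsub>?Q\<^esub> b \<odot>\<^bsub>?Q\<^esub> X"
      using cosetE[of X] by (auto simp: smQ addQ smult_l_distr)
  next
    fix a X Y assume "a \<in> carrier K" "X \<in> carrier ?Q" "Y \<in> carrier ?Q"
    then show "a \<odot>\<^bsub>?Q\<^esub> (X \<oplus>\<^bsub>?Q\<^esub> Y) = a \<odot>\<^bsub>?Q\<^esub> X \<oplus>\<^bsub>?Q\<^esub> a \<odot>\<^bsub>?Q\<^esub> Y"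
      using cosetE[of X] cosetE[of Y] by (auto simp: smQ addQ smult_r_distr)
  next
    fix a b X assume "a \<in> carrier K" "b \<in> carrier K" "X \<in> carrier ?Q"
    then show "(a \<otimes>\<^bsub>K\<^esub> b) \<odot>\<^bsub>?Q\<^esub> X = a \<odot>\<^bsub>?Q\<^esub> (b \<odot>\<^bsub>?Q\<^esub> X)"
      using cosetE[of X] by (auto simp: smQ smult_assoc1)
  next
    fix X assume "X \<in> carrier ?Q"
    then show "\<one>\<^bsub>K\<^esub> \<odot>\<^bsub>?Q\<^esub> X = X"
      using cosetE[of X] by (auto simp: smQ)
  qed
  then show ?thesis
    by (intro vectorspace.intro) (auto simp: field_axioms)
qed


section \<open>The fields of germs and of meromorphic functions\<close>

text \<open>
  In the library \<^const>\<open>meromorphic_on\<close> constrains a function only up to its values on a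
  discrete set, so two representatives are identified when they agree on a punctured
  neighbourhood of each point of \<open>A\<close>. Taking \<open>A = {0}\<close> gives germs at 0; taking
  \<open>A = UNIV\<close> gives meromorphic functions on the plane.
\<close>

definition mero_eq :: "complex set \<Rightarrow> (complex \<Rightarrow> complex) \<Rightarrow> (complex \<Rightarrow> complex) \<Rightarrow> bool" where
  "mero_eq A f g \<longleftrightarrow>
     f meromorphic_on A \<and> g meromorphic_on A \<and> (\<forall>z\<in>A. \<forall>\<^sub>F w in at z. f w = g w)"

lemma part_equivp_mero_eq: "part_equivp (mero_eq A)"
proof (rule part_equivpI)
  show "\<exists>f. mero_eq A f f"
    by (rule exI[of _ "\<lambda>_. 0"]) (auto simp: mero_eq_def)
  show "symp (mero_eq A)"
    by (auto simp: symp_def mero_eq_def eq_commute)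
  show "transp (mero_eq A)"
  proof (rule transpI)
    fix f g h assume *: "mero_eq A f g" "mero_eq A g h"
    have "\<forall>\<^sub>F w in at z. f w = h w" if "z \<in> A" for z
    proof -
      from * that have "\<forall>\<^sub>F w in at z. f w = g w" "\<forall>\<^sub>F w in at z. g w = h w"
        by (auto simp: mero_eq_def)
      then show ?thesis by eventually_elim simp
    qed
    with * show "mero_eq A f h" by (auto simp: mero_eq_def)
  qed
qed

lemma mero_eqI:
  assumes "f meromorphic_on A" "g meromorphic_on A" "\<And>z. f z = g z"
  shows "mero_eq A f g"
  using assms by (auto simp: mero_eq_def)

lemma mero_eq_const: "mero_eq A (\<lambda>_. c) (\<lambda>_. c)"
  by (auto simp: mero_eq_def)

lemma mero_eq_binop:
  assumes "mero_eq A f f'" "mero_eq A g g'"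
    and "(\<lambda>z. b (f z) (g z)) meromorphic_on A" "(\<lambda>z. b (f' z) (g' z)) meromorphic_on A"
  shows "mero_eq A (\<lambda>z. b (f z) (g z)) (\<lambda>z. b (f' z) (g' z))"
proof -
  have "\<forall>\<^sub>F w in at z. b (f w) (g w) = b (f' w) (g' w)" if "z \<in> A" for z
  proof -
    from assms that have "\<forall>\<^sub>F w in at z. f w = f' w" "\<forall>\<^sub>F w in at z. g w = g' w"
      by (auto simp: mero_eq_def)
    then show ?thesis by eventually_elim simp
  qed
  with assms show ?thesis by (auto simp: mero_eq_def)
qed

lemma mero_eq_unop:
  assumes "mero_eq A f f'" and "(\<lambda>z. b (f z)) meromorphic_on A" "(\<lambda>z. b (f' z)) meromorphic_on A"
  shows "mero_eq A (\<lambda>z. b (f z)) (\<lambda>z. b (f' z))"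
  using mero_eq_binop[of A f f' f f' "\<lambda>x _. b x"] assms by blast

lemmas mero_eq_add = mero_eq_binop[where b = "(+)"]
lemmas mero_eq_diff = mero_eq_binop[where b = "(-)"]
lemmas mero_eq_mult = mero_eq_binop[where b = "(*)"]
lemmas mero_eq_divide = mero_eq_binop[where b = "(/)"]
lemmas mero_eq_uminus = mero_eq_unop[where b = uminus]
lemmas mero_eq_inverse = mero_eq_unop[where b = inverse]

lemma mero_eqD:
  assumes "mero_eq A f g"
  shows "f meromorphic_on A" "g meromorphic_on A"
  using assms by (auto simp: mero_eq_def)

lemma eventually_at_scale:
  fixes c :: complex
  assumes "c \<noteq> 0" "\<forall>\<^sub>F w in at (c * z). P w"
  shows "\<forall>\<^sub>F w in at z. P (c * w)"
proof -
  have "filterlim (\<lambda>w. c * w) (at (c * z)) (at z)"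
    using assms(1) by (intro filterlim_atI tendsto_intros) (auto simp: eventually_at_filter)
  with assms(2) show ?thesis by (auto simp: filterlim_iff)
qed

lemma mero_eq_dilate:
  assumes "mero_eq A f g" "c \<noteq> 0" "\<And>z. z \<in> A \<Longrightarrow> c * z \<in> A"
  shows "mero_eq A (\<lambda>z. f (c * z)) (\<lambda>z. g (c * z))"
proof -
  have "(\<lambda>z. h (c * z)) meromorphic_on A" if "h meromorphic_on A" for h
    by (rule meromorphic_on_compose[OF that]) (use assms(3) in \<open>auto intro!: analytic_intros\<close>)
  moreover have "\<forall>\<^sub>F w in at z. f (c * w) = g (c * w)" if "z \<in> A" for z
    using assms that by (intro eventually_at_scale) (auto simp: mero_eq_def)
  ultimately show ?thesis using assms(1) by (auto simp: mero_eq_def)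
qed

lemma mero_eq_mult_dilate:
  assumes "mero_eq A f f" "mero_eq A g g" "c \<noteq> 0" "\<And>z. z \<in> A \<Longrightarrow> c * z \<in> A"
  shows "mero_eq A (\<lambda>z. f (c * z) * g (c * z)) (\<lambda>z. f (c * z) * g (c * z))"
  using mero_eq_dilate[OF assms(1,3,4)] mero_eq_dilate[OF assms(2,3,4)]
  by (intro mero_eqI meromorphic_intros) (auto dest: mero_eqD)

lemma mero_eq_add_dilate:
  assumes "mero_eq A f f" "mero_eq A g g" "c \<noteq> 0" "\<And>z. z \<in> A \<Longrightarrow> c * z \<in> A"
  shows "mero_eq A (\<lambda>z. f (c * z) + g (c * z)) (\<lambda>z. f (c * z) + g (c * z))"
  using mero_eq_dilate[OF assms(1,3,4)] mero_eq_dilate[OF assms(2,3,4)]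
  by (intro mero_eqI meromorphic_intros) (auto dest: mero_eqD)

lemma mero_eq_dilate_dilate:
  assumes "mero_eq A f f" "c \<noteq> 0" "d \<noteq> 0" "\<And>z. z \<in> A \<Longrightarrow> c * d * z \<in> A"
  shows "mero_eq A (\<lambda>z. f (d * (c * z))) (\<lambda>z. f (c * d * z))"
proof -
  have "(\<lambda>z. f (d * (c * z))) = (\<lambda>z. f (c * d * z))"
    by (simp only: mult.assoc mult.left_commute)
  then show ?thesis using mero_eq_dilate[of A f f "c * d"] assms by simp
qed

lemma meromorphic_at_0_or_nonzero:
  assumes "f meromorphic_on {z}"
  shows "(\<forall>\<^sub>F w in at z. f w = 0) \<or> (\<forall>\<^sub>F w in at z. f w \<noteq> 0)"
proof (rule disjCI)
  assume "\<not> (\<forall>\<^sub>F w in at z. f w \<noteq> 0)"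
  then have "\<exists>\<^sub>F w in at z. f w = 0"
    by (simp add: frequently_def)
  then show "\<forall>\<^sub>F w in at z. f w = 0"
    using assms by (intro not_essential_frequently_0_imp_eventually_0) (auto simp: meromorphic_at_iff)
qed

lemma mero_eq_inverse_mult:
  assumes f: "mero_eq A f f" and nz: "\<not> mero_eq A f (\<lambda>_. 0)" and A: "A = {0} \<or> A = UNIV"
  shows "mero_eq A (\<lambda>z. inverse (f z) * f z) (\<lambda>_. 1)"
proof -
  have m: "f meromorphic_on A" using f by (auto simp: mero_eq_def)
  then have dich: "(\<forall>\<^sub>F w in at z. f w = 0) \<or> (\<forall>\<^sub>F w in at z. f w \<noteq> 0)" if "z \<in> A" for z
    using that by (intro meromorphic_at_0_or_nonzero) (auto intro: meromorphic_on_subset)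
  have ev: "\<forall>\<^sub>F w in at z. f w \<noteq> 0" if "z \<in> A" for z
    using A
  proof
    assume "A = {0}"
    with that nz m dich[of 0] show ?thesis by (auto simp: mero_eq_def)
  next
    assume U: "A = UNIV"
    let ?S = "{z. \<forall>\<^sub>F w in at z. f w = 0}" and ?T = "{z. \<forall>\<^sub>F w in at z. f w \<noteq> 0}"
    have op: "open {z :: complex. \<forall>\<^sub>F w in at z. P w}" for P
    proof (rule openI)
      fix z :: complex assume "z \<in> {z. \<forall>\<^sub>F w in at z. P w}"
      then obtain r where r: "r > 0" "\<And>w. w \<in> ball z r - {z} \<Longrightarrow> P w"
        by (auto simp: eventually_at dist_commute)
      have "\<forall>\<^sub>F w in at y. P w" if "y \<in> ball z r" for y
      proof (cases "y = z")
        case True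
        with \<open>z \<in> _\<close> show ?thesis by simp
      next
        case False
        with that have "\<forall>\<^sub>F w in nhds y. w \<in> ball z r - {z}"
          by (intro eventually_nhds_in_open) (auto simp: open_delete)
        then show ?thesis
          using r(2) by (auto simp: eventually_at_filter elim!: eventually_mono)
      qed
      then show "\<exists>e>0. ball z e \<subseteq> {z. \<forall>\<^sub>F w in at z. P w}"
        using r(1) by blast
    qed
    have "?S \<union> ?T = UNIV" using dich U by auto
    moreover have "?S \<inter> ?T = {}"
    proof (rule ccontr)
      assume "?S \<inter> ?T \<noteq> {}"
      then obtain z where "\<forall>\<^sub>F w in at z. f w = 0" "\<forall>\<^sub>F w in at z. f w \<noteq> 0" by auto
      then have "\<forall>\<^sub>F w in at z. False" by eventually_elim simp
      then show False by (simp add: eventually_False trivial_limit_at)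
    qed
    moreover have "?S \<noteq> UNIV" using nz m U by (auto simp: mero_eq_def)
    ultimately have "?S = {}"
      using connected_UNIV[where 'a = complex] op[of "\<lambda>w. f w = 0"] op[of "\<lambda>w. f w \<noteq> 0"]
      unfolding connected_def by blast
    with \<open>?S \<union> ?T = UNIV\<close> show ?thesis by auto
  qed
  have "\<forall>\<^sub>F w in at z. inverse (f w) * f w = 1" if "z \<in> A" for z
    using ev[OF that] by eventually_elim simp
  with m show ?thesis by (auto simp: mero_eq_def intro!: meromorphic_intros)
qed

lemma not_mero_eq_0_1: "A \<noteq> {} \<Longrightarrow> \<not> mero_eq A (\<lambda>_. 0) (\<lambda>_. 1)"
  by (auto simp: mero_eq_def trivial_limit_at)

quotient_type mero_germ = "complex \<Rightarrow> complex" / partial: "mero_eq {0}"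
  by (rule part_equivp_mero_eq)

quotient_type mero_fun = "complex \<Rightarrow> complex" / partial: "mero_eq UNIV"
  by (rule part_equivp_mero_eq)

text \<open>In both dilations the scaling factor 0 is a junk case.\<close>

lift_definition germ_const :: "complex \<Rightarrow> mero_germ" is "\<lambda>c _. c"
  by (rule mero_eq_const)

lift_definition germ_dilate :: "complex \<Rightarrow> mero_germ \<Rightarrow> mero_germ" is
  "\<lambda>c f. if c = 0 then f else (\<lambda>z. f (c * z))"
  by (auto intro: mero_eq_dilate)

lift_definition germ_val :: "mero_germ \<Rightarrow> int" is "\<lambda>f. zorder f 0"
  by (auto simp: mero_eq_def intro: zorder_cong)

lift_definition mero_const :: "complex \<Rightarrow> mero_fun" is "\<lambda>c _. c"
  by (rule mero_eq_const)

lift_definition mero_dilate :: "complex \<Rightarrow> mero_fun \<Rightarrow> mero_fun" is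
  "\<lambda>c f. if c = 0 then f else (\<lambda>z. f (c * z))"
  by (auto intro: mero_eq_dilate)

lift_definition mero_val :: "mero_fun \<Rightarrow> int" is "\<lambda>f. zorder f 0"
  by (auto simp: mero_eq_def intro: zorder_cong)

instantiation mero_germ :: field
begin

lift_definition zero_mero_germ :: mero_germ is "\<lambda>_. 0" by (rule mero_eq_const)
lift_definition one_mero_germ :: mero_germ is "\<lambda>_. 1" by (rule mero_eq_const)
lift_definition plus_mero_germ :: "mero_germ \<Rightarrow> mero_germ \<Rightarrow> mero_germ" is "\<lambda>f g z. f z + g z"
  by (intro mero_eq_add meromorphic_intros) (auto dest: mero_eqD)
lift_definition minus_mero_germ :: "mero_germ \<Rightarrow> mero_germ \<Rightarrow> mero_germ" is "\<lambda>f g z. f z - g z"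
  by (intro mero_eq_diff meromorphic_intros) (auto dest: mero_eqD)
lift_definition uminus_mero_germ :: "mero_germ \<Rightarrow> mero_germ" is "\<lambda>f z. - f z"
  by (intro mero_eq_uminus meromorphic_intros) (auto dest: mero_eqD)
lift_definition times_mero_germ :: "mero_germ \<Rightarrow> mero_germ \<Rightarrow> mero_germ" is "\<lambda>f g z. f z * g z"
  by (intro mero_eq_mult meromorphic_intros) (auto dest: mero_eqD)
lift_definition inverse_mero_germ :: "mero_germ \<Rightarrow> mero_germ" is "\<lambda>f z. inverse (f z)"
  by (intro mero_eq_inverse meromorphic_intros) (auto dest: mero_eqD)
lift_definition divide_mero_germ :: "mero_germ \<Rightarrow> mero_germ \<Rightarrow> mero_germ" is "\<lambda>f g z. f z / g z"
  by (intro mero_eq_divide meromorphic_intros) (auto dest: mero_eqD)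

instance
proof
  fix a :: mero_germ
  show "a \<noteq> 0 \<Longrightarrow> inverse a * a = 1"
    by transfer (intro mero_eq_inverse_mult; simp)
  show "(0 :: mero_germ) \<noteq> 1"
    by transfer (simp add: not_mero_eq_0_1)
qed (transfer; intro mero_eqI meromorphic_intros;
       auto simp: algebra_simps divide_inverse dest: mero_eqD)+

end

instantiation mero_fun :: field
begin

lift_definition zero_mero_fun :: mero_fun is "\<lambda>_. 0" by (rule mero_eq_const)
lift_definition one_mero_fun :: mero_fun is "\<lambda>_. 1" by (rule mero_eq_const)
lift_definition plus_mero_fun :: "mero_fun \<Rightarrow> mero_fun \<Rightarrow> mero_fun" is "\<lambda>f g z. f z + g z"
  by (intro mero_eq_add meromorphic_intros) (auto dest: mero_eqD)
lift_definition minus_mero_fun :: "mero_fun \<Rightarrow> mero_fun \<Rightarrow> mero_fun" is "\<lambda>f g z. f z - g z"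
  by (intro mero_eq_diff meromorphic_intros) (auto dest: mero_eqD)
lift_definition uminus_mero_fun :: "mero_fun \<Rightarrow> mero_fun" is "\<lambda>f z. - f z"
  by (intro mero_eq_uminus meromorphic_intros) (auto dest: mero_eqD)
lift_definition times_mero_fun :: "mero_fun \<Rightarrow> mero_fun \<Rightarrow> mero_fun" is "\<lambda>f g z. f z * g z"
  by (intro mero_eq_mult meromorphic_intros) (auto dest: mero_eqD)
lift_definition inverse_mero_fun :: "mero_fun \<Rightarrow> mero_fun" is "\<lambda>f z. inverse (f z)"
  by (intro mero_eq_inverse meromorphic_intros) (auto dest: mero_eqD)
lift_definition divide_mero_fun :: "mero_fun \<Rightarrow> mero_fun \<Rightarrow> mero_fun" is "\<lambda>f g z. f z / g z"
  by (intro mero_eq_divide meromorphic_intros) (auto dest: mero_eqD)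

instance
proof
  fix a :: mero_fun
  show "a \<noteq> 0 \<Longrightarrow> inverse a * a = 1"
    by transfer (intro mero_eq_inverse_mult; simp)
  show "(0 :: mero_fun) \<noteq> 1"
    by transfer (simp add: not_mero_eq_0_1)
qed (transfer; intro mero_eqI meromorphic_intros;
       auto simp: algebra_simps divide_inverse dest: mero_eqD)+

end

definition fls_dilate :: "complex \<Rightarrow> complex fls \<Rightarrow> complex fls" where
  "fls_dilate c f = fls_compose_fps f (fps_const c * fps_X)"


section \<open>q-difference operators\<close>

text \<open>
  The three coefficient fields are handled uniformly through their structure maps:
  the valuation \<open>v\<close>, the dilations \<open>dil c : f(z) \<mapsto> f(cz)\<close> and the embedding
  \<open>cst\<close> of the constants. The record only bundles these maps.
\<close>

record 'a qfield =
  val :: "'a \<Rightarrow> int"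
  dil :: "complex \<Rightarrow> 'a \<Rightarrow> 'a"
  cst :: "complex \<Rightarrow> 'a"

definition formal_field :: "complex fls qfield" where
  "formal_field = \<lparr>val = fls_subdegree, dil = fls_dilate, cst = fls_const\<rparr>"

definition germ_field :: "mero_germ qfield" where
  "germ_field = \<lparr>val = germ_val, dil = germ_dilate, cst = germ_const\<rparr>"

definition mero_field :: "mero_fun qfield" where
  "mero_field = \<lparr>val = mero_val, dil = mero_dilate, cst = mero_const\<rparr>"

text \<open>
  The valuations are meaningful on nonzero elements only; \<open>v(0) = \<infinity>\<close> is accounted for
  in the definition of the Newton polygon.

  An operator \<open>\<Sum> a\<^sub>i \<sigma>\<^sup>i\<close> is represented by its finitely supported coefficient family
  \<open>a : int \<Rightarrow>\<^sub>0 K\<close>. The multiplication which the library puts on this type is the commutative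
  one and not that of the operator ring; it is not used.
\<close>

type_synonym 'a qdiff_op = "int \<Rightarrow>\<^sub>0 'a"

definition qd_order :: "'a::zero qdiff_op \<Rightarrow> nat" where
  "qd_order P = nat (Max (Poly_Mapping.keys P) - Min (Poly_Mapping.keys P))"

text \<open>Here \<open>\<sigma>\<^sub>q\<^sup>i\<close> is \<open>f(z) \<mapsto> f(q\<^sup>i z)\<close>.\<close>

definition qd_apply :: "'a::field qfield \<Rightarrow> complex \<Rightarrow> 'a qdiff_op \<Rightarrow> 'a \<Rightarrow> 'a" where
  "qd_apply K q P f = (\<Sum>i\<in>Poly_Mapping.keys P. Poly_Mapping.lookup P i * dil K (q powi i) f)"

definition newton_polygon :: "'a::zero qfield \<Rightarrow> 'a qdiff_op \<Rightarrow> (real \<times> real) set" where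
  "newton_polygon K P =
     convex hull {(of_int i, of_int j) |i j. Poly_Mapping.lookup P i \<noteq> 0 \<and> val K (Poly_Mapping.lookup P i) \<le> j}"

definition slopes :: "'a::zero qfield \<Rightarrow> 'a qdiff_op \<Rightarrow> real set" where
  "slopes K P =
     {(y' - y) / (x' - x) |E x y x' y'.
        E edge_of newton_polygon K P \<and> (x, y) \<in> E \<and> (x', y') \<in> E \<and> x \<noteq> x'}"

definition pure_of_slope :: "'a::zero qfield \<Rightarrow> 'a qdiff_op \<Rightarrow> rat \<Rightarrow> bool" where
  "pure_of_slope K P \<mu> \<longleftrightarrow> slopes K P = {of_rat \<mu>}"

definition field_space :: "'a::field qfield \<Rightarrow> (complex, 'a) module" where
  "field_space K =
     \<lparr>carrier = UNIV, monoid.mult = (*), one = 1, ring.zero = 0, add = (+),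
      smult = (\<lambda>c f. cst K c * f)\<rparr>"

definition ker_space :: "'a::field qfield \<Rightarrow> complex \<Rightarrow> 'a qdiff_op \<Rightarrow> (complex, 'a) module" where
  "ker_space K q P =
     (field_space K)\<lparr>carrier := mod_hom.ker (field_space K) (field_space K) (qd_apply K q P)\<rparr>"

definition coker_space ::
    "'a::field qfield \<Rightarrow> complex \<Rightarrow> 'a qdiff_op \<Rightarrow> (complex, 'a set) module" where
  "coker_space K q P =
     quotient_space (field_space K) (mod_hom.im (field_space K) (qd_apply K q P))"

abbreviation fin_dim_C :: "(complex, 'b) module \<Rightarrow> bool" where
  "fin_dim_C V \<equiv> vectorspace.fin_dim complex_ring V"

abbreviation dim_C :: "(complex, 'b) module \<Rightarrow> nat" where
  "dim_C V \<equiv> vectorspace.dim complex_ring V"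

locale qfield_laws =
  fixes K :: "'a::field qfield"
  assumes cst_add: "cst K (a + b) = cst K a + cst K b"
    and cst_mult: "cst K (a * b) = cst K a * cst K b"
    and cst_1: "cst K 1 = 1"
    and dil_add: "c \<noteq> 0 \<Longrightarrow> dil K c (f + g) = dil K c f + dil K c g"
    and dil_mult: "c \<noteq> 0 \<Longrightarrow> dil K c (f * g) = dil K c f * dil K c g"
    and dil_cst: "c \<noteq> 0 \<Longrightarrow> dil K c (cst K a) = cst K a"
    and dil_1: "dil K 1 f = f"
    and dil_dil: "c \<noteq> 0 \<Longrightarrow> d \<noteq> 0 \<Longrightarrow> dil K c (dil K d f) = dil K (c * d) f"
begin

lemma vectorspace_field_space: "vectorspace complex_ring (field_space K)"
proof -
  interpret C: field complex_ring by (rule field_complex_ring)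
  have neg: "\<exists>y. x + y = 0" for x :: 'a
    by (rule exI[of _ "- x"]) simp
  have "Module.module complex_ring (field_space K)"
  proof (rule Module.moduleI)
    show "cring complex_ring" ..
    show "abelian_group (field_space K)"
      by (rule abelian_groupI)
         (simp_all add: field_space_def add.assoc add.commute neg)
  qed (auto simp: field_space_def complex_ring_def cst_add cst_mult cst_1 algebra_simps)
  then show ?thesis by (intro vectorspace.intro) (auto simp: C.field_axioms)
qed

lemma linear_qd_apply:
  assumes "q \<noteq> 0"
  shows "linear_map complex_ring (field_space K) (field_space K) (qd_apply K q P)"
proof -
  have nz: "q powi i \<noteq> 0" for i using assms by simp
  have "qd_apply K q P (f + g) = qd_apply K q P f + qd_apply K q P g" for f g
    unfolding qd_apply_def by (simp only: dil_add[OF nz] distrib_left sum.distrib)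
  moreover have "qd_apply K q P (cst K a * f) = cst K a * qd_apply K q P f" for a f
    unfolding qd_apply_def
    by (simp only: dil_mult[OF nz] dil_cst[OF nz] sum_distrib_left mult.left_commute)
  ultimately have "qd_apply K q P \<in> module_hom complex_ring (field_space K) (field_space K)"
    by (simp add: module_hom_def field_space_def)
  then show ?thesis
    by (rule linear_map.intro[OF vectorspace_field_space vectorspace_field_space
          mod_hom.intro[OF vectorspace.axioms(1)[OF vectorspace_field_space]
            vectorspace.axioms(1)[OF vectorspace_field_space] mod_hom_axioms.intro]])
qed

lemma vectorspace_ker_space:
  assumes "q \<noteq> 0"
  shows "vectorspace complex_ring (ker_space K q P)"
  unfolding ker_space_def
  by (rule vectorspace.subspace_is_vs[OF vectorspace_field_space
        linear_map.kerT_is_subspace[OF linear_qd_apply[OF assms]]])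

lemma vectorspace_coker_space:
  assumes "q \<noteq> 0"
  shows "vectorspace complex_ring (coker_space K q P)"
  unfolding coker_space_def
  by (rule vectorspace_quotient_space[OF vectorspace_field_space
        linear_map.imT_is_subspace[OF linear_qd_apply[OF assms]]])

end

lemma fls_dilate_nth: "c \<noteq> 0 \<Longrightarrow> fls_nth (fls_dilate c f) n = fls_nth f n * c powi n"
  unfolding fls_dilate_def by (rule fls_nth_fls_compose_fps_linear)

lemma qfield_laws_formal: "qfield_laws formal_field"
proof
  fix a b c d :: complex and f g :: "complex fls"
  show "dil formal_field c (f * g) = dil formal_field c f * dil formal_field c g" if "c \<noteq> 0"
    using that by (simp add: formal_field_def fls_dilate_def fls_compose_fps_mult)
  show "dil formal_field c (f + g) = dil formal_field c f + dil formal_field c g" if "c \<noteq> 0"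
    using that by (simp add: formal_field_def fls_eq_iff fls_dilate_nth algebra_simps)
  show "dil formal_field c (cst formal_field a) = cst formal_field a" if "c \<noteq> 0"
    by (simp add: formal_field_def fls_dilate_def)
  show "dil formal_field 1 f = f"
    by (simp add: formal_field_def fls_eq_iff fls_dilate_nth)
  show "dil formal_field c (dil formal_field d f) = dil formal_field (c * d) f"
    if "c \<noteq> 0" "d \<noteq> 0"
    using that by (simp add: formal_field_def fls_eq_iff fls_dilate_nth power_int_mult_distrib)
  show "cst formal_field (a + b) = cst formal_field a + cst formal_field b"
    by (simp add: formal_field_def fls_plus_const)
  show "cst formal_field (a * b) = cst formal_field a * cst formal_field b"
    by (simp add: formal_field_def fls_const_mult_const)
  show "cst formal_field 1 = 1"
    by (simp add: formal_field_def)
qed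

lemma qfield_laws_germ: "qfield_laws germ_field"
proof
  fix a b c d :: complex and f g :: mero_germ
  show "dil germ_field c (f * g) = dil germ_field c f * dil germ_field c g" if "c \<noteq> 0"
    using that unfolding germ_field_def qfield.simps
    by transfer (auto intro: mero_eq_mult_dilate)
  show "dil germ_field c (f + g) = dil germ_field c f + dil germ_field c g" if "c \<noteq> 0"
    using that unfolding germ_field_def qfield.simps
    by transfer (auto intro: mero_eq_add_dilate)
  show "dil germ_field c (cst germ_field a) = cst germ_field a" if "c \<noteq> 0"
    using that unfolding germ_field_def qfield.simps
    by transfer (simp add: mero_eq_const)
  show "dil germ_field 1 f = f"
    unfolding germ_field_def qfield.simps
    by transfer simp
  show "dil germ_field c (dil germ_field d f) = dil germ_field (c * d) f"
    if "c \<noteq> 0" "d \<noteq> 0"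
    using that unfolding germ_field_def qfield.simps
    by transfer (auto intro: mero_eq_dilate_dilate)
  show "cst germ_field (a + b) = cst germ_field a + cst germ_field b"
    unfolding germ_field_def qfield.simps by transfer (rule mero_eq_const)
  show "cst germ_field (a * b) = cst germ_field a * cst germ_field b"
    unfolding germ_field_def qfield.simps by transfer (rule mero_eq_const)
  show "cst germ_field 1 = 1"
    unfolding germ_field_def qfield.simps by transfer (rule mero_eq_const)
qed

lemma qfield_laws_mero: "qfield_laws mero_field"
proof
  fix a b c d :: complex and f g :: mero_fun
  show "dil mero_field c (f * g) = dil mero_field c f * dil mero_field c g" if "c \<noteq> 0"
    using that unfolding mero_field_def qfield.simps
    by transfer (auto intro: mero_eq_mult_dilate)
  show "dil mero_field c (f + g) = dil mero_field c f + dil mero_field c g" if "c \<noteq> 0"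
    using that unfolding mero_field_def qfield.simps
    by transfer (auto intro: mero_eq_add_dilate)
  show "dil mero_field c (cst mero_field a) = cst mero_field a" if "c \<noteq> 0"
    using that unfolding mero_field_def qfield.simps
    by transfer (simp add: mero_eq_const)
  show "dil mero_field 1 f = f"
    unfolding mero_field_def qfield.simps
    by transfer simp
  show "dil mero_field c (dil mero_field d f) = dil mero_field (c * d) f"
    if "c \<noteq> 0" "d \<noteq> 0"
    using that unfolding mero_field_def qfield.simps
    by transfer (auto intro: mero_eq_dilate_dilate)
  show "cst mero_field (a + b) = cst mero_field a + cst mero_field b"
    unfolding mero_field_def qfield.simps by transfer (rule mero_eq_const)
  show "cst mero_field (a * b) = cst mero_field a * cst mero_field b"
    unfolding mero_field_def qfield.simps by transfer (rule mero_eq_const)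
  show "cst mero_field 1 = 1"
    unfolding mero_field_def qfield.simps by transfer (rule mero_eq_const)
qed

end

theory Submission
  imports Defs
begin

text \<open>
  Purity of slope \<open>\<mu> \<noteq> 0\<close> makes the valuation of one extreme coefficient strictly minimal: that of
  the lowest coefficient if \<open>\<mu> > 0\<close>, of the highest one if \<open>\<mu> < 0\<close>. After division by this
  coefficient the operator is triangular with invertible diagonal on Laurent series, hence bijective.
  If \<open>\<mu> < 0\<close>, the triangular recursion only involves contracting dilations relative to the diagonal,
  and a majorant argument shows that solutions converge. If \<open>\<mu> > 0\<close>, the top term
  \<open>a\<^sub>n \<sigma>\<^sup>n\<close> dominates analytically: with \<open>R = r |q|\<^sup>n\<close>, it maps series bounded on the scale \<open>R\<close> to
  series bounded on the scale \<open>r\<close>, and on \<open>z\<^sup>N C{z}\<close> with \<open>N\<close> large the other terms are a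
  small perturbation of it. Its leading monomial shifts degrees by \<open>d = n\<mu>\<close>, so the operator
  is invertible up to exactly \<open>d\<close> coefficients, and \<open>z\<^sup>N, \<dots>, z\<^bsup>N+d-1\<^esup>\<close> is a basis of the cokernel.

  The convergent fields embed into Laurent series by Laurent expansion at 0. Solving the equation
  for its top term continues a germ of solution meromorphically from a disc to one that is \<open>|q|\<close>
  times larger, so meromorphic functions on the plane have the same kernel and cokernel as germs.
\<close>

section \<open>The Newton polygon of a pure operator\<close>

text \<open>The operator is never factored into operators of order one, so a non-integral slope
  costs nothing: only the integer \<open>n * \<mu>\<close>, the difference of the valuations of the
  two extreme coefficients, enters. For positive slope the obstacle is that radii of convergence are
  not uniform. The order \<open>N\<close> from which the operator is a small perturbation of its top
  term depends on the radius of the data, whereas a basis of the cokernel must serve all right-hand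
  sides at once. Two facts repair this. A right-hand side is solved at an order adapted to its own
  radius; what is left over is a polynomial, which is bounded at every scale and can be solved again
  at a fixed radius and a fixed \<open>N\<close>. Conversely, a convergent solution with polynomial
  right-hand side has an unknown radius at the start, but the equation itself enlarges it, by a
  factor \<open>|q|\<close> at a time, up to the scale on which uniqueness holds.\<close>

lemma inner_normal_real_pair: "(-m, 1 :: real) \<bullet> (x, y) = y - m * (x :: real)"
  by (simp add: inner_prod_def)

text \<open>A line below all coefficient points supports the polygon, so it cuts out a face. Two
  contact points with different abscissas give this face dimension at least one, and lying on a line
  gives at most one: it is an edge.\<close>

lemma supporting_line_imp_slope:
  fixes K :: "'a::zero qfield" and m c :: real
  assumes above: "\<And>i. i \<in> Poly_Mapping.keys P \<Longrightarrow>
      of_int (val K (Poly_Mapping.lookup P i)) \<ge> c + m * of_int i"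
    and i: "i \<in> Poly_Mapping.keys P" "of_int (val K (Poly_Mapping.lookup P i)) = c + m * of_int i"
    and j: "j \<in> Poly_Mapping.keys P" "of_int (val K (Poly_Mapping.lookup P j)) = c + m * of_int j"
    and "i \<noteq> j"
  shows "m \<in> slopes K P"
proof -
  define N where "N = newton_polygon K P"
  define E where "E = N \<inter> {x. (-m, 1 :: real) \<bullet> x = c}"
  define p where "p k = (real_of_int k, real_of_int (val K (Poly_Mapping.lookup P k)))" for k
  have "N \<subseteq> {x. (-m, 1 :: real) \<bullet> x \<ge> c}"
    unfolding N_def newton_polygon_def
  proof (rule hull_minimal)
    show "convex {x. (-m, 1 :: real) \<bullet> x \<ge> c}" by (rule convex_halfspace_ge)
    show "{(of_int i, of_int j) |i j. Poly_Mapping.lookup P i \<noteq> 0 \<and> val K (Poly_Mapping.lookup P i) \<le> j}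
        \<subseteq> {x. (-m, 1 :: real) \<bullet> x \<ge> c}"
    proof clarify
      fix i j assume "Poly_Mapping.lookup P i \<noteq> 0" "val K (Poly_Mapping.lookup P i) \<le> j"
      then show "c \<le> (-m, 1 :: real) \<bullet> (real_of_int i, real_of_int j)"
        using above[of i] unfolding inner_normal_real_pair by (simp add: in_keys_iff)
    qed
  qed
  then have face: "E face_of N"
    unfolding E_def by (intro face_of_Int_supporting_hyperplane_ge)
      (auto simp: N_def newton_polygon_def convex_convex_hull)
  have mem: "p k \<in> E" if "k \<in> Poly_Mapping.keys P"
    "of_int (val K (Poly_Mapping.lookup P k)) = c + m * of_int k" for k
  proof -
    have "p k \<in> N"
      unfolding N_def newton_polygon_def p_def using that(1) by (intro hull_inc) (auto simp: in_keys_iff)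
    then show ?thesis using that(2) by (simp add: E_def p_def inner_normal_real_pair)
  qed
  have "aff_dim E \<le> aff_dim {x. (-m, 1 :: real) \<bullet> x = c}"
    by (intro aff_dim_subset) (auto simp: E_def)
  also have "\<dots> = 1" by (subst aff_dim_hyperplane) (auto simp: zero_prod_def)
  finally have "aff_dim E \<le> 1" .
  moreover have "aff_dim {p i, p j} \<le> aff_dim E"
    using mem[OF i] mem[OF j] by (intro aff_dim_subset) auto
  moreover have "aff_dim {p i, p j} = 1" using \<open>i \<noteq> j\<close> by (simp add: aff_dim_2 p_def)
  ultimately have "E edge_of N" using face by (simp add: edge_of_def)
  moreover have "(snd (p j) - snd (p i)) / (fst (p j) - fst (p i)) = m"
    using \<open>i \<noteq> j\<close> i(2) j(2) by (simp add: p_def field_simps)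
  ultimately show ?thesis
    using mem[OF i] mem[OF j] \<open>i \<noteq> j\<close> unfolding slopes_def N_def[symmetric] p_def mem_Collect_eq
    by (metis fst_conv snd_conv of_int_eq_iff)
qed

text \<open>With one support index the polygon lies on a vertical line and has no two points of
  different abscissas; with none it is empty.\<close>

lemma slopes_imp_two_keys:
  assumes "m \<in> slopes K P"
  shows "Poly_Mapping.keys P \<noteq> {}" "Min (Poly_Mapping.keys P) < Max (Poly_Mapping.keys P)"
proof -
  from assms obtain E x y x' y' where E: "E edge_of newton_polygon K P" "(x, y) \<in> E" "(x', y') \<in> E" "x \<noteq> x'"
    unfolding slopes_def by blast
  then have mem: "(x, y) \<in> newton_polygon K P" "(x', y') \<in> newton_polygon K P"
    using edge_of_imp_subset by blast+
  then show ne: "Poly_Mapping.keys P \<noteq> {}"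
    unfolding newton_polygon_def by (auto simp: in_keys_iff)
  show "Min (Poly_Mapping.keys P) < Max (Poly_Mapping.keys P)"
  proof (rule ccontr)
    define a where "a = Min (Poly_Mapping.keys P)"
    assume "\<not> Min (Poly_Mapping.keys P) < Max (Poly_Mapping.keys P)"
    then have all: "k = a" if "k \<in> Poly_Mapping.keys P" for k
      using that Min_le[of "Poly_Mapping.keys P" k] Max_ge[of "Poly_Mapping.keys P" k]
      by (force simp: a_def simp del: Min_le Max_ge)
    have "newton_polygon K P \<subseteq> {x. (1, 0 :: real) \<bullet> x = real_of_int a}"
      unfolding newton_polygon_def
    proof (rule hull_minimal)
      show "convex {x. (1, 0 :: real) \<bullet> x = real_of_int a}" by (rule convex_hyperplane)
    qed (use all in \<open>auto simp: in_keys_iff\<close>)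
    from subsetD[OF this mem(1)] subsetD[OF this mem(2)] E(4) show False by simp
  qed
qed

text \<open>The lower boundary leaves its left end along the chord of least slope and reaches its
  right end along the chord of greatest slope. Both are slopes of the operator, hence both equal
  \<open>\<mu>\<close>. The first puts all points above the line of slope \<open>\<mu>\<close>
  through the left end, the second puts the right end below it.\<close>

lemma pure_of_slope_val:
  fixes K :: "'a::zero qfield"
  defines "a P \<equiv> Min (Poly_Mapping.keys P)" and "b P \<equiv> Max (Poly_Mapping.keys P)"
    and "v P i \<equiv> real_of_int (val K (Poly_Mapping.lookup P i))"
  assumes pure: "pure_of_slope K P \<mu>"
  shows "a P \<in> Poly_Mapping.keys P" "b P \<in> Poly_Mapping.keys P" "a P < b P"
    and "v P (b P) = v P (a P) + of_rat \<mu> * (b P - a P)"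
    and "\<And>i. i \<in> Poly_Mapping.keys P \<Longrightarrow> v P i \<ge> v P (a P) + of_rat \<mu> * (i - a P)"
proof -
  define m where "m = (of_rat \<mu> :: real)"
  have sl: "slopes K P = {m}" using pure by (simp add: pure_of_slope_def m_def)
  note two = slopes_imp_two_keys[of m K P, unfolded sl]
  have ne: "Poly_Mapping.keys P \<noteq> {}" using two by simp
  show a: "a P \<in> Poly_Mapping.keys P" and b: "b P \<in> Poly_Mapping.keys P"
    using ne by (auto simp: a_def b_def)
  show ab: "a P < b P" using two by (simp add: a_def b_def)
  define A where "A = Poly_Mapping.keys P - {a P}"
  define B where "B = Poly_Mapping.keys P - {b P}"
  have A: "finite A" "b P \<in> A" and B: "finite B" "a P \<in> B" using a b ab by (auto simp: A_def B_def)
  have A_gt: "i > a P" if "i \<in> A" for i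
    using that Min_le[of "Poly_Mapping.keys P" i] unfolding A_def a_def by fastforce
  have B_lt: "i < b P" if "i \<in> B" for i
    using that Max_ge[of "Poly_Mapping.keys P" i] unfolding B_def b_def by fastforce
  define s where "s i = (v P i - v P (a P)) / (i - a P)" for i
  define t where "t i = (v P (b P) - v P i) / (b P - i)" for i
  obtain i0 where i0: "i0 \<in> A" "\<And>i. i \<in> A \<Longrightarrow> s i0 \<le> s i"
    using A by (metis arg_min_if_finite(1) arg_min_least empty_iff)
  obtain j0 where j0: "j0 \<in> B" "\<And>j. j \<in> B \<Longrightarrow> - t j0 \<le> - t j"
    using arg_min_if_finite(1)[of B "\<lambda>j. - t j"] arg_min_least[of B _ "\<lambda>j. - t j"] B by blast
  have "s i0 \<in> slopes K P"
  proof (rule supporting_line_imp_slope[where i = "a P" and j = i0 and c = "v P (a P) - s i0 * a P"])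
    show "real_of_int (val K (Poly_Mapping.lookup P i)) \<ge> v P (a P) - s i0 * a P + s i0 * of_int i"
      if "i \<in> Poly_Mapping.keys P" for i
    proof (cases "i = a P")
      case False
      with that have "i \<in> A" by (auto simp: A_def)
      from i0(2)[OF this] A_gt[OF this] show ?thesis
        unfolding s_def[of i] by (simp add: field_simps v_def)
    qed (simp add: v_def)
    show "real_of_int (val K (Poly_Mapping.lookup P i0)) = v P (a P) - s i0 * a P + s i0 * of_int i0"
    proof -
      have "s i0 * (i0 - a P) = v P i0 - v P (a P)" using A_gt[OF i0(1)] by (simp add: s_def)
      then show ?thesis by (simp add: v_def algebra_simps)
    qed
  qed (use i0(1) a A_gt in \<open>auto simp: A_def v_def\<close>)
  then have s0: "s i0 = m" using sl by simp
  have "t j0 \<in> slopes K P"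
  proof (rule supporting_line_imp_slope[where i = "b P" and j = j0 and c = "v P (b P) - t j0 * b P"])
    show "real_of_int (val K (Poly_Mapping.lookup P i)) \<ge> v P (b P) - t j0 * b P + t j0 * of_int i"
      if "i \<in> Poly_Mapping.keys P" for i
    proof (cases "i = b P")
      case False
      with that have "i \<in> B" by (auto simp: B_def)
      from j0(2)[OF this] B_lt[OF this] show ?thesis
        unfolding t_def[of i] by (simp add: field_simps v_def)
    qed (simp add: v_def)
    show "real_of_int (val K (Poly_Mapping.lookup P j0)) = v P (b P) - t j0 * b P + t j0 * of_int j0"
    proof -
      have "t j0 * (b P - j0) = v P (b P) - v P j0" using B_lt[OF j0(1)] by (simp add: t_def)
      then show ?thesis by (simp add: v_def algebra_simps)
    qed
  qed (use j0(1) b B_lt in \<open>auto simp: B_def v_def\<close>)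
  then have t0: "t j0 = m" using sl by simp
  have lower: "v P i \<ge> v P (a P) + m * (i - a P)" if "i \<in> Poly_Mapping.keys P" for i
  proof (cases "i = a P")
    case False
    with that have "i \<in> A" by (auto simp: A_def)
    from i0(2)[OF this] A_gt[OF this] show ?thesis
      unfolding s0 s_def[of i] by (simp add: field_simps)
  qed simp
  then show "v P i \<ge> v P (a P) + of_rat \<mu> * (i - a P)" if "i \<in> Poly_Mapping.keys P" for i
    using that unfolding m_def by simp
  have "v P (a P) \<ge> v P (b P) - m * (b P - a P)"
    using j0(2)[OF B(2)] ab unfolding t0 t_def[of "a P"] by (simp add: field_simps)
  with lower[OF b] show "v P (b P) = v P (a P) + of_rat \<mu> * (b P - a P)"
    unfolding m_def by simp
qed

section \<open>Dimensions of kernels and cokernels\<close>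

context qfield_laws
begin

lemma cst_0: "cst K 0 = 0"
  using cst_add[of 0 0] by (metis add_0 add_cancel_right_right)

lemma cst_uminus: "cst K (- a) = - cst K a"
  using cst_add[of "- a" a] by (simp add: cst_0 eq_neg_iff_add_eq_0)

lemma qd_apply_add: "q \<noteq> 0 \<Longrightarrow> qd_apply K q P (f + g) = qd_apply K q P f + qd_apply K q P g"
  unfolding qd_apply_def by (simp add: dil_add distrib_left sum.distrib)

lemma qd_apply_0: "q \<noteq> 0 \<Longrightarrow> qd_apply K q P 0 = 0"
  using qd_apply_add[of q P 0 0] by (metis add_0 add_cancel_right_right)

lemma qd_apply_cst_mult: "q \<noteq> 0 \<Longrightarrow> qd_apply K q P (cst K a * f) = cst K a * qd_apply K q P f"
  unfolding qd_apply_def by (simp add: dil_mult dil_cst sum_distrib_left mult.left_commute)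

lemma mod_hom_qd_apply:
  "q \<noteq> 0 \<Longrightarrow> mod_hom complex_ring (field_space K) (field_space K) (qd_apply K q P)"
  using linear_qd_apply[of q P] by (simp add: linear_map_def)

lemma ker_space_trivial:
  assumes q: "q \<noteq> 0" and inj: "\<And>f. qd_apply K q P f = 0 \<Longrightarrow> f = 0"
  shows "fin_dim_C (ker_space K q P)" "dim_C (ker_space K q P) = 0"
proof -
  interpret V: vectorspace complex_ring "ker_space K q P" by (rule vectorspace_ker_space[OF q])
  have carrier: "carrier (ker_space K q P) = {0}"
    using inj qd_apply_0[OF q, of P]
    unfolding ker_space_def mod_hom.ker_def[OF mod_hom_qd_apply[OF q]] by (auto simp: field_space_def)
  have "V.span {} = {\<zero>\<^bsub>ker_space K q P\<^esub>}" by (rule V.span_empty)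
  then have gen: "carrier (ker_space K q P) = V.span {}"
    by (simp add: carrier) (simp add: ker_space_def field_space_def)
  then show "fin_dim_C (ker_space K q P)" unfolding V.fin_dim_def by (intro exI[of _ "{}"]) simp
  have "V.dim \<le> card ({} :: 'a set)" by (rule V.gen_ge_dim) (use gen in blast)+
  then show "dim_C (ker_space K q P) = 0" by simp
qed

text \<open>Reduces the dimension of the quotient to two concrete statements about solving
  equations: the two hypotheses say that the classes of the \<open>e j\<close> span and are
  independent.\<close>

lemma coker_space_dim:
  fixes e :: "nat \<Rightarrow> 'a"
  assumes q: "q \<noteq> 0"
    and span: "\<And>g. \<exists>f c. g = qd_apply K q P f + (\<Sum>j<d. cst K (c j) * e j)"
    and indep: "\<And>f c. qd_apply K q P f = (\<Sum>j<d. cst K (c j) * e j) \<Longrightarrow> \<forall>j<d. c j = 0"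
  shows "fin_dim_C (coker_space K q P)" "dim_C (coker_space K q P) = d"
proof -
  define V where "V = field_space K"
  define W where "W = range (qd_apply K q P)"
  define Q where "Q = coker_space K q P"
  interpret Q: vectorspace complex_ring Q
    unfolding Q_def by (rule vectorspace_coker_space[OF q])
  define cl where "cl g = (\<lambda>w. w + g) ` W" for g
  have W_0: "0 \<in> W" using qd_apply_0[OF q, of P] by (auto simp: W_def intro!: image_eqI[of _ _ 0])
  have W_add: "x + y \<in> W" if "x \<in> W" "y \<in> W" for x y
    using that qd_apply_add[OF q, of P] by (auto simp: W_def) (metis rangeI)
  have W_smult: "cst K a * x \<in> W" if "x \<in> W" for x a
    using that qd_apply_cst_mult[OF q, of P] by (auto simp: W_def) (metis rangeI)
  have W_uminus: "- x \<in> W" if "x \<in> W" for x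
    using W_smult[OF that, of "-1"] by (simp add: cst_uminus cst_1)
  have W_diff: "x - y \<in> W" if "x \<in> W" "y \<in> W" for x y
    using W_add[OF that(1) W_uminus[OF that(2)]] by simp
  have coset: "W +>\<^bsub>V\<^esub> g = cl g" for g
    by (auto simp: a_r_coset_def' cl_def V_def field_space_def)
  have im: "mod_hom.im V (qd_apply K q P) = W"
    unfolding V_def mod_hom.im_def[OF mod_hom_qd_apply[OF q]] W_def by (simp add: field_space_def)
  have cl_eq_iff: "cl g = cl h \<longleftrightarrow> g - h \<in> W" for g h
  proof
    assume "cl g = cl h"
    moreover have "g \<in> cl g" using W_0 by (force simp: cl_def)
    ultimately show "g - h \<in> W" by (auto simp: cl_def)
  next
    assume gh: "g - h \<in> W"
    have "cl g \<subseteq> cl h"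
    proof
      fix x assume "x \<in> cl g"
      then obtain w where "w \<in> W" "x = w + g" by (auto simp: cl_def)
      then show "x \<in> cl h" using W_add[OF \<open>w \<in> W\<close> gh] by (auto simp: cl_def intro!: image_eqI[of _ _ "w + (g - h)"])
    qed
    moreover have "cl h \<subseteq> cl g"
    proof
      fix x assume "x \<in> cl h"
      then obtain w where "w \<in> W" "x = w + h" by (auto simp: cl_def)
      then show "x \<in> cl g" using W_diff[OF \<open>w \<in> W\<close> gh] by (auto simp: cl_def intro!: image_eqI[of _ _ "w - (g - h)"])
    qed
    ultimately show "cl g = cl h" by blast
  qed
  have Q_eq: "Q = quotient_space V W" by (simp add: Q_def coker_space_def V_def[symmetric] im)
  have Q_carrier: "carrier Q = range cl"
    unfolding Q_eq quotient_space_def using coset by (auto simp: A_RCOSETS_def' V_def field_space_def)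
  have Q_zero: "\<zero>\<^bsub>Q\<^esub> = cl 0" by (simp add: Q_eq quotient_space_def cl_def)
  have Q_add: "cl g \<oplus>\<^bsub>Q\<^esub> cl h = cl (g + h)" for g h
  proof -
    have "cl g \<oplus>\<^bsub>Q\<^esub> cl h = {x + y |x y. x \<in> cl g \<and> y \<in> cl h}"
      by (auto simp: Q_eq quotient_space_def set_add_def' V_def field_space_def)
    also have "\<dots> = cl (g + h)"
    proof (intro Set.set_eqI iffI)
      fix z assume "z \<in> {x + y |x y. x \<in> cl g \<and> y \<in> cl h}"
      then obtain w w' where "w \<in> W" "w' \<in> W" "z = (w + w') + (g + h)" by (auto simp: cl_def algebra_simps)
      then show "z \<in> cl (g + h)" by (auto simp: cl_def intro!: image_eqI[of _ _ "w + w'"] W_add)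
    next
      fix z assume "z \<in> cl (g + h)"
      then obtain w where "w \<in> W" "z = (w + g) + (0 + h)" by (auto simp: cl_def algebra_simps)
      moreover have "w + g \<in> cl g" "0 + h \<in> cl h" using \<open>w \<in> W\<close> W_0 unfolding cl_def by blast+
      ultimately show "z \<in> {x + y |x y. x \<in> cl g \<and> y \<in> cl h}" by blast
    qed
    finally show ?thesis .
  qed
  have Q_smult: "a \<odot>\<^bsub>Q\<^esub> cl g = cl (cst K a * g)" for a g
  proof -
    have "a \<odot>\<^bsub>Q\<^esub> cl g = (\<Union>x\<in>cl g. cl (cst K a * x))"
      by (simp add: Q_eq quotient_space_def coset) (simp add: V_def field_space_def)
    moreover have "cl (cst K a * x) = cl (cst K a * g)" if "x \<in> cl g" for x
    proof -
      obtain w where "w \<in> W" "x = w + g" using \<open>x \<in> cl g\<close> by (auto simp: cl_def)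
      then show ?thesis unfolding cl_eq_iff using W_smult[of w a] by (simp add: algebra_simps)
    qed
    moreover have "g \<in> cl g" using W_0 by (force simp: cl_def)
    ultimately show ?thesis by blast
  qed
  have finsum_cl: "(\<Oplus>\<^bsub>Q\<^esub>j\<in>J. cl (x j)) = cl (\<Sum>j\<in>J. x j)" if "finite J" for J :: "nat set" and x
    using that
  proof (induction J)
    case empty
    then show ?case by (simp add: Q_zero)
  next
    case (insert j J)
    have "(\<Oplus>\<^bsub>Q\<^esub>j\<in>insert j J. cl (x j)) = cl (x j) \<oplus>\<^bsub>Q\<^esub> (\<Oplus>\<^bsub>Q\<^esub>j\<in>J. cl (x j))"
      using insert.hyps by (intro Q.finsum_insert) (auto simp: Q_carrier)
    with insert show ?case by (simp add: Q_add)
  qed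
  \<comment> \<open>A basis is a set, so its cardinality is \<open>d\<close> only if the classes are
    pairwise distinct. If two coincided, \<open>e i - e j\<close> would lie in the image, a relation
    with coefficients 1 and -1.\<close>
  have inj: "inj_on (\<lambda>j. cl (e j)) {..<d}"
  proof (rule inj_onI, rule ccontr)
    fix i j assume ij: "i \<in> {..<d}" "j \<in> {..<d}" "cl (e i) = cl (e j)" "i \<noteq> j"
    then obtain f where f: "qd_apply K q P f = e i - e j" by (auto simp: cl_eq_iff W_def)
    define c :: "nat \<Rightarrow> complex" where "c k = (if k = i then 1 else if k = j then - 1 else 0)" for k
    have "(\<Sum>k<d. cst K (c k) * e k) = (\<Sum>k\<in>{i, j}. cst K (c k) * e k)"
      using ij by (intro sum.mono_neutral_right) (auto simp: c_def cst_0)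
    also have "\<dots> = e i - e j" using ij by (simp add: c_def cst_uminus cst_1)
    finally have "c i = 0" using indep[of f c] ij(1) f by auto
    then show False by (simp add: c_def)
  qed
  define B where "B = (\<lambda>j. cl (e j)) ` {..<d}"
  have B: "finite B" "B \<subseteq> carrier Q" "card B = d"
    using card_image[OF inj] by (auto simp: B_def Q_carrier)
  have lincomb: "Q.lincomb a B = cl (\<Sum>j<d. cst K (a (cl (e j))) * e j)" for a
  proof -
    have "Q.lincomb a B = (\<Oplus>\<^bsub>Q\<^esub>X\<in>B. a X \<odot>\<^bsub>Q\<^esub> X)" by (rule Q.lincomb_def)
    also have "\<dots> = (\<Oplus>\<^bsub>Q\<^esub>j\<in>{..<d}. a (cl (e j)) \<odot>\<^bsub>Q\<^esub> cl (e j))"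
      unfolding B_def by (rule Q.finsum_reindex[OF _ inj]) (auto simp: Q_carrier Q_smult)
    also have "\<dots> = (\<Oplus>\<^bsub>Q\<^esub>j\<in>{..<d}. cl (cst K (a (cl (e j))) * e j))"
      by (simp only: Q_smult)
    finally show ?thesis by (simp add: finsum_cl)
  qed
  have indpt: "\<not> Q.lin_dep B"
  proof (rule Q.finite_lin_indpt2[OF B(1,2)])
    fix a assume "a \<in> B \<rightarrow> carrier complex_ring" "Q.lincomb a B = \<zero>\<^bsub>Q\<^esub>"
    then have "(\<Sum>j<d. cst K (a (cl (e j))) * e j) \<in> W"
      by (simp add: lincomb Q_zero cl_eq_iff)
    then obtain f where "qd_apply K q P f = (\<Sum>j<d. cst K (a (cl (e j))) * e j)" by (auto simp: W_def)
    from indep[OF this] show "\<forall>v\<in>B. a v = \<zero>\<^bsub>complex_ring\<^esub>"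
      by (auto simp: B_def complex_ring_def)
  qed
  have "carrier Q \<subseteq> Q.span B"
  proof
    fix X assume "X \<in> carrier Q"
    then obtain g where X: "X = cl g" by (auto simp: Q_carrier)
    obtain f c where g: "g = qd_apply K q P f + (\<Sum>j<d. cst K (c j) * e j)" using span by blast
    define a where "a = c \<circ> the_inv_into {..<d} (\<lambda>j. cl (e j))"
    have a: "a (cl (e j)) = c j" if "j < d" for j
      unfolding a_def using the_inv_into_f_f[OF inj] that by simp
    have "Q.lincomb a B = cl (\<Sum>j<d. cst K (c j) * e j)" unfolding lincomb by (simp add: a)
    also have "\<dots> = X" unfolding X cl_eq_iff g using W_uminus by (auto simp: W_def)
    finally show "X \<in> Q.span B"
      unfolding Q.finite_span[OF B(1,2)] by (force simp: complex_ring_def)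
  qed
  then have gen: "Q.span B = carrier Q" using Q.span_is_subset2[OF B(2)] by blast
  show "fin_dim_C (coker_space K q P)"
    using B gen unfolding Q_def[symmetric] Q.fin_dim_def by blast
  show "dim_C (coker_space K q P) = d"
    using Q.dim_basis[OF B(1)] indpt gen B unfolding Q_def[symmetric] Q.basis_def by simp
qed

end

section \<open>Geometrically bounded power series\<close>

text \<open>Cauchy estimates at radius \<open>s\<close>. Compared with convergence on a disc, this
  condition is transported exactly by dilations and is a weighted sup norm, in which contraction
  arguments can be run coefficientwise.\<close>

definition geom_bounded :: "real \<Rightarrow> complex fps \<Rightarrow> bool" where
  "geom_bounded s \<phi> \<longleftrightarrow> (\<exists>C. \<forall>k. norm (fps_nth \<phi> k) * s ^ k \<le> C)"

lemma geom_boundedI: "(\<And>k. norm (fps_nth \<phi> k) * s ^ k \<le> C) \<Longrightarrow> geom_bounded s \<phi>"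
  by (auto simp: geom_bounded_def)

lemma geom_bounded_mono:
  assumes "geom_bounded s \<phi>" "0 \<le> t" "t \<le> s"
  shows "geom_bounded t \<phi>"
proof -
  obtain C where C: "\<And>k. norm (fps_nth \<phi> k) * s ^ k \<le> C" using assms(1) by (auto simp: geom_bounded_def)
  have "norm (fps_nth \<phi> k) * t ^ k \<le> C" for k
    by (rule order_trans[OF _ C[of k]]) (intro mult_left_mono power_mono assms norm_ge_zero)
  then show ?thesis by (rule geom_boundedI)
qed

lemma geom_bounded_0 [simp]: "geom_bounded s 0"
  by (auto simp: geom_bounded_def)

lemma geom_bounded_add:
  assumes "geom_bounded s f" "geom_bounded s g" "0 \<le> s"
  shows "geom_bounded s (f + g)"
proof -
  obtain C where C: "\<And>k. norm (fps_nth f k) * s ^ k \<le> C" using assms(1) by (auto simp: geom_bounded_def)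
  obtain D where D: "\<And>k. norm (fps_nth g k) * s ^ k \<le> D" using assms(2) by (auto simp: geom_bounded_def)
  have "norm (fps_nth (f + g) k) * s ^ k \<le> C + D" for k
  proof -
    have "norm (fps_nth (f + g) k) * s ^ k \<le> (norm (fps_nth f k) + norm (fps_nth g k)) * s ^ k"
      using assms(3) by (intro mult_right_mono) (auto intro: norm_triangle_ineq)
    with C[of k] D[of k] show ?thesis by (simp add: distrib_right)
  qed
  then show ?thesis by (rule geom_boundedI)
qed

lemma geom_bounded_uminus: "geom_bounded s f \<Longrightarrow> geom_bounded s (- f)"
  by (simp add: geom_bounded_def)

lemma geom_bounded_diff:
  assumes "geom_bounded s f" "geom_bounded s g" "0 \<le> s"
  shows "geom_bounded s (f - g)"
  using geom_bounded_add[OF assms(1) geom_bounded_uminus[OF assms(2)] assms(3)] by simp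

lemma geom_bounded_sum:
  assumes "\<And>i. i \<in> I \<Longrightarrow> geom_bounded s (f i)" "0 \<le> s"
  shows "geom_bounded s (sum f I)"
  using assms(1) by (induction I rule: infinite_finite_induct) (auto intro: geom_bounded_add assms(2))

text \<open>Polynomials are bounded at every scale; this decouples polynomial remainders from the
  radius of the series they come from.\<close>

lemma geom_bounded_eventually_0:
  assumes "\<And>k. k > m \<Longrightarrow> fps_nth f k = 0"
  shows "geom_bounded s f"
proof -
  have "norm (fps_nth f k) * s ^ k \<le> Max (insert 0 ((\<lambda>k. norm (fps_nth f k) * s ^ k) ` {..m}))" for k
    by (cases "k \<le> m") (auto simp: assms simp del: Max_insert intro!: Max_ge)
  then show ?thesis by (rule geom_boundedI)
qed

section \<open>Estimates for products and convolution recursions\<close>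

text \<open>Young's inequality for a weighted l1 norm times a weighted sup norm. The l1 norm enters
  only through the partial sum up to \<open>m\<close>, so no summability has to be
  established.\<close>

lemma norm_fps_mult_nth_le:
  fixes b \<phi> :: "complex fps"
  assumes "(\<Sum>k\<le>m. norm (fps_nth b k) * t ^ k) \<le> K" "\<And>k. norm (fps_nth \<phi> k) * t ^ k \<le> C"
    and t: "0 \<le> t"
  shows "norm (fps_nth (b * \<phi>) m) * t ^ m \<le> K * C"
proof -
  have C: "C \<ge> 0" using order_trans[OF norm_ge_zero, of "fps_nth \<phi> 0" C] assms(2)[of 0] by simp
  have "norm (fps_nth (b * \<phi>) m) * t ^ m \<le> (\<Sum>k\<le>m. norm (fps_nth b k * fps_nth \<phi> (m - k))) * t ^ m"
    unfolding fps_mult_nth atMost_atLeast0 using t by (intro mult_right_mono norm_sum) auto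
  also have "\<dots> = (\<Sum>k\<le>m. (norm (fps_nth b k) * t ^ k) * (norm (fps_nth \<phi> (m - k)) * t ^ (m - k)))"
    unfolding sum_distrib_right
  proof (rule sum.cong[OF refl])
    fix k assume "k \<in> {..m}"
    then have "t ^ m = t ^ k * t ^ (m - k)" by (simp flip: power_add)
    then show "norm (fps_nth b k * fps_nth \<phi> (m - k)) * t ^ m =
        (norm (fps_nth b k) * t ^ k) * (norm (fps_nth \<phi> (m - k)) * t ^ (m - k))"
      by (simp add: norm_mult)
  qed
  also have "\<dots> \<le> (\<Sum>k\<le>m. (norm (fps_nth b k) * t ^ k) * C)"
    using t by (intro sum_mono mult_left_mono assms(2)) auto
  also have "\<dots> \<le> K * C"
    unfolding sum_distrib_right[symmetric] by (intro mult_right_mono assms(1) C)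
  finally show ?thesis .
qed

lemma sum_power_half_le: "(\<Sum>k\<le>m. (x::real) ^ k) \<le> 2" if "0 \<le> x" "x \<le> 1/2"
proof -
  have "(\<Sum>k\<le>m. x ^ k) \<le> (\<Sum>k\<le>m. (1/2) ^ k)" by (intro sum_mono power_mono that)
  also have "\<dots> \<le> 2"
  proof -
    have "(\<Sum>k\<le>m. (1/2::real) ^ k) = 2 - (1/2) ^ m" by (induction m) (auto simp: field_simps)
    then show ?thesis by simp
  qed
  finally show ?thesis .
qed

text \<open>At no more than half the radius, a sup bound becomes an l1 bound by comparison with a
  geometric series of ratio at most 1/2, whence the factor 2. Each vanishing initial coefficient
  gains a factor \<open>t / s\<close>.\<close>

lemma sum_norm_fps_nth_le:
  assumes C: "\<And>k. norm (fps_nth b k) * s ^ k \<le> C" and s: "s > 0" and t: "0 < t" "t \<le> s / 2"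
    and e: "\<And>k. k < e \<Longrightarrow> fps_nth b k = 0"
  shows "(\<Sum>k\<le>m. norm (fps_nth b k) * t ^ k) \<le> 2 * C * (t / s) ^ e"
proof -
  define x where "x = t / s"
  have x: "0 \<le> x" "x \<le> 1/2" using s t by (auto simp: x_def field_simps)
  have C0: "C \<ge> 0" using order_trans[OF norm_ge_zero, of "fps_nth b 0" C] C[of 0] by simp
  have "(\<Sum>k\<le>m. norm (fps_nth b k) * t ^ k) \<le> (\<Sum>k\<le>m + e. norm (fps_nth b k) * t ^ k)"
    using t by (intro sum_mono2) auto
  also have "\<dots> = (\<Sum>k\<in>{e..m + e}. norm (fps_nth b k) * t ^ k)"
    using e by (intro sum.mono_neutral_right) auto
  also have "\<dots> \<le> (\<Sum>k\<in>{e..m + e}. C * x ^ k)"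
  proof (rule sum_mono)
    fix k
    have "norm (fps_nth b k) * t ^ k = (norm (fps_nth b k) * s ^ k) * x ^ k"
      using s by (simp add: x_def power_divide)
    also have "\<dots> \<le> C * x ^ k" using x by (intro mult_right_mono C) auto
    finally show "norm (fps_nth b k) * t ^ k \<le> C * x ^ k" .
  qed
  also have "\<dots> = (\<Sum>k\<le>m. C * x ^ e * x ^ k)"
    by (intro sum.reindex_bij_witness[of _ "\<lambda>k. k + e" "\<lambda>k. k - e"]) (auto simp flip: power_add)
  also have "\<dots> = C * x ^ e * (\<Sum>k\<le>m. x ^ k)" by (simp add: sum_distrib_left)
  also have "\<dots> \<le> C * x ^ e * 2"
    using C0 x by (intro mult_left_mono sum_power_half_le) auto
  finally show ?thesis by (simp add: x_def mult_ac)
qed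

lemma geom_bounded_mult:
  assumes b: "geom_bounded s b" and f: "geom_bounded t f" and t: "0 < t" "t \<le> s / 2"
  shows "geom_bounded t (b * f)"
proof -
  have s: "s > 0" using t by simp
  obtain C where C: "\<And>k. norm (fps_nth b k) * s ^ k \<le> C" using b by (auto simp: geom_bounded_def)
  obtain D where D: "\<And>k. norm (fps_nth f k) * t ^ k \<le> D" using f by (auto simp: geom_bounded_def)
  have "norm (fps_nth (b * f) m) * t ^ m \<le> 2 * C * D" for m
    using sum_norm_fps_nth_le[OF C s t, of 0] D t
    by (intro norm_fps_mult_nth_le[where K = "2 * C"]) auto
  then show ?thesis by (rule geom_boundedI)
qed

text \<open>The bound \<open>2 * C\<close> reproduces itself: if it holds for all earlier terms, the
  convolution with total weight at most 1/2 contributes at most \<open>C\<close>.\<close>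

lemma majorant_bound:
  fixes u :: "nat \<Rightarrow> real"
  assumes rec: "\<And>m. u m * t ^ m \<le> C + (\<Sum>k<m. B (m - k) * u k) * t ^ m"
    and B: "\<And>k. B k \<ge> 0" "\<And>m. (\<Sum>k=1..m. B k * t ^ k) \<le> 1/2" and t: "0 \<le> t" and C: "C \<ge> 0"
  shows "u m * t ^ m \<le> 2 * C"
proof (induction m rule: less_induct)
  case (less m)
  have "(\<Sum>k<m. B (m - k) * u k) * t ^ m = (\<Sum>k<m. (B (m - k) * t ^ (m - k)) * (u k * t ^ k))"
    unfolding sum_distrib_right
  proof (rule sum.cong[OF refl])
    fix k assume "k \<in> {..<m}"
    then have "t ^ m = t ^ (m - k) * t ^ k" by (simp flip: power_add)
    then show "B (m - k) * u k * t ^ m = (B (m - k) * t ^ (m - k)) * (u k * t ^ k)" by simp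
  qed
  also have "\<dots> \<le> (\<Sum>k<m. (B (m - k) * t ^ (m - k)) * (2 * C))"
    using t B(1) less by (intro sum_mono mult_left_mono) auto
  also have "\<dots> = (\<Sum>k=1..m. B k * t ^ k) * (2 * C)"
    unfolding sum_distrib_right
    by (intro sum.reindex_bij_witness[of _ "\<lambda>k. m - k" "\<lambda>k. m - k"]) auto
  also have "\<dots> \<le> 1/2 * (2 * C)"
    using C by (intro mult_right_mono B(2)) auto
  finally show ?case using rec[of m] by simp
qed

text \<open>
  \<open>\<sigma>\<^sub>q\<^sup>i\<close> maps \<open>z\<^sup>N \<phi>\<close> to \<open>z\<^sup>N\<close> times the following series.
\<close>

definition fps_qdil :: "complex \<Rightarrow> int \<Rightarrow> int \<Rightarrow> complex fps \<Rightarrow> complex fps" where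
  "fps_qdil q N i \<phi> = Abs_fps (\<lambda>k. q powi (i * (N + int k)) * fps_nth \<phi> k)"

definition fps_qop ::
    "complex \<Rightarrow> int \<Rightarrow> int set \<Rightarrow> (int \<Rightarrow> complex fps) \<Rightarrow> complex fps \<Rightarrow> complex fps" where
  "fps_qop q N I b \<phi> = (\<Sum>i\<in>I. b i * fps_qdil q N i \<phi>)"

lemma fps_qdil_nth [simp]: "fps_nth (fps_qdil q N i \<phi>) k = q powi (i * (N + int k)) * fps_nth \<phi> k"
  by (simp add: fps_qdil_def)

lemma fps_qdil_0 [simp]: "fps_qdil q N i 0 = 0"
  by (simp add: fps_eq_iff)

lemma fps_qdil_diff: "fps_qdil q N i (f - g) = fps_qdil q N i f - fps_qdil q N i g"
  by (simp add: fps_eq_iff algebra_simps)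

lemma fps_qop_0 [simp]: "fps_qop q N I b 0 = 0"
  and fps_qop_diff: "fps_qop q N I b (f - g) = fps_qop q N I b f - fps_qop q N I b g"
  by (simp_all add: fps_qop_def fps_qdil_diff algebra_simps sum_subtractf)

lemma powi_add_int: "x \<noteq> 0 \<Longrightarrow> (x::'a::field) powi (i * (N + int k)) = x powi (i * N) * (x powi i) ^ k"
  by (simp add: distrib_left power_int_add power_int_mult)

text \<open>The factor \<open>q powi (i * (N + k))\<close> is a constant depending on
  \<open>N\<close> times the \<open>k\<close>-th power of \<open>q powi i\<close>; the power changes
  the scale, the constant only changes the bound.\<close>

lemma geom_bounded_qdil_iff:
  assumes q: "q \<noteq> 0" and st: "t * norm q powi i = s"
  shows "geom_bounded t (fps_qdil q N i \<phi>) \<longleftrightarrow> geom_bounded s \<phi>"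
proof -
  define c where "c = norm q powi (i * N)"
  have c: "c > 0" using q by (simp add: c_def)
  have eq: "norm (fps_nth (fps_qdil q N i \<phi>) k) * t ^ k = c * (norm (fps_nth \<phi> k) * s ^ k)" for k
    using q by (simp add: c_def norm_mult norm_power_int powi_add_int norm_power power_mult_distrib flip: st)
  show ?thesis
  proof
    assume "geom_bounded t (fps_qdil q N i \<phi>)"
    then obtain C where "\<And>k. norm (fps_nth (fps_qdil q N i \<phi>) k) * t ^ k \<le> C" by (auto simp: geom_bounded_def)
    then show "geom_bounded s \<phi>"
      unfolding eq using c by (intro geom_boundedI[where C = "C / c"]) (simp add: field_simps)
  next
    assume "geom_bounded s \<phi>"
    then obtain C where "\<And>k. norm (fps_nth \<phi> k) * s ^ k \<le> C" by (auto simp: geom_bounded_def)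
    then have "norm (fps_nth (fps_qdil q N i \<phi>) k) * t ^ k \<le> c * C" for k
      unfolding eq using c by simp
    then show "geom_bounded t (fps_qdil q N i \<phi>)" by (rule geom_boundedI)
  qed
qed

section \<open>Inverting the operator up to finitely many coefficients\<close>

text \<open>
  Compared with \<open>\<sigma>\<^sup>n\<close>, a term in \<open>\<sigma>\<^sup>i\<close> with \<open>i < n\<close> gains a factor \<open>|q|\<^bsup>(i-n)N\<^esup>\<close> on multiples of \<open>z\<^sup>N\<close>.
  The assumption \<open>small\<close> therefore holds for small \<open>r\<close> and, given \<open>r\<close>, for large \<open>N\<close>.
\<close>

context
  fixes q :: complex and N n :: int and I :: "int set" and b b' :: "int \<Rightarrow> complex fps"
    and r R :: real and \<beta> :: complex and d :: nat
  assumes q: "norm q > 1" and I: "finite I" "n \<in> I" "\<And>i. i \<in> I \<Longrightarrow> i \<le> n"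
    and r: "r > 0" and R: "R = r * norm q powi n" and \<beta>: "\<beta> \<noteq> 0"
    and b': "b' = b(n := b n - fps_const \<beta> * fps_X ^ d)"
    and small: "\<And>m. (\<Sum>i\<in>I. norm q powi ((i - n) * N) * (\<Sum>k\<le>m. norm (fps_nth (b' i) k) * r ^ k))
                  \<le> norm \<beta> * r ^ d / 2"
begin

lemma q_nz: "q \<noteq> 0" using q by auto

lemma R_pos: "R > 0" using r q_nz by (simp add: R)

text \<open>The monomial split off from the top coefficient, combined with the top dilation, acts
  diagonally up to a shift of degree by \<open>d\<close>. This is the part to be inverted;
  \<open>b'\<close> gives the perturbation.\<close>

lemma fps_qop_split_top:
  "fps_nth (fps_qop q N I b \<phi>) (l + d) =
     fps_nth (fps_qop q N I b' \<phi>) (l + d) + \<beta> * q powi (n * (N + int l)) * fps_nth \<phi> l"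
proof -
  have "fps_qop q N I b \<phi> = b n * fps_qdil q N n \<phi> + (\<Sum>i\<in>I - {n}. b i * fps_qdil q N i \<phi>)"
    unfolding fps_qop_def using I by (simp add: sum.remove)
  moreover have "fps_qop q N I b' \<phi> = b' n * fps_qdil q N n \<phi> + (\<Sum>i\<in>I - {n}. b' i * fps_qdil q N i \<phi>)"
    unfolding fps_qop_def using I by (simp add: sum.remove)
  moreover have "(\<Sum>i\<in>I - {n}. b' i * fps_qdil q N i \<phi>) = (\<Sum>i\<in>I - {n}. b i * fps_qdil q N i \<phi>)"
    by (intro sum.cong) (auto simp: b')
  ultimately have "fps_qop q N I b \<phi> = fps_qop q N I b' \<phi> + fps_const \<beta> * (fps_X ^ d * fps_qdil q N n \<phi>)"
    by (simp add: b' algebra_simps)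
  then show ?thesis by (simp add: fps_X_power_mult_nth)
qed

text \<open>With scale \<open>R\<close> at the source and \<open>r\<close> at the target, the
  remainder is at most half as large as the bound for the main term. The lower dilations are
  harmless because \<open>i \<le> n\<close> gives \<open>r * |q|^i \<le> R\<close>.\<close>

lemma norm_fps_qop_remainder_le:
  assumes C: "\<And>k. norm (fps_nth \<phi> k) * R ^ k \<le> C"
  shows "norm (fps_nth (fps_qop q N I b' \<phi>) (l + d)) * R ^ l \<le> norm \<beta> * norm q powi (n * (N + int l)) * (C / 2)"
proof -
  define Q where "Q = norm q"
  have Q: "Q > 1" "Q \<noteq> 0" using q by (auto simp: Q_def)
  have C0: "C \<ge> 0" using order_trans[OF norm_ge_zero, of "fps_nth \<phi> 0" C] C[of 0] by simp
  define S where "S i = (\<Sum>k\<le>l + d. norm (fps_nth (b' i) k) * r ^ k)" for i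
  have term_le: "norm (fps_nth (b' i * fps_qdil q N i \<phi>) (l + d)) * r ^ (l + d) \<le> S i * (Q powi (i * N) * C)"
    if "i \<in> I" for i
  proof (rule norm_fps_mult_nth_le)
    fix k
    have "norm (fps_nth (fps_qdil q N i \<phi>) k) * r ^ k
        = Q powi (i * N) * (norm (fps_nth \<phi> k) * (r * Q powi i) ^ k)"
      using Q by (simp add: norm_mult norm_power_int powi_add_int Q_def[symmetric] power_mult_distrib)
    also have "\<dots> \<le> Q powi (i * N) * (norm (fps_nth \<phi> k) * R ^ k)"
      using Q r I(3)[OF that] unfolding R Q_def[symmetric]
      by (intro mult_left_mono power_mono power_int_increasing mult_nonneg_nonneg) auto
    also have "\<dots> \<le> Q powi (i * N) * C" using Q by (intro mult_left_mono C) auto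
    finally show "norm (fps_nth (fps_qdil q N i \<phi>) k) * r ^ k \<le> Q powi (i * N) * C" .
  qed (use r in \<open>auto simp: S_def\<close>)
  have "norm (fps_nth (fps_qop q N I b' \<phi>) (l + d)) * r ^ (l + d)
      \<le> (\<Sum>i\<in>I. norm (fps_nth (b' i * fps_qdil q N i \<phi>) (l + d))) * r ^ (l + d)"
    unfolding fps_qop_def fps_sum_nth using r by (intro mult_right_mono norm_sum) auto
  also have "\<dots> \<le> (\<Sum>i\<in>I. S i * (Q powi (i * N) * C))"
    unfolding sum_distrib_right by (intro sum_mono term_le)
  also have "\<dots> = (\<Sum>i\<in>I. Q powi ((i - n) * N) * S i) * (Q powi (n * N) * C)"
    unfolding sum_distrib_right
    by (intro sum.cong refl) (use Q in \<open>simp add: power_int_diff left_diff_distrib\<close>)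
  also have "\<dots> \<le> (norm \<beta> * r ^ d / 2) * (Q powi (n * N) * C)"
    using small[of "l + d"] C0 Q by (intro mult_right_mono) (auto simp: S_def Q_def)
  finally have "norm (fps_nth (fps_qop q N I b' \<phi>) (l + d)) * r ^ l \<le> norm \<beta> * Q powi (n * N) * (C / 2)"
    using r by (simp add: power_add field_simps)
  \<comment> \<open>Passing from the weight \<open>r ^ l\<close> to \<open>R ^ l\<close> costs
    exactly the growth in \<open>l\<close> of the diagonal entries.\<close>
  then have "norm (fps_nth (fps_qop q N I b' \<phi>) (l + d)) * r ^ l * (Q powi n) ^ l
      \<le> norm \<beta> * Q powi (n * N) * (C / 2) * (Q powi n) ^ l"
    using Q by (intro mult_right_mono) auto
  then show ?thesis
    using Q by (simp add: R powi_add_int power_mult_distrib mult_ac flip: Q_def)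
qed

text \<open>If the image vanishes from degree \<open>d\<close> on, the main term is minus the
  remainder, so any bound for \<open>\<phi>\<close> can be halved, and this repeatedly.\<close>

lemma truncated_qop_inj:
  assumes \<phi>: "geom_bounded R \<phi>" and ker: "\<And>l. fps_nth (fps_qop q N I b \<phi>) (l + d) = 0"
  shows "\<phi> = 0"
proof -
  obtain C where C: "\<And>k. norm (fps_nth \<phi> k) * R ^ k \<le> C" using \<phi> by (auto simp: geom_bounded_def)
  have half: "norm (fps_nth \<phi> k) * R ^ k \<le> C / 2" if C: "\<And>k. norm (fps_nth \<phi> k) * R ^ k \<le> C" for C k
  proof -
    define w where "w = norm \<beta> * norm q powi (n * (N + int k))"
    have w: "w > 0" using q_nz \<beta> by (simp add: w_def)
    have "fps_nth (fps_qop q N I b' \<phi>) (k + d) = - (\<beta> * q powi (n * (N + int k)) * fps_nth \<phi> k)"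
      using fps_qop_split_top[of \<phi> k] ker[of k] by (simp add: eq_neg_iff_add_eq_0)
    then have "w * (norm (fps_nth \<phi> k) * R ^ k) \<le> w * (C / 2)"
      using norm_fps_qop_remainder_le[OF C, of k]
      by (simp add: w_def norm_mult norm_power_int mult_ac)
    with w show ?thesis by simp
  qed
  have bound: "norm (fps_nth \<phi> k) * R ^ k \<le> C / 2 ^ j" for j k
  proof (induction j arbitrary: k)
    case (Suc j)
    from half[OF Suc.IH] show ?case by (simp add: mult_ac)
  qed (use C in simp)
  have "fps_nth \<phi> k = 0" for k
  proof -
    have "(\<lambda>j. C * (1 / 2) ^ j) \<longlonglongrightarrow> C * 0"
      by (intro tendsto_mult tendsto_const LIMSEQ_power_zero) auto
    then have "norm (fps_nth \<phi> k) * R ^ k \<le> C * 0"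
      by (rule LIMSEQ_le_const) (use bound[of k] in \<open>auto simp: power_divide\<close>)
    moreover have "R ^ k > 0" using R_pos by simp
    ultimately show ?thesis
      using mult_pos_pos[of "norm (fps_nth \<phi> k)" "R ^ k"] by fastforce
  qed
  then show ?thesis by (simp add: fps_eq_iff)
qed

text \<open>Fixed point iteration for the equation solved for its main term; by the remainder
  estimate it contracts by 1/2 in the sup norm at scale \<open>R\<close>. The limit is taken
  coefficient by coefficient.\<close>

lemma truncated_qop_surj:
  assumes \<gamma>: "geom_bounded r \<gamma>"
  shows "\<exists>\<phi>. geom_bounded R \<phi> \<and> (\<forall>l. fps_nth (fps_qop q N I b \<phi>) (l + d) = fps_nth \<gamma> (l + d))"
proof -
  define w where "w l = \<beta> * q powi (n * (N + int l))" for l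
  have w: "w l \<noteq> 0" for l using q_nz \<beta> by (simp add: w_def)
  have nw: "norm (w l) = norm \<beta> * norm q powi (n * (N + int l))" for l
    by (simp add: w_def norm_mult norm_power_int)
  \<comment> \<open>Rescaling of the coefficients: the weighted sup norm at scale \<open>R\<close>
    becomes the plain sup norm of the sequence \<open>x\<close>.\<close>
  define ser where "ser x = Abs_fps (\<lambda>k. x k / complex_of_real (R ^ k))" for x :: "nat \<Rightarrow> complex"
  have ser_nth: "norm (fps_nth (ser x) k) * R ^ k = norm (x k)" for x k
    using R_pos by (simp add: ser_def norm_divide norm_power)
  define G where "G x l = (fps_nth \<gamma> (l + d) - fps_nth (fps_qop q N I b' (ser x)) (l + d)) * of_real (R ^ l) / w l" for x l
  have rem: "norm (fps_nth (fps_qop q N I b' (ser x)) (l + d) * of_real (R ^ l) / w l) \<le> C / 2"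
    if "\<And>k. norm (x k) \<le> C" for x C l
  proof -
    have "norm (fps_nth (fps_qop q N I b' (ser x)) (l + d)) * R ^ l \<le> norm (w l) * (C / 2)"
      unfolding nw using that by (intro norm_fps_qop_remainder_le) (simp add: ser_nth)
    then show ?thesis
      using w[of l] R_pos by (simp add: norm_mult norm_divide norm_power field_simps)
  qed
  obtain D where D: "\<And>k. norm (fps_nth \<gamma> k) * r ^ k \<le> D" using \<gamma> by (auto simp: geom_bounded_def)
  \<comment> \<open>The reason for the choice of \<open>R\<close>: dividing by the diagonal entry,
    of size \<open>|q|^(n * l)\<close> up to a constant, turns the scale \<open>r\<close> of the
    right-hand side into the scale \<open>R\<close> of the solution.\<close>
  have src: "norm (fps_nth \<gamma> (l + d) * of_real (R ^ l) / w l) \<le> D / (r ^ d * norm \<beta> * norm q powi (n * N))" for l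
  proof -
    have "norm (complex_of_real (R ^ l)) = R ^ l" using R_pos by (simp add: norm_power)
    then have "norm (fps_nth \<gamma> (l + d) * of_real (R ^ l) / w l)
        = norm (fps_nth \<gamma> (l + d)) * R ^ l / (norm \<beta> * (norm q powi (n * N) * (norm q powi n) ^ l))"
      using q_nz by (simp only: norm_mult norm_divide nw powi_add_int norm_eq_zero not_False_eq_True)
    also have "\<dots> = norm (fps_nth \<gamma> (l + d)) * r ^ (l + d) / (r ^ d * norm \<beta> * norm q powi (n * N))"
      using r q_nz by (simp add: R power_mult_distrib power_add)
    also have "\<dots> \<le> D / (r ^ d * norm \<beta> * norm q powi (n * N))"
      using r by (intro divide_right_mono D) auto
    finally show ?thesis .
  qed
  have G_diff: "norm (G x l - G y l) \<le> C / 2" if "\<And>k. norm (x k - y k) \<le> C" for x y C l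
  proof -
    have lin: "ser y - ser x = ser (\<lambda>k. y k - x k)"
      by (simp add: ser_def fps_eq_iff diff_divide_distrib)
    have "G x l - G y l = fps_nth (fps_qop q N I b' (ser y - ser x)) (l + d) * of_real (R ^ l) / w l"
      unfolding fps_qop_diff using w[of l] by (simp add: G_def field_simps)
    also have "norm \<dots> \<le> C / 2"
      unfolding lin using that by (intro rem) (simp add: norm_minus_commute)
    finally show ?thesis .
  qed
  define D' where "D' = D / (r ^ d * norm \<beta> * norm q powi (n * N))"
  have G_0: "norm (G (\<lambda>_. 0) l) \<le> D'" for l
  proof -
    have "ser (\<lambda>_. 0) = 0" by (simp add: ser_def fps_eq_iff)
    then show ?thesis using src[of l] by (simp add: G_def D'_def)
  qed
  define x where "x j = (G ^^ j) (\<lambda>_. 0)" for j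
  have x_Suc: "x (Suc j) = G (x j)" for j by (simp add: x_def)
  have x_bound: "norm (x j l) \<le> 2 * D'" for j l
  proof (induction j arbitrary: l)
    case 0
    have "D' \<ge> 0" using order_trans[OF norm_ge_zero G_0[of 0]] .
    then show ?case by (simp add: x_def)
  next
    case (Suc j)
    have "norm (G (x j) l - G (\<lambda>_. 0) l) \<le> 2 * D' / 2"
      by (rule G_diff) (use Suc.IH in simp)
    then show ?case
      using G_0[of l] norm_triangle_sub[of "G (x j) l" "G (\<lambda>_. 0) l"] by (simp add: x_Suc)
  qed
  have x_step: "norm (x (Suc j) l - x j l) \<le> D' * (1 / 2) ^ j" for j l
  proof (induction j arbitrary: l)
    case 0
    then show ?case using G_0[of l] by (simp add: x_def)
  next
    case (Suc j)
    show ?case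
      using G_diff[of "x (Suc j)" "x j", OF Suc.IH] by (simp only: x_Suc) simp
  qed
  have "\<exists>y. (\<lambda>j. x j l) \<longlonglongrightarrow> y" for l
  proof -
    have telescope: "(\<Sum>j<n. x (Suc j) l - x j l) = x n l - x 0 l" for n
      by (rule sum_lessThan_telescope)
    have "summable (\<lambda>j. x (Suc j) l - x j l)"
      by (rule summable_comparison_test'[where g = "\<lambda>j. D' * (1 / 2) ^ j"])
        (use x_step in \<open>auto intro!: summable_mult summable_geometric\<close>)
    then have "(\<lambda>n. \<Sum>j<n. x (Suc j) l - x j l) \<longlonglongrightarrow> suminf (\<lambda>j. x (Suc j) l - x j l)"
      by (rule summable_LIMSEQ)
    then have "(\<lambda>n. x n l - x 0 l) \<longlonglongrightarrow> suminf (\<lambda>j. x (Suc j) l - x j l)"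
      unfolding telescope .
    then show ?thesis by (auto simp: x_def)
  qed
  then obtain y where y: "\<And>l. (\<lambda>j. x j l) \<longlonglongrightarrow> y l" by metis
  have y_bound: "norm (y l) \<le> 2 * D'" for l
    using tendsto_norm[OF y[of l]] by (rule LIMSEQ_le_const2) (use x_bound in auto)
  \<comment> \<open>Each coordinate of \<open>G\<close> depends on finitely many coordinates of its
    argument, so coordinatewise convergence suffices to pass to the limit.\<close>
  have "(\<lambda>j. G (x j) l) \<longlonglongrightarrow> G y l" for l
    unfolding G_def fps_qop_def fps_sum_nth fps_mult_nth fps_qdil_nth ser_def fps_nth_Abs_fps
    using w R_pos by (intro tendsto_intros y) simp_all
  then have fixp: "G y l = y l" for l
    using LIMSEQ_unique LIMSEQ_Suc[OF y[of l]] unfolding x_Suc by blast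
  have "geom_bounded R (ser y)"
    by (intro geom_boundedI[where C = "2 * D'"]) (simp add: ser_nth y_bound)
  moreover have "fps_nth (fps_qop q N I b (ser y)) (l + d) = fps_nth \<gamma> (l + d)" for l
  proof -
    have "w l * fps_nth (ser y) l = fps_nth \<gamma> (l + d) - fps_nth (fps_qop q N I b' (ser y)) (l + d)"
      using fixp[of l] w[of l] R_pos by (simp add: G_def ser_def field_simps)
    then show ?thesis unfolding fps_qop_split_top w_def by simp
  qed
  ultimately show ?thesis by blast
qed

end

section \<open>Regularity of solutions\<close>

text \<open>\<open>b\<close> is \<open>\<beta> * X^d\<close> times a series with constant term 1
  whose other terms have total weight at most 1/2 at scale \<open>t\<close>. Solving the product
  formula for the coefficients of \<open>\<psi>\<close> gives a majorant recursion. The scale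
  \<open>t\<close> is not reduced, so the division can be repeated indefinitely.\<close>

lemma geom_bounded_cancel_left:
  assumes b: "\<And>k. k < d \<Longrightarrow> fps_nth b k = 0" "fps_nth b d = \<beta>" "\<beta> \<noteq> 0"
    and tail: "\<And>m. (\<Sum>k\<le>m. norm (fps_nth (b - fps_const \<beta> * fps_X ^ d) k) * t ^ k) \<le> norm \<beta> * t ^ d / 2"
    and t: "t > 0" and h: "geom_bounded t (b * \<psi>)"
  shows "geom_bounded t \<psi>"
proof -
  obtain C where C: "\<And>k. norm (fps_nth (b * \<psi>) k) * t ^ k \<le> C"
    using h by (auto simp: geom_bounded_def)
  define u where "u k = norm (fps_nth \<psi> k)" for k
  define B where "B k = (if k = 0 then 0 else norm (fps_nth b (d + k)) / norm \<beta>)" for k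
  define C' where "C' = C / (t ^ d * norm \<beta>)"
  have CC: "C = C' * (norm \<beta> * t ^ d)" using t b(3) by (simp add: C'_def)
  have C0: "C \<ge> 0" using order_trans[OF norm_ge_zero, of "fps_nth (b * \<psi>) 0" C] C[of 0] by simp
  have "u m * t ^ m \<le> 2 * C'" for m
  proof (rule majorant_bound[where B = B])
    fix m
    have "fps_nth (b * \<psi>) (m + d) = (\<Sum>k\<le>m + d. fps_nth b k * fps_nth \<psi> (m + d - k))"
      by (simp add: fps_mult_nth atMost_atLeast0)
    also have "\<dots> = (\<Sum>k\<in>{d..m + d}. fps_nth b k * fps_nth \<psi> (m + d - k))"
      by (rule sum.mono_neutral_right) (auto simp: b(1))
    also have "\<dots> = (\<Sum>k\<le>m. fps_nth b (d + m - k) * fps_nth \<psi> k)"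
      by (intro sum.reindex_bij_witness[of _ "\<lambda>k. d + m - k" "\<lambda>k. d + m - k"]) (auto simp: add.commute)
    also have "\<dots> = \<beta> * fps_nth \<psi> m + (\<Sum>k<m. fps_nth b (d + m - k) * fps_nth \<psi> k)"
      by (simp add: lessThan_Suc_atMost[symmetric] b(2))
    finally have "\<beta> * fps_nth \<psi> m = fps_nth (b * \<psi>) (m + d) - (\<Sum>k<m. fps_nth b (d + m - k) * fps_nth \<psi> k)"
      by simp
    then have "norm (\<beta> * fps_nth \<psi> m) \<le> norm (fps_nth (b * \<psi>) (m + d))
        + norm (\<Sum>k<m. fps_nth b (d + m - k) * fps_nth \<psi> k)"
      by (metis norm_triangle_ineq4)
    also have "norm (\<Sum>k<m. fps_nth b (d + m - k) * fps_nth \<psi> k) \<le> (\<Sum>k<m. norm (fps_nth b (d + m - k)) * u k)"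
      unfolding u_def by (rule order_trans[OF norm_sum]) (simp add: norm_mult)
    also have "\<dots> = norm \<beta> * (\<Sum>k<m. B (m - k) * u k)"
      unfolding sum_distrib_left by (intro sum.cong) (use b(3) in \<open>auto simp: B_def\<close>)
    finally have "norm \<beta> * u m \<le> norm (fps_nth (b * \<psi>) (m + d)) + norm \<beta> * (\<Sum>k<m. B (m - k) * u k)"
      by (simp add: norm_mult u_def)
    then have "norm \<beta> * u m * t ^ (m + d) \<le> (norm (fps_nth (b * \<psi>) (m + d)) + norm \<beta> * (\<Sum>k<m. B (m - k) * u k)) * t ^ (m + d)"
      using t by (intro mult_right_mono) auto
    also have "\<dots> \<le> C + norm \<beta> * (\<Sum>k<m. B (m - k) * u k) * t ^ (m + d)"
      using C[of "m + d"] by (simp add: distrib_right)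
    also have "\<dots> = (C' + (\<Sum>k<m. B (m - k) * u k) * t ^ m) * (norm \<beta> * t ^ d)"
      using CC by (simp add: distrib_right power_add)
    finally have "u m * t ^ m * (norm \<beta> * t ^ d) \<le> \<dots>"
      by (simp only: power_add mult_ac)
    then show "u m * t ^ m \<le> C' + (\<Sum>k<m. B (m - k) * u k) * t ^ m"
      by (rule mult_right_le_imp_le) (use t b(3) in auto)
  next
    fix m
    have "(\<Sum>k = 1..m. B k * t ^ k) * (norm \<beta> * t ^ d)
        = (\<Sum>k = 1..m. norm (fps_nth (b - fps_const \<beta> * fps_X ^ d) (k + d)) * t ^ (k + d))"
      unfolding sum_distrib_right
      by (intro sum.cong refl) (use b(3) in \<open>auto simp: B_def fps_X_power_nth power_add add.commute\<close>)
    also have "\<dots> = (\<Sum>k\<in>{d + 1..m + d}. norm (fps_nth (b - fps_const \<beta> * fps_X ^ d) k) * t ^ k)"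
      by (intro sum.reindex_bij_witness[of _ "\<lambda>k. k - d" "\<lambda>k. k + d"]) auto
    also have "\<dots> \<le> (\<Sum>k\<le>m + d. norm (fps_nth (b - fps_const \<beta> * fps_X ^ d) k) * t ^ k)"
      using t by (intro sum_mono2) auto
    also have "\<dots> \<le> norm \<beta> * t ^ d / 2" by (rule tail)
    finally have "(\<Sum>k = 1..m. B k * t ^ k) * (norm \<beta> * t ^ d) \<le> 1 / 2 * (norm \<beta> * t ^ d)" by simp
    then show "(\<Sum>k = 1..m. B k * t ^ k) \<le> 1 / 2"
      by (rule mult_right_le_imp_le) (use t b(3) in auto)
  qed (use t C0 in \<open>auto simp: B_def C'_def\<close>)
  then show ?thesis unfolding u_def by (rule geom_boundedI)
qed

text \<open>
  \<open>\<sigma>\<^sup>n \<phi>\<close> is expressed by the \<open>\<sigma>\<^sup>i \<phi>\<close> with \<open>i < n\<close>, whose scale is larger by a factor of at least \<open>|q|\<close>.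
\<close>

lemma qop_regularity_step:
  fixes q :: complex and b :: "int \<Rightarrow> complex fps"
  assumes q: "norm q > 1" and I: "finite I" "n \<in> I" "\<And>i. i \<in> I \<Longrightarrow> i \<le> n"
    and b: "\<And>k. k < d \<Longrightarrow> fps_nth (b n) k = 0" "fps_nth (b n) d = \<beta>" "\<beta> \<noteq> 0"
    and bs: "\<And>i. i \<in> I \<Longrightarrow> geom_bounded s (b i)" and r: "0 < r" "r \<le> s / 2"
    and tail: "\<And>m t. 0 < t \<Longrightarrow> t \<le> r \<Longrightarrow>
      (\<Sum>k\<le>m. norm (fps_nth (b n - fps_const \<beta> * fps_X ^ d) k) * t ^ k) \<le> norm \<beta> * t ^ d / 2"
    and \<gamma>: "geom_bounded r (fps_qop q N I b \<phi>)"
    and \<phi>: "geom_bounded \<rho> \<phi>" "\<rho> > 0"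
  shows "geom_bounded (min (r * norm q powi n) (\<rho> * norm q)) \<phi>"
proof -
  define Q where "Q = norm q"
  have Q: "Q > 1" "q \<noteq> 0" using q by (auto simp: Q_def)
  \<comment> \<open>The right-hand side is bounded only up to \<open>r\<close>. The second term is
    the least scale guaranteed for the lower dilates of \<open>\<phi>\<close>: that of index
    \<open>i\<close> is bounded at \<open>\<rho> / Q powi i\<close>, and
    \<open>i \<le> n - 1\<close>.\<close>
  define t where "t = min r (\<rho> * Q / Q powi n)"
  have t: "t > 0" "t \<le> r" using r \<phi>(2) Q by (auto simp: t_def)
  have low: "geom_bounded t (b i * fps_qdil q N i \<phi>)" if i: "i \<in> I" "i \<noteq> n" for i
  proof (rule geom_bounded_mult[OF bs[OF i(1)]])
    have "i + 1 \<le> n" using I(3)[OF i(1)] i(2) by simp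
    then have "Q powi i * Q \<le> Q powi n"
      using power_int_increasing[of "i + 1" n Q] Q by (simp add: power_int_add_1)
    then have "\<rho> * (Q powi i * Q) \<le> \<rho> * Q powi n" using \<phi>(2) by simp
    then have "\<rho> * Q / Q powi n \<le> \<rho> / Q powi i"
      using Q \<phi>(2) by (simp add: field_simps)
    then have "t \<le> \<rho> / Q powi i" by (simp add: t_def)
    moreover have "geom_bounded (\<rho> / Q powi i) (fps_qdil q N i \<phi>)"
      by (subst geom_bounded_qdil_iff[of q _ i \<rho>]) (use Q \<phi> in \<open>auto simp: Q_def\<close>)
    ultimately show "geom_bounded t (fps_qdil q N i \<phi>)"
      using t geom_bounded_mono[of "\<rho> / Q powi i" "fps_qdil q N i \<phi>" t] by simp
  qed (use t r in auto)
  have "b n * fps_qdil q N n \<phi> = fps_qop q N I b \<phi> - (\<Sum>i\<in>I - {n}. b i * fps_qdil q N i \<phi>)"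
    unfolding fps_qop_def using I by (simp add: sum.remove)
  also have "geom_bounded t \<dots>"
    using t low geom_bounded_mono[OF \<gamma>, of t] by (intro geom_bounded_diff geom_bounded_sum) auto
  finally have "geom_bounded t (b n * fps_qdil q N n \<phi>)" .
  with b tail[OF t] t(1) have "geom_bounded t (fps_qdil q N n \<phi>)"
    by (rule geom_bounded_cancel_left)
  then have "geom_bounded (t * Q powi n) \<phi>"
    using geom_bounded_qdil_iff[of q t n "t * Q powi n"] Q by (simp add: Q_def)
  also have "t * Q powi n = min (r * Q powi n) (\<rho> * Q)"
    using Q by (simp add: t_def min_mult_distrib_right)
  finally show ?thesis by (simp add: Q_def)
qed

text \<open>Iterating the step gains a factor \<open>|q|\<close> each time until the cap set by the
  right-hand side is reached. A convergent solution of unknown radius thus lands in the space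
  covered by \<open>truncated_qop_inj\<close>.\<close>

lemma qop_regularity:
  fixes q :: complex and b :: "int \<Rightarrow> complex fps"
  assumes q: "norm q > 1" and I: "finite I" "n \<in> I" "\<And>i. i \<in> I \<Longrightarrow> i \<le> n"
    and b: "\<And>k. k < d \<Longrightarrow> fps_nth (b n) k = 0" "fps_nth (b n) d = \<beta>" "\<beta> \<noteq> 0"
    and bs: "\<And>i. i \<in> I \<Longrightarrow> geom_bounded s (b i)" and r: "0 < r" "r \<le> s / 2"
    and tail: "\<And>m t. 0 < t \<Longrightarrow> t \<le> r \<Longrightarrow>
      (\<Sum>k\<le>m. norm (fps_nth (b n - fps_const \<beta> * fps_X ^ d) k) * t ^ k) \<le> norm \<beta> * t ^ d / 2"
    and \<gamma>: "geom_bounded r (fps_qop q N I b \<phi>)"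
    and \<phi>: "geom_bounded \<rho> \<phi>" "\<rho> > 0"
  shows "geom_bounded (r * norm q powi n) \<phi>"
proof -
  define R where "R = r * norm q powi n"
  have q0: "norm q > 0" using q by linarith
  then have R: "R > 0" using r by (simp add: R_def)
  have pow: "geom_bounded (min R (\<rho> * norm q ^ j)) \<phi>" for j
  proof (induction j)
    case 0
    then show ?case using \<phi> R geom_bounded_mono[of \<rho> \<phi> "min R \<rho>"] by simp
  next
    case (Suc j)
    define \<rho>' where "\<rho>' = min R (\<rho> * norm q ^ j)"
    have \<rho>': "geom_bounded \<rho>' \<phi>" "\<rho>' > 0"
      using Suc.IH R \<phi>(2) q0 by (simp_all add: \<rho>'_def)
    have "geom_bounded (min R (\<rho>' * norm q)) \<phi>"
      unfolding R_def
      by (rule qop_regularity_step[where I = I and b = b and N = N and s = s and d = d and \<beta> = \<beta>])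
         (fact q I b bs r tail \<gamma> \<rho>')+
    then have "geom_bounded (min R (min R (\<rho> * norm q ^ j) * norm q)) \<phi>"
      by (simp only: \<rho>'_def)
    moreover have "min R (min R (\<rho> * norm q ^ j) * norm q) = min R (\<rho> * norm q ^ Suc j)"
    proof -
      have "min R (\<rho> * norm q ^ j) * norm q = min (R * norm q) (\<rho> * norm q ^ j * norm q)"
        using q0 by (simp add: min_mult_distrib_right)
      then have "min R (\<rho> * norm q ^ j) * norm q = min (R * norm q) (\<rho> * norm q ^ Suc j)"
        by (simp only: power_Suc2 mult.assoc)
      moreover have "R \<le> R * norm q" using R q by simp
      ultimately show ?thesis by linarith
    qed
    ultimately show ?case by simp
  qed
  obtain j where "R / \<rho> < norm q ^ j" using real_arch_pow[OF q] by blast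
  then have "min R (\<rho> * norm q ^ j) = R" using \<phi>(2) by (simp add: field_simps)
  with pow[of j] show ?thesis by (simp add: R_def)
qed

section \<open>Operators with a dominant coefficient\<close>

lemma fps_conv_radius_pos_iff_geom_bounded:
  "fps_conv_radius \<phi> > 0 \<longleftrightarrow> (\<exists>s>0. geom_bounded s \<phi>)"
proof
  assume "fps_conv_radius \<phi> > 0"
  then obtain s where s: "0 < ereal s" "ereal s < fps_conv_radius \<phi>"
    using ereal_dense2 by blast
  then have "ereal (norm (complex_of_real s)) < conv_radius (fps_nth \<phi>)"
    by (simp add: fps_conv_radius_def)
  then have "summable (\<lambda>k. norm (fps_nth \<phi> k * of_real s ^ k))"
    by (rule abs_summable_in_conv_radius)
  then have "Bseq (\<lambda>k. norm (fps_nth \<phi> k * of_real s ^ k))"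
    using summable_LIMSEQ_zero convergentI convergent_imp_Bseq by blast
  then obtain C where "\<And>k. norm (norm (fps_nth \<phi> k * of_real s ^ k)) \<le> C"
    by (auto simp: Bseq_def)
  then have "norm (fps_nth \<phi> k) * s ^ k \<le> C" for k
    using s by (simp add: norm_mult norm_power)
  then have "geom_bounded s \<phi>" by (rule geom_boundedI)
  then show "\<exists>s>0. geom_bounded s \<phi>" using s by auto
next
  assume "\<exists>s>0. geom_bounded s \<phi>"
  then obtain s C where s: "s > 0" and C: "\<And>k. norm (fps_nth \<phi> k) * s ^ k \<le> C"
    by (auto simp: geom_bounded_def)
  have "summable (\<lambda>k. fps_nth \<phi> k * of_real (s / 2) ^ k)"
  proof (rule summable_comparison_test'[where g = "\<lambda>k. C * (1 / 2) ^ k"])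
    fix k
    have "norm (fps_nth \<phi> k * of_real (s / 2) ^ k) = (norm (fps_nth \<phi> k) * s ^ k) * (1 / 2) ^ k"
      using s by (simp add: norm_mult norm_power norm_divide power_divide)
    also have "\<dots> \<le> C * (1 / 2) ^ k" by (intro mult_right_mono C) auto
    finally show "norm (fps_nth \<phi> k * of_real (s / 2) ^ k) \<le> C * (1 / 2) ^ k" .
  qed (auto intro!: summable_mult summable_geometric)
  then have "ereal (norm (complex_of_real (s / 2))) \<le> fps_conv_radius \<phi>"
    unfolding fps_conv_radius_def by (rule conv_radius_geI)
  moreover have "0 < ereal (norm (complex_of_real (s / 2)))" using s by simp
  ultimately show "fps_conv_radius \<phi> > 0" by order
qed

definition fls_qop :: "complex \<Rightarrow> int set \<Rightarrow> (int \<Rightarrow> complex fls) \<Rightarrow> complex fls \<Rightarrow> complex fls" where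
  "fls_qop q I A f = (\<Sum>i\<in>I. A i * fls_dilate (q powi i) f)"

abbreviation fls_monom_mult :: "int \<Rightarrow> complex fps \<Rightarrow> complex fls" where
  "fls_monom_mult N \<phi> \<equiv> fls_shift (-N) (fps_to_fls \<phi>)"

lemma fls_monom_mult_exists:
  assumes "N \<le> fls_subdegree f"
  obtains \<phi> where "f = fls_monom_mult N \<phi>"
proof
  have "fps_to_fls (fls_regpart (fls_shift N f)) = fls_shift N f"
    using fls_shift_nonneg_subdegree[OF assms] by (rule fls_regpart_to_fls_trivial)
  then show "f = fls_monom_mult N (fls_regpart (fls_shift N f))"
    by (simp only: fls_shift_fls_shift) simp
qed

lemma fls_conv_radius_monom_mult_pos_iff:
  "fls_conv_radius (fls_monom_mult N \<phi>) > 0 \<longleftrightarrow> (\<exists>s>0. geom_bounded s \<phi>)"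
  by (simp only: fls_conv_radius_shift fls_conv_radius_fps_to_fls fps_conv_radius_pos_iff_geom_bounded)

lemma fls_dilate_monom_mult:
  assumes "q \<noteq> 0"
  shows "fls_dilate (q powi i) (fls_monom_mult N \<phi>) = fls_monom_mult N (fps_qdil q N i \<phi>)"
proof (rule fls_eqI)
  fix n
  show "fls_nth (fls_dilate (q powi i) (fls_monom_mult N \<phi>)) n = fls_nth (fls_monom_mult N (fps_qdil q N i \<phi>)) n"
  proof (cases "n < N")
    case False
    then have "N + int (nat (n - N)) = n" by simp
    with False assms show ?thesis by (simp add: fls_dilate_nth power_int_mult)
  qed (use assms in \<open>simp add: fls_dilate_nth\<close>)
qed

lemma fps_to_fls_sum: "fps_to_fls (sum f I) = (\<Sum>i\<in>I. fps_to_fls (f i))"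
  by (induction I rule: infinite_finite_induct) auto

lemma fls_shift_sum: "fls_shift N (sum f I) = (\<Sum>i\<in>I. fls_shift N (f i))"
  by (induction I rule: infinite_finite_induct) auto

lemma fls_qop_monom_mult:
  assumes "q \<noteq> 0"
  shows "fls_qop q I (\<lambda>i. fps_to_fls (b i)) (fls_monom_mult N \<phi>) = fls_monom_mult N (fps_qop q N I b \<phi>)"
  unfolding fls_qop_def fps_qop_def fls_dilate_monom_mult[OF assms]
  by (simp add: fps_to_fls_sum fls_shift_sum fls_times_fps_to_fls fls_shifted_times_simps)

lemma fls_dilate_add: "c \<noteq> 0 \<Longrightarrow> fls_dilate c (f + g) = fls_dilate c f + fls_dilate c g"
  by (simp add: fls_eq_iff fls_dilate_nth algebra_simps)

lemma fls_qop_add: "q \<noteq> 0 \<Longrightarrow> fls_qop q I A (f + g) = fls_qop q I A f + fls_qop q I A g"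
  by (simp add: fls_qop_def fls_dilate_add distrib_left sum.distrib)

lemma fls_qop_0 [simp]: "q \<noteq> 0 \<Longrightarrow> fls_qop q I A 0 = 0"
  using fls_qop_add[of q I A 0 0] by simp

lemma triangular_system_solvable:
  fixes M :: "nat \<Rightarrow> nat \<Rightarrow> 'a::field"
  assumes "\<And>m. M m m \<noteq> 0"
  shows "\<exists>\<phi>. \<forall>m. (\<Sum>k\<le>m. M m k * \<phi> k) = \<gamma> m"
proof -
  define F where "F = (\<lambda>f m. (\<gamma> m - (\<Sum>k<m. M m k * f k)) / M m m)"
  define \<phi> where "\<phi> = wfrec less_than F"
  have "\<phi> m = F \<phi> m" for m
  proof -
    have "\<phi> m = F (cut \<phi> less_than m) m"
      unfolding \<phi>_def by (subst wfrec[OF wf_less_than]) (rule refl)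
    then show ?thesis by (simp add: F_def cut_def)
  qed
  then have diag: "M m m * \<phi> m = \<gamma> m - (\<Sum>k<m. M m k * \<phi> k)" for m
    unfolding F_def using assms[of m] by (metis nonzero_mult_div_cancel_left times_divide_eq_right)
  have "(\<Sum>k\<le>m. M m k * \<phi> k) = \<gamma> m" for m
    by (simp add: lessThan_Suc_atMost[symmetric] diag)
  then show ?thesis by blast
qed

text \<open>The operator after division by its dominant coefficient. The position of
  \<open>\<alpha>\<close> is left open: it will be the lowest index for positive slope and the
  highest for negative slope.\<close>

locale dominated_qop =
  fixes q :: complex and I :: "int set" and b :: "int \<Rightarrow> complex fps" and \<alpha> :: int
  assumes q: "norm q > 1" and I: "finite I" "\<alpha> \<in> I"
    and b_dom: "b \<alpha> = 1" and b_0: "\<And>i. i \<in> I \<Longrightarrow> i \<noteq> \<alpha> \<Longrightarrow> fps_nth (b i) 0 = 0"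
begin

abbreviation T :: "complex fls \<Rightarrow> complex fls" where
  "T \<equiv> fls_qop q I (\<lambda>i. fps_to_fls (b i))"

lemma q_nonzero: "q \<noteq> 0" using q by auto

definition M where "M N m k = (\<Sum>i\<in>I. fps_nth (b i) (m - k) * q powi (i * (N + int k)))"

lemma fps_qop_nth: "fps_nth (fps_qop q N I b \<phi>) m = (\<Sum>k\<le>m. M N m k * fps_nth \<phi> k)"
proof -
  have "fps_nth (fps_qop q N I b \<phi>) m =
      (\<Sum>i\<in>I. \<Sum>k\<le>m. fps_nth (b i) (m - k) * (q powi (i * (N + int k)) * fps_nth \<phi> k))"
    unfolding fps_qop_def fps_sum_nth fps_mult_nth atMost_atLeast0[symmetric] fps_qdil_nth
    by (intro sum.cong refl sum.reindex_bij_witness[of _ "\<lambda>k. m - k" "\<lambda>k. m - k"]) auto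
  then show ?thesis
    by (simp add: M_def sum_distrib_right mult.assoc sum.swap[of _ "{..m}" I])
qed

lemma M_diag: "M N m m = q powi (\<alpha> * (N + int m))"
proof -
  have "M N m m = (\<Sum>i\<in>I. if i = \<alpha> then q powi (\<alpha> * (N + int m)) else 0)"
    unfolding M_def by (intro sum.cong) (auto simp: b_dom b_0)
  then show ?thesis using I by simp
qed

lemma fps_qop_nth_0: "fps_nth (fps_qop q N I b \<phi>) 0 = q powi (\<alpha> * N) * fps_nth \<phi> 0"
  by (simp add: fps_qop_nth M_diag)

lemma fps_qop_surj: "\<exists>\<phi>. fps_qop q N I b \<phi> = \<gamma>"
proof -
  have "\<exists>\<phi>. \<forall>m. (\<Sum>k\<le>m. M N m k * \<phi> k) = fps_nth \<gamma> m"
    by (rule triangular_system_solvable) (simp add: M_diag q_nonzero)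
  then obtain \<phi> where "\<And>m. (\<Sum>k\<le>m. M N m k * \<phi> k) = fps_nth \<gamma> m" by blast
  then have "fps_qop q N I b (Abs_fps \<phi>) = \<gamma>"
    by (simp add: fps_eq_iff fps_qop_nth)
  then show ?thesis by blast
qed

text \<open>The leading coefficient is only multiplied by a power of \<open>q\<close>. Preservation
  of the order later confines a solution to multiples of \<open>z^N\<close> when the right-hand side
  is one.\<close>

lemma T_nonzero:
  assumes "f \<noteq> 0"
  shows "T f \<noteq> 0" "fls_subdegree (T f) = fls_subdegree f"
proof -
  define N where "N = fls_subdegree f"
  obtain \<phi> where f: "f = fls_monom_mult N \<phi>"
    using fls_monom_mult_exists[of N f] by (auto simp: N_def)
  have "fls_nth f N = fps_nth \<phi> 0" by (subst f) simp
  then have \<phi>0: "fps_nth \<phi> 0 \<noteq> 0" using nth_fls_subdegree_nonzero[OF assms] unfolding N_def by metis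
  have Tf: "T f = fls_monom_mult N (fps_qop q N I b \<phi>)"
    unfolding f by (rule fls_qop_monom_mult[OF q_nonzero])
  have nz: "fps_nth (fps_qop q N I b \<phi>) 0 \<noteq> 0" using \<phi>0 q_nonzero by (simp add: fps_qop_nth_0)
  then have ne: "fps_qop q N I b \<phi> \<noteq> 0" by auto
  then show "T f \<noteq> 0" using fls_shift_eq_iff[of "- N" _ "0 :: complex fls"] by (simp add: Tf)
  have "subdegree (fps_qop q N I b \<phi>) = 0" using nz by (rule subdegree_eq_0)
  then show "fls_subdegree (T f) = fls_subdegree f"
    using ne by (simp add: Tf fls_shift_subdegree fls_subdegree_fls_to_fps N_def)
qed

lemma T_surj: "\<exists>f. T f = g"
proof -
  obtain \<gamma> where g: "g = fls_monom_mult (fls_subdegree g) \<gamma>"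
    using fls_monom_mult_exists[of "fls_subdegree g" g] by auto
  obtain \<phi> where "fps_qop q (fls_subdegree g) I b \<phi> = \<gamma>" using fps_qop_surj by blast
  then have "T (fls_monom_mult (fls_subdegree g) \<phi>) = g"
    using g by (simp add: fls_qop_monom_mult[OF q_nonzero])
  then show ?thesis by blast
qed

end

locale convergent_dominated_qop = dominated_qop +
  assumes conv: "\<And>i. i \<in> I \<Longrightarrow> fps_conv_radius (b i) > 0"
begin

lemma common_bound:
  obtains s C where "s > 0" "\<And>i k. i \<in> I \<Longrightarrow> norm (fps_nth (b i) k) * s ^ k \<le> C i"
proof -
  have "\<forall>i\<in>I. \<exists>s>0. geom_bounded s (b i)"
    using conv by (simp add: fps_conv_radius_pos_iff_geom_bounded)
  then obtain s where s: "\<And>i. i \<in> I \<Longrightarrow> s i > 0" "\<And>i. i \<in> I \<Longrightarrow> geom_bounded (s i) (b i)"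
    by metis
  define s0 where "s0 = Min (s ` I)"
  have "s0 > 0" unfolding s0_def using I s(1) by (subst Min_gr_iff) auto
  moreover have "s0 \<le> s i" if "i \<in> I" for i using I that by (simp add: s0_def)
  ultimately have s0: "s0 > 0" "\<And>i. i \<in> I \<Longrightarrow> s0 \<le> s i" by blast+
  have "geom_bounded s0 (b i)" if "i \<in> I" for i
    using geom_bounded_mono[OF s(2)[OF that], of s0] s0(1) s0(2)[OF that] by simp
  then have "\<forall>i\<in>I. \<exists>C. \<forall>k. norm (fps_nth (b i) k) * s0 ^ k \<le> C"
    by (simp add: geom_bounded_def)
  then obtain C where "\<And>i k. i \<in> I \<Longrightarrow> norm (fps_nth (b i) k) * s0 ^ k \<le> C i" by metis
  with s0(1) that show ?thesis by blast
qed

text \<open>For \<open>\<psi>\<close>, the dilate of \<open>\<phi>\<close> by the dominant index,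
  the recursion has weights \<open>|q|^((i - \<alpha>) * (N + k))\<close>. Since
  \<open>i \<le> \<alpha>\<close> these stay below \<open>w i\<close> for all \<open>k\<close>, so
  the majorant argument applies. With \<open>\<alpha>\<close> as the lowest index they would grow
  geometrically in \<open>k\<close>, and formal solutions may diverge.\<close>

lemma fps_qop_solution_geom_bounded:
  assumes top: "\<And>i. i \<in> I \<Longrightarrow> i \<le> \<alpha>" and \<gamma>: "\<exists>s>0. geom_bounded s (fps_qop q N I b \<phi>)"
  shows "\<exists>s>0. geom_bounded s \<phi>"
proof -
  define Q where "Q = norm q"
  have Q: "Q > 1" "Q > 0" using q by (auto simp: Q_def intro: less_trans[OF zero_less_one])
  obtain s C where s: "s > 0" and C: "\<And>i k. i \<in> I \<Longrightarrow> norm (fps_nth (b i) k) * s ^ k \<le> C i"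
    using common_bound by blast
  obtain s' D where s': "s' > 0" and D: "\<And>k. norm (fps_nth (fps_qop q N I b \<phi>) k) * s' ^ k \<le> D"
    using \<gamma> by (auto simp: geom_bounded_def)
  define \<psi> where "\<psi> = fps_qdil q N \<alpha> \<phi>"
  define J where "J = I - {\<alpha>}"
  define w where "w i = Q powi ((i - \<alpha>) * N)" for i
  define W where "W = (\<Sum>i\<in>J. w i * (2 * C i))"
  have w: "w i > 0" for i using Q by (simp add: w_def)
  have C0: "C i \<ge> 0" if "i \<in> I" for i
    using order_trans[OF norm_ge_zero, of "fps_nth (b i) 0" "C i"] C[OF that, of 0] by simp
  have W0: "W \<ge> 0" unfolding W_def J_def using w C0 by (intro sum_nonneg mult_nonneg_nonneg) (auto intro: less_imp_le)
  \<comment> \<open>The three bounds serve the geometric series estimate, the right-hand side, and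
    the total weight 1/2 of the recursion; \<open>W + 1\<close> avoids division by zero when
    \<open>W = 0\<close>.\<close>
  define t where "t = min (min (s / 2) s') (s / (2 * (W + 1)))"
  have t: "t > 0" "t \<le> s / 2" "t \<le> s'"
    using s s' W0 by (simp_all only: t_def min_le_iff_disj) auto
  have tW: "W * (t / s) \<le> 1 / 2"
  proof -
    have "t \<le> s / (2 * (W + 1))" by (simp add: t_def)
    then have "(W + 1) * (t / s) \<le> 1 / 2" using s W0 by (simp add: field_simps)
    moreover have "W * (t / s) \<le> (W + 1) * (t / s)" using t s by (intro mult_right_mono) auto
    ultimately show ?thesis by linarith
  qed
  define B where "B k = (\<Sum>i\<in>J. w i * norm (fps_nth (b i) k))" for k
  have "norm (fps_nth \<psi> m) * t ^ m \<le> 2 * D" for m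
  proof (rule majorant_bound[where B = B])
    fix m
    have "fps_nth (fps_qop q N I b \<phi>) m = (\<Sum>k<m. M N m k * fps_nth \<phi> k) + fps_nth \<psi> m"
      by (simp add: fps_qop_nth M_diag \<psi>_def lessThan_Suc_atMost[symmetric])
    then have "fps_nth \<psi> m = fps_nth (fps_qop q N I b \<phi>) m - (\<Sum>k<m. M N m k * fps_nth \<phi> k)"
      by simp
    then have "norm (fps_nth \<psi> m) \<le> norm (fps_nth (fps_qop q N I b \<phi>) m) + norm (\<Sum>k<m. M N m k * fps_nth \<phi> k)"
      by (metis norm_triangle_ineq4)
    also have "norm (\<Sum>k<m. M N m k * fps_nth \<phi> k) \<le> (\<Sum>k<m. B (m - k) * norm (fps_nth \<psi> k))"
    proof (rule order_trans[OF norm_sum], rule sum_mono)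
      fix k assume k: "k \<in> {..<m}"
      have "M N m k * fps_nth \<phi> k = (\<Sum>i\<in>J. fps_nth (b i) (m - k) * q powi (i * (N + int k)) * fps_nth \<phi> k)"
        using I k by (simp add: M_def J_def sum.remove[of I \<alpha>] b_dom sum_distrib_right)
      also have "norm \<dots> \<le> (\<Sum>i\<in>J. w i * norm (fps_nth (b i) (m - k)) * norm (fps_nth \<psi> k))"
      proof (rule order_trans[OF norm_sum], rule sum_mono)
        fix i assume "i \<in> J"
        then have i: "i \<le> \<alpha>" using top by (auto simp: J_def)
        have "Q powi (i * (N + int k)) = w i * Q powi ((i - \<alpha>) * int k) * Q powi (\<alpha> * (N + int k))"
          using Q unfolding w_def by (simp flip: power_int_add add: algebra_simps)
        also have "\<dots> \<le> w i * 1 * Q powi (\<alpha> * (N + int k))"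
        proof -
          have "(i - \<alpha>) * int k \<le> 0" using i by (simp add: mult_le_0_iff)
          then have "Q powi ((i - \<alpha>) * int k) \<le> Q powi 0"
            using Q by (intro power_int_increasing) auto
          then show ?thesis using Q w[of i] by (intro mult_right_mono mult_left_mono) auto
        qed
        finally have "Q powi (i * (N + int k)) \<le> w i * Q powi (\<alpha> * (N + int k))" by simp
        then have "norm (fps_nth (b i) (m - k)) * norm (fps_nth \<phi> k) * Q powi (i * (N + int k))
            \<le> norm (fps_nth (b i) (m - k)) * norm (fps_nth \<phi> k) * (w i * Q powi (\<alpha> * (N + int k)))"
          by (intro mult_left_mono) auto
        then show "norm (fps_nth (b i) (m - k) * q powi (i * (N + int k)) * fps_nth \<phi> k)
            \<le> w i * norm (fps_nth (b i) (m - k)) * norm (fps_nth \<psi> k)"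
          by (simp add: norm_mult norm_power_int \<psi>_def mult_ac flip: Q_def)
      qed
      finally show "norm (M N m k * fps_nth \<phi> k) \<le> B (m - k) * norm (fps_nth \<psi> k)"
        by (simp add: B_def sum_distrib_right)
    qed
    finally have "norm (fps_nth \<psi> m) * t ^ m
        \<le> (norm (fps_nth (fps_qop q N I b \<phi>) m) + (\<Sum>k<m. B (m - k) * norm (fps_nth \<psi> k))) * t ^ m"
      using t by (intro mult_right_mono) auto
    moreover have "norm (fps_nth (fps_qop q N I b \<phi>) m) * t ^ m \<le> norm (fps_nth (fps_qop q N I b \<phi>) m) * s' ^ m"
      using t by (intro mult_left_mono power_mono) auto
    ultimately show "norm (fps_nth \<psi> m) * t ^ m \<le> D + (\<Sum>k<m. B (m - k) * norm (fps_nth \<psi> k)) * t ^ m"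
      using D[of m] by (simp add: distrib_right)
  next
    fix m
    have "(\<Sum>k = 1..m. B k * t ^ k) = (\<Sum>i\<in>J. w i * (\<Sum>k = 1..m. norm (fps_nth (b i) k) * t ^ k))"
      by (simp add: B_def sum_distrib_right sum_distrib_left mult_ac sum.swap[of _ "{Suc 0..m}" J])
    \<comment> \<open>The constant terms of the non-dominant coefficients vanish; the resulting
      factor \<open>t / s\<close> is what makes the total weight small for small
      \<open>t\<close>.\<close>
    also have "\<dots> \<le> (\<Sum>i\<in>J. w i * (2 * C i * (t / s) ^ 1))"
    proof (intro sum_mono mult_left_mono)
      fix i assume i: "i \<in> J"
      have "(\<Sum>k = 1..m. norm (fps_nth (b i) k) * t ^ k) \<le> (\<Sum>k\<le>m. norm (fps_nth (b i) k) * t ^ k)"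
        using t by (intro sum_mono2) auto
      also have "\<dots> \<le> 2 * C i * (t / s) ^ 1"
        by (rule sum_norm_fps_nth_le) (use C s t i b_0 in \<open>auto simp: J_def\<close>)
      finally show "(\<Sum>k = 1..m. norm (fps_nth (b i) k) * t ^ k) \<le> 2 * C i * (t / s) ^ 1" .
    qed (use w less_imp_le in auto)
    also have "\<dots> = W * (t / s)" unfolding W_def sum_distrib_right by (intro sum.cong) auto
    finally show "(\<Sum>k = 1..m. B k * t ^ k) \<le> 1 / 2" using tW by linarith
  next
    show "B k \<ge> 0" for k unfolding B_def using w by (intro sum_nonneg mult_nonneg_nonneg) (auto intro: less_imp_le)
    show "D \<ge> 0" using order_trans[OF norm_ge_zero, of "fps_nth (fps_qop q N I b \<phi>) 0" D] D[of 0] by simp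
  qed (use t in auto)
  then have "geom_bounded t \<psi>" by (rule geom_boundedI)
  then have "geom_bounded (t * Q powi \<alpha>) \<phi>"
    using geom_bounded_qdil_iff[of q t \<alpha> "t * Q powi \<alpha>"] q_nonzero by (simp add: \<psi>_def Q_def)
  then show ?thesis using t Q by (intro exI[of _ "t * Q powi \<alpha>"]) simp
qed

lemma T_surj_convergent:
  assumes top: "\<And>i. i \<in> I \<Longrightarrow> i \<le> \<alpha>" and g: "fls_conv_radius g > 0"
  shows "\<exists>f. fls_conv_radius f > 0 \<and> T f = g"
proof -
  obtain f where f: "T f = g" using T_surj by blast
  obtain \<phi> where \<phi>: "f = fls_monom_mult (fls_subdegree f) \<phi>"
    using fls_monom_mult_exists[of "fls_subdegree f" f] by auto
  have "g = fls_monom_mult (fls_subdegree f) (fps_qop q (fls_subdegree f) I b \<phi>)"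
    using f \<phi> fls_qop_monom_mult[OF q_nonzero] by metis
  with g have "\<exists>s>0. geom_bounded s (fps_qop q (fls_subdegree f) I b \<phi>)"
    by (simp only: fls_conv_radius_monom_mult_pos_iff)
  then have "\<exists>s>0. geom_bounded s \<phi>" using fps_qop_solution_geom_bounded top by blast
  then have "fls_conv_radius f > 0" by (subst \<phi>) (simp only: fls_conv_radius_monom_mult_pos_iff)
  with f show ?thesis by blast
qed

end

section \<open>The cokernel of an operator of positive slope\<close>

lemma fls_monom_mult_eq_iff: "fls_monom_mult N f = fls_monom_mult N g \<longleftrightarrow> f = g"
  by (simp add: fls_shift_eq_iff)

lemma fls_monom_mult_eq_0_iff: "fls_monom_mult N f = 0 \<longleftrightarrow> f = 0"
  using fls_monom_mult_eq_iff[of N f 0] by simp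

text \<open>Two indices play different parts: dominance of \<open>\<alpha>\<close> makes the
  operator triangular, while the top index \<open>n\<close>, whose coefficient starts in degree
  \<open>d\<close>, governs convergence.\<close>

locale cokernel_qop = convergent_dominated_qop +
  fixes n :: int and d :: nat
  assumes n: "n \<in> I" and top: "\<And>i. i \<in> I \<Longrightarrow> i \<le> n"
    and d: "\<And>k. k < d \<Longrightarrow> fps_nth (b n) k = 0" "fps_nth (b n) d \<noteq> 0"
begin

definition \<beta> :: complex where "\<beta> = fps_nth (b n) d"

definition b' :: "int \<Rightarrow> complex fps" where "b' = b(n := b n - fps_const \<beta> * fps_X ^ d)"

lemma \<beta>_nz: "\<beta> \<noteq> 0" using d by (simp add: \<beta>_def)

lemma b'_n_nth: "fps_nth (b' n) k = (if k \<le> d then 0 else fps_nth (b n) k)"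
  using d by (auto simp: b'_def fps_X_power_nth \<beta>_def)

definition contracting :: "real \<Rightarrow> nat \<Rightarrow> bool" where
  "contracting r N \<longleftrightarrow> (\<forall>m. (\<Sum>i\<in>I. norm q powi ((i - n) * int N) * (\<Sum>k\<le>m. norm (fps_nth (b' i) k) * r ^ k))
                  \<le> norm \<beta> * r ^ d / 2)"

text \<open>The term \<open>i = n\<close> gains nothing from a large \<open>N\<close>, but its
  remainder starts beyond degree \<open>d\<close> and is controlled by a small radius. At a fixed
  radius the other terms are beaten by \<open>|q|^(-N)\<close>. Hence \<open>r0\<close> comes before
  \<open>N0\<close>, which depends on \<open>t\<close>.\<close>

lemma contraction_radius:
  "\<exists>s r0. 0 < r0 \<and> r0 \<le> s / 2 \<and> (\<forall>i\<in>I. geom_bounded s (b i)) \<and>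
     (\<forall>t. 0 < t \<and> t \<le> r0 \<longrightarrow>
       (\<forall>m. (\<Sum>k\<le>m. norm (fps_nth (b n - fps_const \<beta> * fps_X ^ d) k) * t ^ k) \<le> norm \<beta> * t ^ d / 2) \<and>
       (\<exists>N0. \<forall>N\<ge>N0. contracting t N))"
proof -
  define Q where "Q = norm q"
  have Q: "Q > 1" "Q > 0" using q by (auto simp: Q_def intro: less_trans[OF zero_less_one])
  obtain s C where s: "s > 0" and C: "\<And>i k. i \<in> I \<Longrightarrow> norm (fps_nth (b i) k) * s ^ k \<le> C i"
    using common_bound by blast
  have C0: "C i \<ge> 0" if "i \<in> I" for i
    using order_trans[OF norm_ge_zero, of "fps_nth (b i) 0" "C i"] C[OF that, of 0] by simp
  have C': "norm (fps_nth (b' i) k) * s ^ k \<le> C i" if "i \<in> I" for i k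
  proof (cases "i = n")
    case True
    then show ?thesis using C[OF that, of k] C0[OF that] by (simp add: b'_n_nth)
  next
    case False
    then show ?thesis using C[OF that, of k] by (simp add: b'_def)
  qed
  \<comment> \<open>Chosen so that \<open>2 * C n * t / s ^ Suc d\<close> is at most
    \<open>|\<beta>| / 4\<close> for \<open>t \<le> x\<close>; the \<open>+ 1\<close> avoids
    division by zero. The allowed one half is shared equally: one quarter for \<open>i = n\<close>,
    one quarter for all other terms.\<close>
  define x where "x = norm \<beta> * s ^ d * s / (8 * (C n + 1))"
  have Cn: "C n \<ge> 0" using C0 n by blast
  have x: "x > 0" unfolding x_def using \<beta>_nz s Cn by (intro divide_pos_pos mult_pos_pos) auto
  define r0 where "r0 = min (s / 2) x"
  have r0: "0 < r0" "r0 \<le> s / 2" using s x by (auto simp: r0_def)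
  have tail: "(\<Sum>k\<le>m. norm (fps_nth (b' n) k) * t ^ k) \<le> norm \<beta> * t ^ d / 4"
    if t: "0 < t" "t \<le> r0" for t m
  proof -
    have "(\<Sum>k\<le>m. norm (fps_nth (b' n) k) * t ^ k) \<le> 2 * C n * (t / s) ^ Suc d"
      using t r0 s by (intro sum_norm_fps_nth_le C' n) (auto simp: b'_n_nth)
    also have "\<dots> = (2 * C n * t / (s ^ d * s)) * t ^ d" by (simp add: power_divide field_simps)
    also have "\<dots> \<le> (norm \<beta> / 4) * t ^ d"
    proof (rule mult_right_mono)
      have "t \<le> x" using t by (simp add: r0_def)
      then have "t * (8 * (C n + 1)) \<le> norm \<beta> * (s ^ d * s)"
        unfolding x_def using Cn by (simp add: pos_le_divide_eq mult.assoc)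
      moreover have "t * (8 * C n) \<le> t * (8 * (C n + 1))" using t by simp
      ultimately have "t * (8 * C n) \<le> norm \<beta> * (s ^ d * s)" by linarith
      then show "2 * C n * t / (s ^ d * s) \<le> norm \<beta> / 4"
        using s by (simp add: pos_divide_le_eq mult_ac)
    qed (use t in auto)
    finally show ?thesis by simp
  qed
  have contr: "\<exists>N0. \<forall>N\<ge>N0. contracting t N" if t: "0 < t" "t \<le> r0" for t
  proof -
    define K where "K = (\<Sum>i\<in>I - {n}. 2 * C i)"
    have K: "K \<ge> 0" unfolding K_def using C0 by (intro sum_nonneg) auto
    define y where "y = norm \<beta> * t ^ d / 4"
    have y: "y > 0" using \<beta>_nz t by (simp add: y_def)
    have "1 / Q < 1" using Q by simp
    then have "(\<lambda>N. K * (1 / Q) ^ N) \<longlonglongrightarrow> K * 0"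
      using Q by (intro tendsto_mult tendsto_const LIMSEQ_power_zero) auto
    then have "eventually (\<lambda>N. K * (1 / Q) ^ N < y) sequentially"
      using y by (auto dest: order_tendstoD)
    then obtain N0 where N0: "\<And>N. N \<ge> N0 \<Longrightarrow> K * (1 / Q) ^ N < y"
      by (auto simp: eventually_sequentially)
    have "contracting t N" if "N \<ge> N0" for N
      unfolding contracting_def
    proof
      fix m
      define S where "S i = (\<Sum>k\<le>m. norm (fps_nth (b' i) k) * t ^ k)" for i
      have S0: "S i \<ge> 0" for i unfolding S_def using t by (intro sum_nonneg) auto
      have "(\<Sum>i\<in>I. Q powi ((i - n) * int N) * S i) = S n + (\<Sum>i\<in>I - {n}. Q powi ((i - n) * int N) * S i)"
        using I n by (simp add: sum.remove[of I n])
      also have "S n \<le> y" unfolding S_def y_def by (rule tail[OF t])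
      also have "(\<Sum>i\<in>I - {n}. Q powi ((i - n) * int N) * S i) \<le> (\<Sum>i\<in>I - {n}. (1 / Q) ^ N * (2 * C i))"
      proof (intro sum_mono mult_mono)
        fix i assume i: "i \<in> I - {n}"
        then have "i - n \<le> -1" using top[of i] by auto
        then have "(i - n) * int N \<le> (-1) * int N" by (rule mult_right_mono) auto
        then have "Q powi ((i - n) * int N) \<le> Q powi (- int N)"
          using Q by (intro power_int_increasing) auto
        then show "Q powi ((i - n) * int N) \<le> (1 / Q) ^ N"
          by (simp add: power_int_minus power_one_over inverse_eq_divide)
        show "S i \<le> 2 * C i"
          using sum_norm_fps_nth_le[of "b' i" s "C i" t 0 m] C'[of i] i s t r0 by (simp add: S_def)
      qed (use S0 Q in auto)
      also have "\<dots> = K * (1 / Q) ^ N" by (simp add: K_def sum_distrib_left mult.commute)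
      also have "\<dots> \<le> y" using N0[OF that] by simp
      finally show "(\<Sum>i\<in>I. norm q powi ((i - n) * int N) * (\<Sum>k\<le>m. norm (fps_nth (b' i) k) * t ^ k))
          \<le> norm \<beta> * t ^ d / 2"
        by (simp add: S_def y_def Q_def mult.commute)
    qed
    then show ?thesis by blast
  qed
  have "(\<Sum>k\<le>m. norm (fps_nth (b n - fps_const \<beta> * fps_X ^ d) k) * t ^ k) \<le> norm \<beta> * t ^ d / 2"
    if t: "0 < t" "t \<le> r0" for t m
  proof -
    have "norm \<beta> * t ^ d \<ge> 0" using t by simp
    with tail[OF t, of m] show ?thesis by (simp add: b'_def)
  qed
  moreover have "geom_bounded s (b i)" if "i \<in> I" for i
    using C[OF that] by (rule geom_boundedI)
  ultimately show ?thesis using r0 contr by blast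
qed

text \<open>The diagonal entries are nonzero, so the lowest coefficient can be cancelled by the
  image of a monomial, one degree at a time. Such an image is bounded at scale \<open>r\<close>, so
  the radius survives any number of steps.\<close>

lemma remove_low_order_terms:
  assumes r: "0 < r" "r \<le> s / 2" and bs: "\<And>i. i \<in> I \<Longrightarrow> geom_bounded s (b i)"
    and \<gamma>: "geom_bounded r \<gamma>"
  shows "\<exists>f \<gamma>'. fls_conv_radius f > 0 \<and> geom_bounded r \<gamma>' \<and>
           fls_monom_mult L \<gamma> = T f + fls_monom_mult (L + int K) \<gamma>'"
proof (induction K)
  case 0
  show ?case using \<gamma> q_nonzero by (intro exI[of _ 0] exI[of _ \<gamma>]) simp
next
  case (Suc K)
  then obtain f \<gamma>' where f: "fls_conv_radius f > 0" "geom_bounded r \<gamma>'"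
    "fls_monom_mult L \<gamma> = T f + fls_monom_mult (L + int K) \<gamma>'" by blast
  define H where "H = L + int K"
  define \<phi> where "\<phi> = fps_const (fps_nth \<gamma>' 0 / q powi (\<alpha> * H))"
  define \<delta> where "\<delta> = \<gamma>' - fps_qop q H I b \<phi>"
  have "geom_bounded r (fps_qdil q H i \<phi>)" for i
    by (rule geom_bounded_eventually_0[of 0]) (simp add: \<phi>_def)
  then have "geom_bounded r \<delta>"
    unfolding \<delta>_def fps_qop_def using r
    by (intro geom_bounded_diff f(2) geom_bounded_sum geom_bounded_mult[of s]) (auto intro: bs)
  then obtain C where C: "\<And>k. norm (fps_nth \<delta> k) * r ^ k \<le> C" by (auto simp: geom_bounded_def)
  have \<delta>_shift: "geom_bounded r (fps_shift 1 \<delta>)"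
  proof (rule geom_boundedI[where C = "C / r"])
    fix k
    show "norm (fps_nth (fps_shift 1 \<delta>) k) * r ^ k \<le> C / r"
      using C[of "Suc k"] r by (simp add: field_simps)
  qed
  have "fps_nth \<delta> 0 = 0"
    using q_nonzero by (simp add: \<delta>_def fps_qop_nth_0 \<phi>_def)
  then have "fls_monom_mult H \<delta> = fls_monom_mult (H + 1) (fps_shift 1 \<delta>)"
    by (auto simp: fls_eq_iff nat_diff_distrib nat_add_distrib Suc_nat_eq_nat_zadd1 algebra_simps
        intro!: arg_cong[of _ _ "fps_nth \<delta>"])
  moreover have "fls_monom_mult H \<gamma>' = fls_monom_mult H (fps_qop q H I b \<phi>) + fls_monom_mult H \<delta>"
    by (simp add: \<delta>_def)
  ultimately have "fls_monom_mult H \<gamma>' = T (fls_monom_mult H \<phi>) + fls_monom_mult (H + 1) (fps_shift 1 \<delta>)"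
    by (simp only: fls_qop_monom_mult[OF q_nonzero])
  then have "fls_monom_mult L \<gamma> = T (f + fls_monom_mult H \<phi>) + fls_monom_mult (L + int (Suc K)) (fps_shift 1 \<delta>)"
    using f(3) unfolding fls_qop_add[OF q_nonzero] by (simp add: H_def algebra_simps)
  moreover have "fls_conv_radius (f + fls_monom_mult H \<phi>) > 0"
    using f(1) by (intro less_le_trans[OF _ fls_conv_radius_add]) (simp add: \<phi>_def)
  ultimately show ?case using \<delta>_shift by blast
qed

text \<open>One \<open>N\<close> must serve all \<open>g\<close>, although the order from which the
  operator contracts depends on the radius of \<open>g\<close>. This is why the equation is solved
  twice, first at an order \<open>H\<close> suited to \<open>g\<close> and then at \<open>N\<close>
  for the polynomial left over.\<close>

lemma cokernel_monomials:
  "\<exists>N :: nat. (\<forall>g. fls_conv_radius g > 0 \<longrightarrow>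
           (\<exists>f \<pi>. fls_conv_radius f > 0 \<and> (\<forall>k\<ge>d. fps_nth \<pi> k = 0) \<and> g = T f + fls_monom_mult (int N) \<pi>)) \<and>
       (\<forall>f \<pi>. fls_conv_radius f > 0 \<longrightarrow> (\<forall>k\<ge>d. fps_nth \<pi> k = 0) \<longrightarrow> T f = fls_monom_mult (int N) \<pi> \<longrightarrow> \<pi> = 0)"
proof -
  obtain s r0 where *: "0 < r0 \<and> r0 \<le> s / 2 \<and> (\<forall>i\<in>I. geom_bounded s (b i)) \<and>
     (\<forall>t. 0 < t \<and> t \<le> r0 \<longrightarrow>
       (\<forall>m. (\<Sum>k\<le>m. norm (fps_nth (b n - fps_const \<beta> * fps_X ^ d) k) * t ^ k) \<le> norm \<beta> * t ^ d / 2) \<and>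
       (\<exists>N0. \<forall>N\<ge>N0. contracting t N))"
    using contraction_radius by (elim exE)
  have r0: "0 < r0" "r0 \<le> s / 2" using * by simp_all
  have bs: "geom_bounded s (b i)" if "i \<in> I" for i using * that by simp
  have tail: "(\<Sum>k\<le>m. norm (fps_nth (b n - fps_const \<beta> * fps_X ^ d) k) * t ^ k) \<le> norm \<beta> * t ^ d / 2"
    if "0 < t" "t \<le> r0" for m t
    using * that by simp
  have contr: "\<exists>N0. \<forall>N\<ge>N0. contracting t N" if "0 < t" "t \<le> r0" for t
    using * that by simp
  obtain N where N: "contracting r0 N" using contr[of r0] r0 by auto
  have q0: "norm q > 0" using q_nonzero by simp
  have finite_sol: "\<exists>f \<pi>. fls_conv_radius f > 0 \<and> (\<forall>k\<ge>d. fps_nth \<pi> k = 0) \<and>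
      fls_monom_mult H \<gamma> = T f + fls_monom_mult H \<pi>"
    if H: "contracting r H" and r: "r > 0" and \<gamma>: "geom_bounded r \<gamma>" for r H \<gamma>
  proof -
    have "\<exists>\<phi>. geom_bounded (r * norm q powi n) \<phi> \<and>
        (\<forall>l. fps_nth (fps_qop q (int H) I b \<phi>) (l + d) = fps_nth \<gamma> (l + d))"
      by (rule truncated_qop_surj[where r = r and \<beta> = \<beta> and b' = b' and n = n])
         (fact q I(1) n top r refl \<beta>_nz b'_def H[unfolded contracting_def, rule_format] \<gamma>)+
    then obtain \<phi> where \<phi>: "geom_bounded (r * norm q powi n) \<phi>"
      "\<And>l. fps_nth (fps_qop q (int H) I b \<phi>) (l + d) = fps_nth \<gamma> (l + d)"
      by blast
    define \<pi> where "\<pi> = \<gamma> - fps_qop q H I b \<phi>"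
    have "fps_nth \<pi> k = 0" if "k \<ge> d" for k
      using \<phi>(2)[of "k - d"] that by (simp add: \<pi>_def)
    moreover have "fls_monom_mult H \<gamma> = T (fls_monom_mult H \<phi>) + fls_monom_mult H \<pi>"
      unfolding fls_qop_monom_mult[OF q_nonzero] by (simp add: \<pi>_def)
    moreover have "fls_conv_radius (fls_monom_mult H \<phi>) > 0"
      unfolding fls_conv_radius_monom_mult_pos_iff using \<phi>(1) r q0
      by (intro exI[of _ "r * norm q powi n"]) simp
    ultimately show ?thesis by blast
  qed
  have "\<exists>f \<pi>. fls_conv_radius f > 0 \<and> (\<forall>k\<ge>d. fps_nth \<pi> k = 0) \<and> g = T f + fls_monom_mult N \<pi>"
    if g: "fls_conv_radius g > 0" for g
  proof -
    \<comment> \<open>\<open>L\<close> is made nonpositive so that the distance up to the order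
      \<open>H\<close> is a natural number of elimination steps.\<close>
    define L where "L = min (fls_subdegree g) 0"
    obtain \<gamma> where \<gamma>: "g = fls_monom_mult L \<gamma>"
      using fls_monom_mult_exists[of L g] by (auto simp: L_def)
    obtain \<rho> where \<rho>: "\<rho> > 0" "geom_bounded \<rho> \<gamma>"
      using g unfolding \<gamma> fls_conv_radius_monom_mult_pos_iff by blast
    define r where "r = min \<rho> r0"
    have r: "0 < r" "r \<le> r0" "r \<le> \<rho>" "r \<le> s / 2" using \<rho> r0 by (auto simp: r_def)
    obtain H0 where H0: "\<And>H. H \<ge> H0 \<Longrightarrow> contracting r H" using contr r by blast
    define H where "H = max H0 N"
    have H: "contracting r H" "H \<ge> N" using H0 by (auto simp: H_def)
    define K where "K = nat (int H - L)"
    have "L \<le> 0" by (simp add: L_def)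
    then have K: "L + int K = int H" by (simp add: K_def)
    have "geom_bounded r \<gamma>" using geom_bounded_mono[OF \<rho>(2), of r] r by simp
    then obtain f1 \<gamma>1 where f1: "fls_conv_radius f1 > 0" "geom_bounded r \<gamma>1"
      "g = T f1 + fls_monom_mult H \<gamma>1"
      using remove_low_order_terms[of r s \<gamma> L K] r bs unfolding \<gamma> K by blast
    obtain f2 \<pi>2 where f2: "fls_conv_radius f2 > 0" "\<And>k. k \<ge> d \<Longrightarrow> fps_nth \<pi>2 k = 0"
      "fls_monom_mult H \<gamma>1 = T f2 + fls_monom_mult H \<pi>2"
      using finite_sol[OF H(1) r(1) f1(2)] by blast
    \<comment> \<open>The remainder \<open>z^H * \<pi>2\<close>, rewritten as a multiple of
      \<open>z^N\<close>. Being a polynomial it is bounded at the fixed scale \<open>r0\<close>,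
      whatever the radius of \<open>g\<close> was.\<close>
    define \<gamma>3 where "\<gamma>3 = fps_X ^ (H - N) * \<pi>2"
    have "geom_bounded r0 \<gamma>3"
      by (rule geom_bounded_eventually_0[of "d + (H - N)"]) (use f2(2) in \<open>auto simp: \<gamma>3_def fps_X_power_mult_nth\<close>)
    then obtain f3 \<pi> where f3: "fls_conv_radius f3 > 0" "\<And>k. k \<ge> d \<Longrightarrow> fps_nth \<pi> k = 0"
      "fls_monom_mult N \<gamma>3 = T f3 + fls_monom_mult N \<pi>"
      using finite_sol[OF N r0(1)] by blast
    have "fls_monom_mult N \<gamma>3 = fls_monom_mult H \<pi>2"
      using H(2) by (auto simp: fls_eq_iff \<gamma>3_def fps_X_power_mult_nth intro!: arg_cong[of _ _ "fps_nth \<pi>2"])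
    then have "g = T (f1 + f2 + f3) + fls_monom_mult N \<pi>"
      using f1(3) f2(3) f3(3) by (simp add: fls_qop_add[OF q_nonzero])
    moreover have "fls_conv_radius (f1 + f2 + f3) > 0"
      using f1(1) f2(1) f3(1) by (intro less_le_trans[OF _ fls_conv_radius_add] min_less_iff_conj[THEN iffD2] conjI)
    ultimately show ?thesis using f3(2) by blast
  qed
  moreover have "\<pi> = 0"
    if f: "fls_conv_radius f > 0" and \<pi>: "\<forall>k\<ge>d. fps_nth \<pi> k = 0" and eq: "T f = fls_monom_mult N \<pi>" for f \<pi>
  proof (rule ccontr)
    assume "\<pi> \<noteq> 0"
    then have "T f \<noteq> 0" unfolding eq fls_monom_mult_eq_0_iff .
    then have "f \<noteq> 0" using q_nonzero by auto
    \<comment> \<open>Since \<open>T\<close> preserves the order, \<open>f\<close> itself is a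
      multiple of \<open>z^N\<close>, where the contraction estimate is available.\<close>
    have "fls_subdegree (T f) \<ge> int N"
      unfolding eq using \<open>\<pi> \<noteq> 0\<close> by (simp add: fls_shift_subdegree fls_subdegree_fls_to_fps)
    then have "int N \<le> fls_subdegree f" using T_nonzero(2)[OF \<open>f \<noteq> 0\<close>] by simp
    then obtain \<phi> where \<phi>: "f = fls_monom_mult N \<phi>" by (rule fls_monom_mult_exists)
    have op: "fps_qop q N I b \<phi> = \<pi>"
      using eq unfolding \<phi> fls_qop_monom_mult[OF q_nonzero] fls_monom_mult_eq_iff .
    obtain \<rho> where \<rho>: "\<rho> > 0" "geom_bounded \<rho> \<phi>"
      using f unfolding \<phi> fls_conv_radius_monom_mult_pos_iff by blast
    have "geom_bounded r0 (fps_qop q N I b \<phi>)"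
      unfolding op by (rule geom_bounded_eventually_0[of d]) (use \<pi> in auto)
    note bounded = this
    \<comment> \<open>So far \<open>f\<close> is only known to converge on some disc; the polynomial
      right-hand side lets regularity raise this to the scale needed for injectivity.\<close>
    have reg: "geom_bounded (r0 * norm q powi n) \<phi>"
      by (rule qop_regularity[where I = I and b = b and N = "int N" and s = s and d = d and \<beta> = \<beta>])
         (fact q I(1) n top d(1) \<beta>_def[symmetric] \<beta>_nz bs r0 tail bounded \<rho>)+
    have ker: "fps_nth (fps_qop q (int N) I b \<phi>) (l + d) = 0" for l
      unfolding op using \<pi> by simp
    have "\<phi> = 0"
      by (rule truncated_qop_inj[where r = r0 and \<beta> = \<beta> and b' = b' and n = n])
         (fact q I(1) n top r0(1) refl \<beta>_nz b'_def N[unfolded contracting_def, rule_format] reg ker)+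
    with \<open>f \<noteq> 0\<close> \<phi> show False by simp
  qed
  ultimately show ?thesis by blast
qed

end

section \<open>Analytic continuation of solutions\<close>

lemma meromorphic_identity:
  assumes f: "f meromorphic_on S" and g: "g meromorphic_on S" and S: "open S" "connected S"
    and a: "a \<in> S" "\<forall>\<^sub>F z in at a. f z = g z" and z: "z \<in> S"
  shows "\<forall>\<^sub>F w in at z. f w = g w"
proof -
  have "(\<lambda>z. f z - g z) meromorphic_on S" using f g by (intro meromorphic_intros)
  then have "(\<forall>\<^sub>F z in cosparse S. f z - g z = 0) \<or> (\<forall>\<^sub>F z in cosparse S. f z - g z \<noteq> 0)"
    by (rule meromorphic_imp_constant_or_avoid[OF _ S])
  then show ?thesis
  proof
    assume "\<forall>\<^sub>F z in cosparse S. f z - g z = 0"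
    from eventually_cosparse_imp_eventually_at[OF this z, of UNIV] show ?thesis by simp
  next
    assume "\<forall>\<^sub>F z in cosparse S. f z - g z \<noteq> 0"
    from eventually_cosparse_imp_eventually_at[OF this a(1), of UNIV] a(2)
    have "\<forall>\<^sub>F w in at a. False" by eventually_elim simp
    then show ?thesis by (simp add: trivial_limit_at)
  qed
qed

lemma eventually_at_0_scale:
  "c \<noteq> 0 \<Longrightarrow> \<forall>\<^sub>F w in at 0. P w \<Longrightarrow> \<forall>\<^sub>F w in at (0 :: complex). P (c * w)"
  using eventually_at_scale[of c P 0] by simp

lemma meromorphic_dilate_ball:
  fixes c :: complex
  assumes "f meromorphic_on ball 0 r" "c \<noteq> 0" "norm c * s \<le> r"
  shows "(\<lambda>z. f (c * z)) meromorphic_on ball 0 s"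
proof (rule meromorphic_on_compose[OF assms(1)])
  have "norm c * norm z < r" if "norm z < s" for z :: complex
  proof -
    have "norm c * norm z < norm c * s" using that assms(2) by simp
    with assms(3) show ?thesis by linarith
  qed
  then show "(*) c ` ball 0 s \<subseteq> ball 0 r" by (auto simp: norm_mult)
qed (auto intro!: analytic_intros)

text \<open>
  Continuations to different discs agree only up to discrete sets of points; removing the
  singularities of each of them makes their gluing consistent.
\<close>

lemma qop_solution_extends:
  fixes q :: complex and a :: "int \<Rightarrow> complex \<Rightarrow> complex"
  assumes q: "norm q > 1" and I: "finite I" "n \<in> I" "\<And>i. i \<in> I \<Longrightarrow> i \<le> n"
    and a: "\<And>i. i \<in> I \<Longrightarrow> a i meromorphic_on UNIV" and an: "\<forall>\<^sub>F z in at 0. a n z \<noteq> 0"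
    and g: "g meromorphic_on UNIV" and r: "r > 0" and f: "f meromorphic_on ball 0 r"
    and eq: "\<forall>\<^sub>F z in at 0. (\<Sum>i\<in>I. a i z * f (q powi i * z)) = g z"
  shows "\<exists>h. h meromorphic_on UNIV \<and> (\<forall>\<^sub>F z in at 0. h z = f z)"
proof -
  have q0: "q \<noteq> 0" "norm q > 0" using q by auto
  have step: "\<exists>h'. h' meromorphic_on ball 0 (norm q * R) \<and> (\<forall>\<^sub>F z in at 0. h' z = f z)"
    if h: "h meromorphic_on ball 0 R" "\<forall>\<^sub>F z in at 0. h z = f z" and R: "R > 0" for h R
  proof -
    define p where "p = q powi (- n)"
    have p0: "p \<noteq> 0" using q0 by (simp add: p_def)
    \<comment> \<open>The equation solved for its top term, with \<open>z\<close> replaced by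
      \<open>q powi (- n) * w\<close>. The other terms evaluate \<open>h\<close> at points of
      modulus at most \<open>|w| / |q|\<close>, so the larger disc is reached.\<close>
    define h' where "h' w = (g (p * w) - (\<Sum>i\<in>I - {n}. a i (p * w) * h (q powi (i - n) * w))) / a n (p * w)" for w
    have mer: "(\<lambda>z. u (p * z)) meromorphic_on S" if "u meromorphic_on UNIV" for u S
      by (rule meromorphic_on_compose[OF that]) (auto intro!: analytic_intros)
    have "h' meromorphic_on ball 0 (norm q * R)"
      unfolding h'_def
    proof (intro meromorphic_intros mer g)
      fix i assume i: "i \<in> I - {n}"
      then have "i - n \<le> -1" using I(3)[of i] by auto
      then have "norm q powi (i - n) \<le> norm q powi (-1)" using q by (intro power_int_increasing) auto
      then have "norm (q powi (i - n)) * (norm q * R) \<le> norm q powi (-1) * (norm q * R)"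
        using q0 R by (intro mult_right_mono) (auto simp: norm_power_int)
      also have "norm q powi (-1) * (norm q * R) = R" using q0 by (simp add: power_int_minus)
      finally show "(\<lambda>w. h (q powi (i - n) * w)) meromorphic_on ball 0 (norm q * R)"
        using q0 by (intro meromorphic_dilate_ball[OF h(1)]) simp_all
    qed (use a I in auto)
    moreover have "\<forall>\<^sub>F w in at 0. h' w = f w"
    proof -
      have e1: "\<forall>\<^sub>F w in at 0. (\<Sum>i\<in>I. a i (p * w) * f (q powi i * (p * w))) = g (p * w)"
        by (rule eventually_at_0_scale[OF p0 eq])
      have e2: "\<forall>\<^sub>F w in at 0. a n (p * w) \<noteq> 0" by (rule eventually_at_0_scale[OF p0 an])
      have e3: "\<forall>\<^sub>F w in at 0. \<forall>i\<in>I. h (q powi (i - n) * w) = f (q powi (i - n) * w)"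
        by (intro eventually_ball_finite I(1) ballI eventually_at_0_scale h(2)) (use q0 in auto)
      have pq: "q powi i * (p * w) = q powi (i - n) * w" for i w
        using q0 by (simp add: p_def power_int_diff power_int_minus field_simps)
      show ?thesis
        using e1 e2 e3
      proof eventually_elim
        case (elim w)
        have "(\<Sum>i\<in>I. a i (p * w) * f (q powi (i - n) * w)) = g (p * w)" using elim(1) by (simp only: pq)
        moreover have "(\<Sum>i\<in>I. a i (p * w) * f (q powi (i - n) * w)) =
            a n (p * w) * f w + (\<Sum>i\<in>I - {n}. a i (p * w) * f (q powi (i - n) * w))"
          using I by (simp add: sum.remove[of I n])
        moreover have "(\<Sum>i\<in>I - {n}. a i (p * w) * h (q powi (i - n) * w)) =
            (\<Sum>i\<in>I - {n}. a i (p * w) * f (q powi (i - n) * w))"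
          using elim(3) by (intro sum.cong) auto
        ultimately show ?case using elim(2) by (simp add: h'_def field_simps)
      qed
    qed
    ultimately show ?thesis by blast
  qed
  define R where "R k = norm q ^ k * r" for k
  have R: "R k > 0" for k using r q0 by (simp add: R_def)
  have "\<exists>h. h meromorphic_on ball 0 (R k) \<and> (\<forall>\<^sub>F z in at 0. h z = f z)" for k
  proof (induction k)
    case 0
    then show ?case using f by (auto simp: R_def)
  next
    case (Suc k)
    then show ?case using step[OF _ _ R[of k]] by (auto simp: R_def mult.assoc)
  qed
  then obtain H where H: "\<And>k. H k meromorphic_on ball 0 (R k)" "\<And>k. \<forall>\<^sub>F z in at 0. H k z = f z"
    by metis
  have agree: "remove_sings (H j) z = remove_sings (H k) z" if "norm z < R j" "norm z < R k" for j k z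
  proof (rule remove_sings_cong[OF _ refl])
    define \<rho> where "\<rho> = min (R j) (R k)"
    have "\<forall>\<^sub>F z in at 0. H j z = H k z" using H(2)[of j] H(2)[of k] by eventually_elim simp
    moreover have "H j meromorphic_on ball 0 \<rho>" "H k meromorphic_on ball 0 \<rho>"
      by (rule meromorphic_on_subset[OF H(1)]; simp add: \<rho>_def subset_ball)+
    ultimately show "\<forall>\<^sub>F w in at z. H j w = H k w"
      using meromorphic_identity[of "H j" "ball 0 \<rho>" "H k" 0 z] that R by (simp add: \<rho>_def)
  qed
  have "\<exists>k. norm z < R k" for z :: complex
  proof -
    obtain k where "norm z / r < norm q ^ k" using real_arch_pow[OF q] by blast
    then show ?thesis using r by (intro exI[of _ k]) (simp add: R_def pos_divide_less_eq)
  qed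
  then obtain \<kappa> where \<kappa>: "\<And>z :: complex. norm z < R (\<kappa> z)" by metis
  define h where "h z = remove_sings (H (\<kappa> z)) z" for z
  have near: "\<forall>\<^sub>F w in at z. h w = remove_sings (H k) w" if "norm z < R k" for z k
  proof -
    have "\<forall>\<^sub>F w in at z. w \<in> ball 0 (R k)"
      using that by (intro eventually_at_in_open') auto
    then show ?thesis by eventually_elim (auto simp: h_def intro!: agree \<kappa>)
  qed
  have "h meromorphic_on {z}" for z
  proof -
    have "remove_sings (H (\<kappa> z)) meromorphic_on {z}"
      using \<kappa>[of z] by (intro remove_sings_meromorphic meromorphic_on_subset[OF H(1)[of "\<kappa> z"]]) auto
    moreover have "h meromorphic_on {z} \<longleftrightarrow> remove_sings (H (\<kappa> z)) meromorphic_on {z}"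
      by (rule meromorphic_on_cong) (use near[OF \<kappa>[of z]] in auto)
    ultimately show ?thesis by simp
  qed
  then have "h meromorphic_on UNIV" by (auto simp: meromorphic_on_def)
  moreover have "\<forall>\<^sub>F z in at 0. h z = f z"
  proof -
    have "\<forall>\<^sub>F z in at 0. h z = remove_sings (H 0) z" using near[of 0 0] R by simp
    moreover have "\<forall>\<^sub>F z in at 0. remove_sings (H 0) z = H 0 z"
    proof (rule eventually_remove_sings_eq_at)
      have "H 0 meromorphic_on {0}" using R by (intro meromorphic_on_subset[OF H(1)[of 0]]) auto
      then show "isolated_singularity_at (H 0) 0" by (simp add: meromorphic_at_iff)
    qed
    ultimately show ?thesis using H(2)[of 0] by eventually_elim simp
  qed
  ultimately show ?thesis by blast
qed

section \<open>Laurent expansion as an embedding of the coefficient fields\<close>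

lemma meromorphic_has_laurent_expansion_0:
  "f meromorphic_on {0} \<Longrightarrow> f has_laurent_expansion laurent_expansion f 0"
  using meromorphic_on_imp_has_laurent_expansion[of f "{0}" 0] by simp

lemma has_laurent_expansion_dilate:
  assumes "f has_laurent_expansion F" "c \<noteq> 0"
  shows "(\<lambda>z. f (c * z)) has_laurent_expansion fls_dilate c F"
proof -
  have "(\<lambda>z. c * z) has_laurent_expansion fps_to_fls (fps_const c * fps_X)"
    by (auto intro!: has_laurent_expansion_fps fps_expansion_intros)
  from has_laurent_expansion_compose[OF assms(1) this] assms(2) show ?thesis
    by (simp add: fls_dilate_def o_def)
qed

context
  fixes f g :: "complex \<Rightarrow> complex"
  assumes f: "f meromorphic_on {0}" and g: "g meromorphic_on {0}"
begin

lemma laurent_expansion_add: "laurent_expansion (\<lambda>z. f z + g z) 0 = laurent_expansion f 0 + laurent_expansion g 0"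
  and laurent_expansion_mult: "laurent_expansion (\<lambda>z. f z * g z) 0 = laurent_expansion f 0 * laurent_expansion g 0"
  and laurent_expansion_dilate: "c \<noteq> 0 \<Longrightarrow> laurent_expansion (\<lambda>z. f (c * z)) 0 = fls_dilate c (laurent_expansion f 0)"
  by (intro laurent_expansion_0_eqI has_laurent_expansion_dilate laurent_expansion_intros
        meromorphic_has_laurent_expansion_0 f g; assumption)+

lemma zorder_eq_subdegree_laurent_expansion:
  assumes "\<not> (\<forall>\<^sub>F z in at 0. f z = 0)"
  shows "zorder f 0 = fls_subdegree (laurent_expansion f 0)"
proof -
  have "laurent_expansion f 0 \<noteq> 0"
    using assms meromorphic_has_laurent_expansion_0[OF f]
    by (auto simp: has_laurent_expansion_def elim!: eventually_mono)
  then show ?thesis by (rule has_laurent_expansion_zorder_0[OF meromorphic_has_laurent_expansion_0[OF f]])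
qed

lemma fls_conv_radius_laurent_expansion: "fls_conv_radius (laurent_expansion f 0) > 0"
  using meromorphic_has_laurent_expansion_0[OF f] by (simp add: has_laurent_expansion_def)

end

lemma laurent_expansion_const: "laurent_expansion (\<lambda>_. c) 0 = fls_const c"
  by (intro laurent_expansion_0_eqI) auto

text \<open>Collects what lets equations over the coefficient field be handled as equations of
  Laurent series. Injectivity is automatic for a ring homomorphism between fields. The valuation law
  excludes 0, where the valuations take default values.\<close>

locale laurent_embedding = qfield_laws K for K :: "'a::field qfield" +
  fixes \<epsilon> :: "'a \<Rightarrow> complex fls"
  assumes emb_add: "\<epsilon> (f + g) = \<epsilon> f + \<epsilon> g" and emb_mult: "\<epsilon> (f * g) = \<epsilon> f * \<epsilon> g"
    and emb_cst: "\<epsilon> (cst K a) = fls_const a"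
    and emb_dil: "c \<noteq> 0 \<Longrightarrow> \<epsilon> (dil K c f) = fls_dilate c (\<epsilon> f)"
    and emb_val: "f \<noteq> 0 \<Longrightarrow> val K f = fls_subdegree (\<epsilon> f)"

text \<open>
  \<open>emb_solution\<close> is what the germs and the meromorphic functions have in common: a convergent solution
  of an equation with coefficients in the field belongs to the field.
\<close>

locale convergent_embedding = laurent_embedding +
  assumes emb_conv: "fls_conv_radius (\<epsilon> f) > 0"
    and emb_monomial: "\<exists>x. \<epsilon> x = fls_X_intpow (int k)"
    and emb_solution: "\<lbrakk>norm q > 1; P \<noteq> 0; fls_conv_radius F > 0;
      fls_qop q (Poly_Mapping.keys P) (\<lambda>i. \<epsilon> (Poly_Mapping.lookup P i)) F = \<epsilon> g\<rbrakk> \<Longrightarrow> \<exists>f. \<epsilon> f = F"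

section \<open>The three concrete embeddings\<close>

lemma laurent_embedding_formal: "laurent_embedding formal_field (\<lambda>f. f)"
  by (intro laurent_embedding.intro qfield_laws_formal laurent_embedding_axioms.intro)
     (simp_all add: formal_field_def)

lift_definition germ_expansion :: "mero_germ \<Rightarrow> complex fls" is "\<lambda>f. laurent_expansion f 0"
  by (auto simp: mero_eq_def intro: laurent_expansion_cong)

lift_definition mero_expansion :: "mero_fun \<Rightarrow> complex fls" is "\<lambda>f. laurent_expansion f 0"
  by (auto simp: mero_eq_def intro: laurent_expansion_cong)

lemma laurent_embedding_germ: "laurent_embedding germ_field germ_expansion"
proof (intro laurent_embedding.intro qfield_laws_germ laurent_embedding_axioms.intro)
  fix f g :: mero_germ and a c :: complex
  show "germ_expansion (f + g) = germ_expansion f + germ_expansion g"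
    by transfer (auto intro: laurent_expansion_add dest: mero_eqD)
  show "germ_expansion (f * g) = germ_expansion f * germ_expansion g"
    by transfer (auto intro: laurent_expansion_mult dest: mero_eqD)
  show "germ_expansion (cst germ_field a) = fls_const a"
    unfolding germ_field_def qfield.simps by transfer (rule laurent_expansion_const)
  show "germ_expansion (dil germ_field c f) = fls_dilate c (germ_expansion f)" if "c \<noteq> 0"
    using that unfolding germ_field_def qfield.simps
    by transfer (auto intro!: laurent_expansion_dilate dest: mero_eqD)
  show "val germ_field f = fls_subdegree (germ_expansion f)" if "f \<noteq> 0"
    using that unfolding germ_field_def qfield.simps
    by transfer (auto simp: mero_eq_def intro!: zorder_eq_subdegree_laurent_expansion)
qed

lemma meromorphic_on_UNIV_at_0: "f meromorphic_on UNIV \<Longrightarrow> f meromorphic_on {0}"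
  by (rule meromorphic_on_subset) auto

text \<open>A nonzero element of the field is nonzero somewhere on the plane; the identity theorem
  moves this to the origin, where the valuation is read off.\<close>

lemma not_eventually_0_mero_fun:
  assumes "f meromorphic_on UNIV" "\<not> mero_eq UNIV f (\<lambda>_. 0)"
  shows "\<not> (\<forall>\<^sub>F z in at 0. f z = 0)"
  using assms meromorphic_identity[of f UNIV "\<lambda>_. 0" 0] by (auto simp: mero_eq_def)

lemma laurent_embedding_mero: "laurent_embedding mero_field mero_expansion"
proof (intro laurent_embedding.intro qfield_laws_mero laurent_embedding_axioms.intro)
  fix f g :: mero_fun and a c :: complex
  show "mero_expansion (f + g) = mero_expansion f + mero_expansion g"
    by transfer (auto intro!: laurent_expansion_add meromorphic_on_UNIV_at_0 dest: mero_eqD)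
  show "mero_expansion (f * g) = mero_expansion f * mero_expansion g"
    by transfer (auto intro!: laurent_expansion_mult meromorphic_on_UNIV_at_0 dest: mero_eqD)
  show "mero_expansion (cst mero_field a) = fls_const a"
    unfolding mero_field_def qfield.simps by transfer (rule laurent_expansion_const)
  show "mero_expansion (dil mero_field c f) = fls_dilate c (mero_expansion f)" if "c \<noteq> 0"
    using that unfolding mero_field_def qfield.simps
    by transfer (auto intro!: laurent_expansion_dilate meromorphic_on_UNIV_at_0 dest: mero_eqD)
  show "val mero_field f = fls_subdegree (mero_expansion f)" if "f \<noteq> 0"
    using that unfolding mero_field_def qfield.simps
    by transfer (auto intro!: zorder_eq_subdegree_laurent_expansion meromorphic_on_UNIV_at_0
        dest: mero_eqD not_eventually_0_mero_fun)
qed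

lemma convergent_embedding_germ: "convergent_embedding germ_field germ_expansion"
proof (intro convergent_embedding.intro laurent_embedding_germ convergent_embedding_axioms.intro)
  have range: "\<exists>f. germ_expansion f = F" if "fls_conv_radius F > 0" for F
    using that
  proof transfer
    fix F assume "fls_conv_radius F > 0"
    then have "eval_fls F has_laurent_expansion F" by (rule eval_fls_has_laurent_expansion)
    then show "\<exists>f\<in>{f. mero_eq {0} f f}. laurent_expansion f 0 = F"
      by (intro bexI[of _ "eval_fls F"]) (auto simp: mero_eq_def meromorphic_on_def intro: laurent_expansion_0_eqI)
  qed
  show "\<exists>f. germ_expansion f = F" if "fls_conv_radius F > 0" for F using that by (rule range)
  show "fls_conv_radius (germ_expansion f) > 0" for f
    by transfer (auto intro: fls_conv_radius_laurent_expansion dest: mero_eqD)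
  show "\<exists>x. germ_expansion x = fls_X_intpow (int k)" for k by (rule range) simp
qed

lemma convergent_embedding_mero: "convergent_embedding mero_field mero_expansion"
proof (intro convergent_embedding.intro laurent_embedding_mero convergent_embedding_axioms.intro)
  have range: "\<exists>f. mero_expansion f = F" if "h meromorphic_on UNIV" "h has_laurent_expansion F" for F h
    using that
  proof transfer
    fix F h assume "h meromorphic_on UNIV" "h has_laurent_expansion F"
    then show "\<exists>f\<in>{f. mero_eq UNIV f f}. laurent_expansion f 0 = F"
      by (intro bexI[of _ h]) (auto simp: mero_eq_def intro: laurent_expansion_0_eqI)
  qed
  have rep: "\<exists>h. h meromorphic_on UNIV \<and> h has_laurent_expansion mero_expansion f" for f
  proof transfer
    fix f :: "complex \<Rightarrow> complex" assume "mero_eq UNIV f f"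
    then have "f meromorphic_on UNIV" by (rule mero_eqD)
    then show "\<exists>h. h meromorphic_on UNIV \<and> h has_laurent_expansion laurent_expansion f 0"
      by (intro exI[of _ f] conjI meromorphic_has_laurent_expansion_0 meromorphic_on_UNIV_at_0)
  qed
  show "fls_conv_radius (mero_expansion f) > 0" for f
    using rep[of f] by (auto simp: has_laurent_expansion_def)
  show "\<exists>x. mero_expansion x = fls_X_intpow (int k)" for k
    by (rule range[of "\<lambda>z. z ^ k"])
       (auto intro!: meromorphic_intros simp del: of_nat_power intro: has_laurent_expansion_fps_X_power)
  fix q P F g
  assume q: "norm q > 1" and P: "P \<noteq> 0" and F: "fls_conv_radius F > 0"
    and eq: "fls_qop q (Poly_Mapping.keys P) (\<lambda>i. mero_expansion (Poly_Mapping.lookup P i)) F = mero_expansion g"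
  interpret laurent_embedding mero_field mero_expansion by (rule laurent_embedding_mero)
  define I where "I = Poly_Mapping.keys P"
  define n where "n = Max I"
  have I: "finite I" "n \<in> I" "\<And>i. i \<in> I \<Longrightarrow> i \<le> n" using P by (auto simp: I_def n_def)
  have "\<exists>a. \<forall>i. a i meromorphic_on UNIV \<and> a i has_laurent_expansion mero_expansion (Poly_Mapping.lookup P i)"
    by (rule choice) (intro allI rep)
  then obtain a where a: "\<And>i. a i meromorphic_on UNIV"
    "\<And>i. a i has_laurent_expansion mero_expansion (Poly_Mapping.lookup P i)"
    by blast
  obtain \<gamma> where \<gamma>: "\<gamma> meromorphic_on UNIV" "\<gamma> has_laurent_expansion mero_expansion g" using rep[of g] by blast
  have f: "eval_fls F has_laurent_expansion F" using F by (rule eval_fls_has_laurent_expansion)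
  then have "eval_fls F meromorphic_on {0}" by (auto simp: meromorphic_on_def)
  then obtain S where S: "open S" "0 \<in> S" "eval_fls F meromorphic_on S"
    using meromorphic_on_open_nhd[of "eval_fls F" "{0}"] by auto
  then obtain r where r: "r > 0" "ball 0 r \<subseteq> S" using open_contains_ball by metis
  have "(\<lambda>z. \<Sum>i\<in>I. a i z * eval_fls F (q powi i * z)) has_laurent_expansion mero_expansion g"
    unfolding eq[symmetric] fls_qop_def I_def[symmetric]
    using q by (intro laurent_expansion_intros has_laurent_expansion_dilate a f) auto
  then have "(\<lambda>z. (\<Sum>i\<in>I. a i z * eval_fls F (q powi i * z)) - \<gamma> z) has_laurent_expansion 0"
    using has_laurent_expansion_diff[OF _ \<gamma>(2)] by fastforce
  then have ev: "\<forall>\<^sub>F z in at 0. (\<Sum>i\<in>I. a i z * eval_fls F (q powi i * z)) = \<gamma> z"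
    by (auto simp: has_laurent_expansion_def elim!: eventually_mono)
  have "mero_expansion (Poly_Mapping.lookup P n) \<noteq> 0"
  proof
    assume *: "mero_expansion (Poly_Mapping.lookup P n) = 0"
    define x where "x = Poly_Mapping.lookup P n"
    have "x \<noteq> 0" using I(2) by (simp add: x_def I_def in_keys_iff)
    then have "mero_expansion (inverse x * x) = mero_expansion (cst mero_field 1)" by (simp add: cst_1)
    with * show False by (simp add: emb_mult emb_cst x_def)
  qed
  then have an: "\<forall>\<^sub>F z in at 0. a n z \<noteq> 0"
    using has_laurent_expansion_nonzero_imp_eventually_nonzero[OF a(2)[of n]] by simp
  obtain h where h: "h meromorphic_on UNIV" "\<forall>\<^sub>F z in at 0. h z = eval_fls F z"
    using qop_solution_extends[of q I n a \<gamma> r "eval_fls F"] q I a(1) an \<gamma>(1) r(1)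
      meromorphic_on_subset[OF S(3) r(2)] ev by blast
  have "h has_laurent_expansion F"
    using f has_laurent_expansion_cong[OF h(2), of F F] by simp
  then show "\<exists>f. mero_expansion f = F" using range h(1) by blast
qed

section \<open>Operators over the embedded fields\<close>

context laurent_embedding
begin

lemma emb_0 [simp]: "\<epsilon> 0 = 0" and emb_1 [simp]: "\<epsilon> 1 = 1"
  using emb_cst[of 0] emb_cst[of 1] by (simp_all add: cst_0 cst_1)

lemma emb_sum: "\<epsilon> (sum f I) = (\<Sum>i\<in>I. \<epsilon> (f i))"
  by (induction I rule: infinite_finite_induct) (auto simp: emb_add)

lemma emb_inverse: "x \<noteq> 0 \<Longrightarrow> \<epsilon> x * \<epsilon> (inverse x) = 1"
  by (simp flip: emb_mult)

lemma emb_eq_0_iff [simp]: "\<epsilon> x = 0 \<longleftrightarrow> x = 0"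
  using emb_inverse[of x] by (cases "x = 0") auto

lemma emb_diff: "\<epsilon> (f - g) = \<epsilon> f - \<epsilon> g"
  using emb_add[of "f - g" g] by simp

lemma emb_eq_iff: "\<epsilon> x = \<epsilon> y \<longleftrightarrow> x = y"
  using emb_eq_0_iff[of "x - y"] by (simp add: emb_diff)

lemma emb_divide: "y \<noteq> 0 \<Longrightarrow> \<epsilon> (x / y) = \<epsilon> x / \<epsilon> y"
  using emb_mult[of "x / y" y] by (simp add: nonzero_eq_divide_eq)

lemma emb_qd_apply:
  "q \<noteq> 0 \<Longrightarrow> \<epsilon> (qd_apply K q P f) =
     fls_qop q (Poly_Mapping.keys P) (\<lambda>i. \<epsilon> (Poly_Mapping.lookup P i)) (\<epsilon> f)"
  by (simp add: qd_apply_def fls_qop_def emb_sum emb_mult emb_dil)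

text \<open>Taking the regular part discards nothing when \<open>\<alpha>\<close> is dominant: the
  quotients then have nonnegative order.\<close>

definition norm_coeff :: "'a qdiff_op \<Rightarrow> int \<Rightarrow> int \<Rightarrow> complex fps" where
  "norm_coeff P \<alpha> i = fls_regpart (\<epsilon> (Poly_Mapping.lookup P i / Poly_Mapping.lookup P \<alpha>))"

context
  fixes P :: "'a qdiff_op" and \<alpha> :: int and q :: complex
  assumes q: "norm q > 1" and \<alpha>: "\<alpha> \<in> Poly_Mapping.keys P"
    and dom: "\<And>i. i \<in> Poly_Mapping.keys P \<Longrightarrow> i \<noteq> \<alpha> \<Longrightarrow>
      val K (Poly_Mapping.lookup P i) > val K (Poly_Mapping.lookup P \<alpha>)"
begin

lemma q_nz: "q \<noteq> 0"
  using q by auto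

lemma lookup_nz: "i \<in> Poly_Mapping.keys P \<Longrightarrow> Poly_Mapping.lookup P i \<noteq> 0"
  by (simp add: in_keys_iff)

lemma subdegree_quotient:
  assumes "i \<in> Poly_Mapping.keys P"
  shows "fls_subdegree (\<epsilon> (Poly_Mapping.lookup P i / Poly_Mapping.lookup P \<alpha>)) =
    val K (Poly_Mapping.lookup P i) - val K (Poly_Mapping.lookup P \<alpha>)"
  using lookup_nz[OF assms] lookup_nz[OF \<alpha>]
  by (simp add: emb_divide fls_divide_subdegree emb_val)

lemma fps_to_fls_norm_coeff:
  assumes "i \<in> Poly_Mapping.keys P"
  shows "fps_to_fls (norm_coeff P \<alpha> i) = \<epsilon> (Poly_Mapping.lookup P i) / \<epsilon> (Poly_Mapping.lookup P \<alpha>)"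
proof -
  have "fls_subdegree (\<epsilon> (Poly_Mapping.lookup P i / Poly_Mapping.lookup P \<alpha>)) \<ge> 0"
    unfolding subdegree_quotient[OF assms] using dom[OF assms] by (cases "i = \<alpha>") auto
  then show ?thesis
    unfolding norm_coeff_def by (simp only: fls_regpart_to_fls_trivial emb_divide[OF lookup_nz[OF \<alpha>]])
qed

lemma dominated: "dominated_qop q (Poly_Mapping.keys P) (norm_coeff P \<alpha>) \<alpha>"
proof
  show "norm_coeff P \<alpha> \<alpha> = 1" using lookup_nz[OF \<alpha>] by (simp add: norm_coeff_def)
  fix i assume i: "i \<in> Poly_Mapping.keys P" "i \<noteq> \<alpha>"
  then have "fls_subdegree (\<epsilon> (Poly_Mapping.lookup P i / Poly_Mapping.lookup P \<alpha>)) > 0"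
    using dom[OF i] by (simp add: subdegree_quotient)
  then show "fps_nth (norm_coeff P \<alpha> i) 0 = 0" by (simp add: norm_coeff_def fls_eq0_below_subdegree)
qed (use q \<alpha> in auto)

lemma emb_qd_apply_factor:
  "\<epsilon> (qd_apply K q P f) = \<epsilon> (Poly_Mapping.lookup P \<alpha>) *
     fls_qop q (Poly_Mapping.keys P) (\<lambda>i. fps_to_fls (norm_coeff P \<alpha> i)) (\<epsilon> f)"
  unfolding emb_qd_apply[OF q_nz] fls_qop_def sum_distrib_left
  by (intro sum.cong refl) (use lookup_nz[OF \<alpha>] in \<open>simp add: fps_to_fls_norm_coeff\<close>)

lemma qd_apply_inj: "qd_apply K q P f = 0 \<Longrightarrow> f = 0"
  using emb_qd_apply_factor[of f] lookup_nz[OF \<alpha>] dominated_qop.T_nonzero(1)[OF dominated, of "\<epsilon> f"]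
  by auto

lemmas ker_space_dominated = ker_space_trivial[OF q_nz qd_apply_inj]

lemma coker_space_surj:
  assumes "\<And>g. \<exists>f. qd_apply K q P f = g"
  shows "fin_dim_C (coker_space K q P)" "dim_C (coker_space K q P) = 0"
proof -
  have span: "\<exists>f (c :: nat \<Rightarrow> complex). g = qd_apply K q P f + (\<Sum>j<0. cst K (c j) * 0)" for g
    using assms[of g] by auto
  show "fin_dim_C (coker_space K q P)"
    by (rule coker_space_dim(1)[OF q_nz, where d = 0 and e = "\<lambda>_. 0"]) (rule span, simp)
  show "dim_C (coker_space K q P) = 0"
    by (rule coker_space_dim(2)[OF q_nz, where d = 0 and e = "\<lambda>_. 0"]) (rule span, simp)
qed

lemma coker_space_trivial_if_surj:
  assumes "surj \<epsilon>"
  shows "fin_dim_C (coker_space K q P)" "dim_C (coker_space K q P) = 0"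
proof -
  interpret dominated_qop q "Poly_Mapping.keys P" "norm_coeff P \<alpha>" \<alpha> by (rule dominated)
  have "\<exists>f. qd_apply K q P f = g" for g
  proof -
    obtain F where F: "T F = \<epsilon> g / \<epsilon> (Poly_Mapping.lookup P \<alpha>)" using T_surj by blast
    obtain f where "F = \<epsilon> f" using assms by (elim surjE)
    with F have "\<epsilon> (qd_apply K q P f) = \<epsilon> g"
      using emb_qd_apply_factor[of f] lookup_nz[OF \<alpha>] by simp
    then show ?thesis by (auto simp: emb_eq_iff)
  qed
  then show "fin_dim_C (coker_space K q P)" "dim_C (coker_space K q P) = 0"
    by (rule coker_space_surj)+
qed

lemma emb_eq_factorI:
  assumes "fls_qop q (Poly_Mapping.keys P) (\<lambda>i. fps_to_fls (norm_coeff P \<alpha> i)) F =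
      \<epsilon> g / \<epsilon> (Poly_Mapping.lookup P \<alpha>)"
  shows "fls_qop q (Poly_Mapping.keys P) (\<lambda>i. \<epsilon> (Poly_Mapping.lookup P i)) F = \<epsilon> g"
proof -
  have "fls_qop q (Poly_Mapping.keys P) (\<lambda>i. \<epsilon> (Poly_Mapping.lookup P i)) F =
      \<epsilon> (Poly_Mapping.lookup P \<alpha>) * fls_qop q (Poly_Mapping.keys P) (\<lambda>i. fps_to_fls (norm_coeff P \<alpha> i)) F"
    unfolding fls_qop_def sum_distrib_left
    by (intro sum.cong refl) (use lookup_nz[OF \<alpha>] in \<open>simp add: fps_to_fls_norm_coeff\<close>)
  then show ?thesis using assms lookup_nz[OF \<alpha>] by simp
qed

end

end

section \<open>Cokernels over the convergent fields\<close>

context convergent_embedding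
begin

context
  fixes P :: "'a qdiff_op" and \<alpha> :: int and q :: complex
  assumes q: "norm q > 1" and \<alpha>: "\<alpha> \<in> Poly_Mapping.keys P"
    and dom: "\<And>i. i \<in> Poly_Mapping.keys P \<Longrightarrow> i \<noteq> \<alpha> \<Longrightarrow>
      val K (Poly_Mapping.lookup P i) > val K (Poly_Mapping.lookup P \<alpha>)"
begin

lemma convergent_dominated: "convergent_dominated_qop q (Poly_Mapping.keys P) (norm_coeff P \<alpha>) \<alpha>"
  by (intro convergent_dominated_qop.intro dominated[OF q \<alpha> dom] convergent_dominated_qop_axioms.intro)
     (auto simp: norm_coeff_def fps_conv_radius_fls_regpart emb_conv)

text \<open>Solutions are constructed as convergent Laurent series; this brings them back into the
  coefficient field, by continuation to the plane in the case of meromorphic functions.\<close>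

lemma solution_in_range:
  assumes "fls_conv_radius F > 0"
    and "fls_qop q (Poly_Mapping.keys P) (\<lambda>i. fps_to_fls (norm_coeff P \<alpha> i)) F =
      \<epsilon> g / \<epsilon> (Poly_Mapping.lookup P \<alpha>)"
  shows "\<exists>f. \<epsilon> f = F \<and> qd_apply K q P f = g"
proof -
  have eq: "fls_qop q (Poly_Mapping.keys P) (\<lambda>i. \<epsilon> (Poly_Mapping.lookup P i)) F = \<epsilon> g"
    by (rule emb_eq_factorI[OF q \<alpha> dom assms(2)])
  have "P \<noteq> 0" using \<alpha> by auto
  then obtain f where f: "\<epsilon> f = F" using emb_solution[OF q _ assms(1) eq] by blast
  then have "\<epsilon> (qd_apply K q P f) = \<epsilon> g" using eq emb_qd_apply[OF q_nz[OF q \<alpha> dom], of P f] by simp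
  with f show ?thesis by (auto simp: emb_eq_iff)
qed

lemma coker_space_trivial_if_top_dominates:
  assumes "\<And>i. i \<in> Poly_Mapping.keys P \<Longrightarrow> i \<le> \<alpha>"
  shows "fin_dim_C (coker_space K q P)" "dim_C (coker_space K q P) = 0"
proof -
  interpret convergent_dominated_qop q "Poly_Mapping.keys P" "norm_coeff P \<alpha>" \<alpha>
    by (rule convergent_dominated)
  have "\<exists>f. qd_apply K q P f = g" for g
  proof -
    have "fls_conv_radius (\<epsilon> (g / Poly_Mapping.lookup P \<alpha>)) > 0" by (rule emb_conv)
    then have "fls_conv_radius (\<epsilon> g / \<epsilon> (Poly_Mapping.lookup P \<alpha>)) > 0"
      using \<alpha> by (simp add: emb_divide in_keys_iff)
    then obtain F where "fls_conv_radius F > 0" "T F = \<epsilon> g / \<epsilon> (Poly_Mapping.lookup P \<alpha>)"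
      using T_surj_convergent assms by metis
    then show ?thesis using solution_in_range by blast
  qed
  then show "fin_dim_C (coker_space K q P)" "dim_C (coker_space K q P) = 0"
    using coker_space_surj[OF q \<alpha> dom] by blast+
qed

lemma coker_space_dim_if_bottom_dominates:
  assumes n: "n \<in> Poly_Mapping.keys P" "\<And>i. i \<in> Poly_Mapping.keys P \<Longrightarrow> i \<le> n"
    and d: "val K (Poly_Mapping.lookup P n) = val K (Poly_Mapping.lookup P \<alpha>) + int d"
  shows "fin_dim_C (coker_space K q P)" "dim_C (coker_space K q P) = d"
proof -
  define A where "A = Poly_Mapping.lookup P \<alpha>"
  have A: "A \<noteq> 0" using \<alpha> by (simp add: A_def in_keys_iff)
  have q0: "q \<noteq> 0" using q by auto
  have sub: "fls_subdegree (\<epsilon> (Poly_Mapping.lookup P n / A)) = int d"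
    using subdegree_quotient[OF q \<alpha> dom n(1)] d by (simp add: A_def)
  have "\<epsilon> (Poly_Mapping.lookup P n / A) \<noteq> 0" using A n(1) by (simp add: in_keys_iff)
  then have lead: "fls_nth (\<epsilon> (Poly_Mapping.lookup P n / A)) (int d) \<noteq> 0"
    using sub nth_fls_subdegree_nonzero by metis
  interpret cokernel_qop q "Poly_Mapping.keys P" "norm_coeff P \<alpha>" \<alpha> n d
  proof (intro cokernel_qop.intro convergent_dominated cokernel_qop_axioms.intro n)
    show "fps_nth (norm_coeff P \<alpha> n) k = 0" if "k < d" for k
      using sub that by (simp add: norm_coeff_def A_def fls_eq0_below_subdegree)
    show "fps_nth (norm_coeff P \<alpha> n) d \<noteq> 0"
      using lead by (simp add: norm_coeff_def A_def)
  qed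
  obtain N :: nat where N: "(\<forall>g. fls_conv_radius g > 0 \<longrightarrow>
        (\<exists>f \<pi>. fls_conv_radius f > 0 \<and> (\<forall>k\<ge>d. fps_nth \<pi> k = 0) \<and> g = T f + fls_monom_mult (int N) \<pi>)) \<and>
      (\<forall>f \<pi>. fls_conv_radius f > 0 \<longrightarrow> (\<forall>k\<ge>d. fps_nth \<pi> k = 0) \<longrightarrow>
        T f = fls_monom_mult (int N) \<pi> \<longrightarrow> \<pi> = 0)"
    using cokernel_monomials by (elim exE)
  obtain x where x: "\<And>k. \<epsilon> (x k) = fls_X_intpow (int k)" using emb_monomial by metis
  \<comment> \<open>The monomials represent the cokernel of the normalised operator; multiplication
    by \<open>A\<close> undoes the division by the dominant coefficient.\<close>
  define e where "e j = A * x (N + j)" for j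
  have lin: "\<epsilon> (\<Sum>j<d. cst K (c j) * e j) = \<epsilon> A * fls_monom_mult N \<pi>"
    if "\<And>j. j < d \<Longrightarrow> fps_nth \<pi> j = c j" "\<forall>k\<ge>d. fps_nth \<pi> k = 0" for c \<pi>
  proof -
    have "fls_monom_mult N \<pi> = (\<Sum>j<d. fls_const (c j) * fls_X_intpow (int (N + j)))"
    proof (rule fls_eqI)
      fix k :: int
      have "fls_nth (\<Sum>j<d. fls_const (c j) * fls_X_intpow (int (N + j))) k
          = (\<Sum>j<d. if k = int (N + j) then c j else 0)"
        unfolding fls_nth_sum by (intro sum.cong refl) (auto simp: fls_const_mult_const fls_X_intpow_times_conv_shift)
      also have "\<dots> = (\<Sum>j<d. if j = nat (k - int N) \<and> k \<ge> int N then c j else 0)"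
        by (intro sum.cong refl) auto
      also have "\<dots> = fls_nth (fls_monom_mult N \<pi>) k"
        using that by (auto simp: sum.delta not_less)
      finally show "fls_nth (fls_monom_mult N \<pi>) k = fls_nth (\<Sum>j<d. fls_const (c j) * fls_X_intpow (int (N + j))) k"
        by simp
    qed
    then show ?thesis
      by (simp add: emb_sum emb_mult emb_cst e_def x sum_distrib_left mult_ac)
  qed
  have span: "\<exists>f c. g = qd_apply K q P f + (\<Sum>j<d. cst K (c j) * e j)" for g
  proof -
    have "fls_conv_radius (\<epsilon> (g / A)) > 0" by (rule emb_conv)
    then obtain F \<pi> where F: "fls_conv_radius F > 0" "\<forall>k\<ge>d. fps_nth \<pi> k = 0"
      "\<epsilon> (g / A) = T F + fls_monom_mult N \<pi>" using N[THEN conjunct1, rule_format] by metis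
    define h where "h = (\<Sum>j<d. cst K (fps_nth \<pi> j) * e j)"
    have "\<epsilon> h = \<epsilon> A * fls_monom_mult N \<pi>" unfolding h_def by (rule lin) (use F(2) in auto)
    then have "T F = \<epsilon> (g - h) / \<epsilon> A"
      using F(3) A by (simp add: emb_diff emb_divide diff_divide_distrib)
    then obtain f where "qd_apply K q P f = g - h"
      using solution_in_range[OF F(1), of "g - h"] by (auto simp: A_def)
    then have "g = qd_apply K q P f + h" by simp
    then show ?thesis unfolding h_def by blast
  qed
  have indep: "\<forall>j<d. c j = 0" if eq: "qd_apply K q P f = (\<Sum>j<d. cst K (c j) * e j)" for f c
  proof -
    \<comment> \<open>Cutting off at \<open>d\<close> matters: the coefficients \<open>c k\<close>
      with \<open>k \<ge> d\<close> are arbitrary, while \<open>\<pi>\<close> must be a polynomial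
      of degree below \<open>d\<close>.\<close>
    define \<pi> where "\<pi> = Abs_fps (\<lambda>k. if k < d then c k else 0)"
    have "\<epsilon> A * T (\<epsilon> f) = \<epsilon> (qd_apply K q P f)"
      unfolding A_def by (rule emb_qd_apply_factor[OF q \<alpha> dom, symmetric])
    also have "\<dots> = \<epsilon> A * fls_monom_mult N \<pi>"
      unfolding eq by (rule lin) (simp_all add: \<pi>_def)
    finally have "T (\<epsilon> f) = fls_monom_mult N \<pi>" using A by simp
    moreover have "\<forall>k\<ge>d. fps_nth \<pi> k = 0" by (simp add: \<pi>_def)
    ultimately have "\<pi> = 0" using N[THEN conjunct2] emb_conv[of f] by metis
    show ?thesis
    proof (intro allI impI)
      fix j assume "j < d"
      moreover have "fps_nth \<pi> j = 0" by (simp add: \<open>\<pi> = 0\<close>)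
      ultimately show "c j = 0" by (simp add: \<pi>_def)
    qed
  qed
  show "fin_dim_C (coker_space K q P)"
    by (rule coker_space_dim(1)[OF q0, where d = d and e = e]) (fact span indep)+
  show "dim_C (coker_space K q P) = d"
    by (rule coker_space_dim(2)[OF q0, where d = d and e = e]) (fact span indep)+
qed

end

end

section \<open>From purity to kernels and cokernels\<close>

lemma pure_of_slope_dominant:
  fixes K :: "'a::zero qfield"
  assumes pure: "pure_of_slope K P \<mu>" and "\<mu> \<noteq> 0"
  defines "\<alpha> \<equiv> if \<mu> > 0 then Min (Poly_Mapping.keys P) else Max (Poly_Mapping.keys P)"
  shows "\<alpha> \<in> Poly_Mapping.keys P"
    and "\<And>i. i \<in> Poly_Mapping.keys P \<Longrightarrow> i \<noteq> \<alpha> \<Longrightarrow>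
      val K (Poly_Mapping.lookup P i) > val K (Poly_Mapping.lookup P \<alpha>)"
proof -
  note v = pure_of_slope_val[OF pure]
  show "\<alpha> \<in> Poly_Mapping.keys P" using v(1,2) by (simp add: \<alpha>_def)
  fix i assume i: "i \<in> Poly_Mapping.keys P" "i \<noteq> \<alpha>"
  define m where "m = (of_rat \<mu> :: real)"
  define a where "a = Min (Poly_Mapping.keys P)"
  define b where "b = Max (Poly_Mapping.keys P)"
  have ab: "a \<le> i" "i \<le> b" using i by (auto simp: a_def b_def)
  have vi: "real_of_int (val K (Poly_Mapping.lookup P i)) \<ge>
      real_of_int (val K (Poly_Mapping.lookup P a)) + m * (real_of_int i - real_of_int a)"
    using v(5)[OF i(1)] by (simp add: m_def a_def)
  have vb: "real_of_int (val K (Poly_Mapping.lookup P b)) =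
      real_of_int (val K (Poly_Mapping.lookup P a)) + m * (real_of_int b - real_of_int a)"
    using v(4) by (simp add: m_def a_def b_def)
  show "val K (Poly_Mapping.lookup P i) > val K (Poly_Mapping.lookup P \<alpha>)"
  proof (cases "\<mu> > 0")
    case True
    then have "i \<noteq> a" using i(2) by (simp add: \<alpha>_def a_def)
    then have "m > 0" "a < i" using ab True by (simp_all add: m_def)
    then have "m * (real_of_int i - real_of_int a) > 0" by simp
    with vi have "real_of_int (val K (Poly_Mapping.lookup P i)) > val K (Poly_Mapping.lookup P a)" by linarith
    with True show ?thesis by (simp add: \<alpha>_def a_def)
  next
    case False
    then have "i \<noteq> b" using i(2) by (simp add: \<alpha>_def b_def)
    then have "m < 0" "i < b" using ab False \<open>\<mu> \<noteq> 0\<close> by (simp_all add: m_def)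
    then have "m * (real_of_int i - real_of_int b) > 0" by (intro mult_neg_neg) auto
    \<comment> \<open>The supporting line is re-based at the right end, where a decreasing line is
      lowest.\<close>
    then have "m * (real_of_int i - real_of_int a) > m * (real_of_int b - real_of_int a)"
      by (simp add: algebra_simps)
    with vi vb have "real_of_int (val K (Poly_Mapping.lookup P i)) > val K (Poly_Mapping.lookup P b)" by linarith
    with False show ?thesis by (simp add: \<alpha>_def b_def)
  qed
qed

lemma (in convergent_embedding) pure_of_slope_ker_coker:
  assumes q: "norm q > 1" and "\<mu> \<noteq> 0" and n: "qd_order P = n" and pure: "pure_of_slope K P \<mu>"
  shows "fin_dim_C (ker_space K q P) \<and> dim_C (ker_space K q P) = 0 \<and>
    fin_dim_C (coker_space K q P) \<and> of_nat (dim_C (coker_space K q P)) = of_nat n * max 0 \<mu>"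
proof -
  note v = pure_of_slope_val[OF pure]
  note dom = pure_of_slope_dominant[OF pure \<open>\<mu> \<noteq> 0\<close>]
  note ker = ker_space_dominated[OF q dom]
  show ?thesis
  proof (cases "\<mu> > 0")
    case False
    then have "fin_dim_C (coker_space K q P)" "dim_C (coker_space K q P) = 0"
      using coker_space_trivial_if_top_dominates[OF q dom] by auto
    with False ker show ?thesis by simp
  next
    case True
    define a where "a = Min (Poly_Mapping.keys P)"
    define b where "b = Max (Poly_Mapping.keys P)"
    define d where "d = nat (val K (Poly_Mapping.lookup P b) - val K (Poly_Mapping.lookup P a))"
    have "real_of_int (val K (Poly_Mapping.lookup P b) - val K (Poly_Mapping.lookup P a)) = of_rat \<mu> * (b - a)"
      using v(4) by (simp add: a_def b_def)
    also have "b - a = int n" using n v(3) by (simp add: qd_order_def a_def b_def)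
    finally have "(of_rat (of_int (val K (Poly_Mapping.lookup P b) - val K (Poly_Mapping.lookup P a))) :: real)
        = of_rat (\<mu> * of_nat n)"
      by (simp only: of_rat_mult of_rat_of_int_eq of_rat_of_nat_eq of_int_of_nat_eq)
    \<comment> \<open>Slopes are real in the polygon and rational in the claim; injectivity of
      \<open>of_rat\<close> brings the equation back to the rationals. It shows that
      \<open>n * \<mu>\<close> is an integer although \<open>\<mu>\<close> need not be.\<close>
    then have eq: "of_int (val K (Poly_Mapping.lookup P b) - val K (Poly_Mapping.lookup P a)) = \<mu> * of_nat n"
      by (simp only: of_rat_eq_iff)
    also have "\<dots> \<ge> 0" using True by simp
    finally have "val K (Poly_Mapping.lookup P b) - val K (Poly_Mapping.lookup P a) \<ge> 0"
      by (simp only: of_int_0_le_iff)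
    then have d: "val K (Poly_Mapping.lookup P b) - val K (Poly_Mapping.lookup P a) = int d"
      by (simp add: d_def)
    have dom': "a \<in> Poly_Mapping.keys P" "\<And>i. i \<in> Poly_Mapping.keys P \<Longrightarrow> i \<noteq> a \<Longrightarrow>
        val K (Poly_Mapping.lookup P i) > val K (Poly_Mapping.lookup P a)"
      using dom True by (auto simp: a_def)
    have "fin_dim_C (coker_space K q P)" "dim_C (coker_space K q P) = d"
      using coker_space_dim_if_bottom_dominates[OF q dom', of b d] v(2) d by (auto simp: b_def)
    moreover have "of_nat d = of_nat n * max 0 \<mu>" using eq True unfolding d by (simp add: mult.commute)
    ultimately show ?thesis using ker by simp
  qed
qed

theorem mainTheorem7:
  fixes q :: complex and \<mu> :: rat and n :: nat
  assumes "norm q > 1" and "\<mu> \<noteq> 0"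
  shows
    "(\<forall>P :: complex fls qdiff_op.
        qd_order P = n \<and> pure_of_slope formal_field P \<mu> \<longrightarrow>
          fin_dim_C (ker_space formal_field q P) \<and> dim_C (ker_space formal_field q P) = 0 \<and>
          fin_dim_C (coker_space formal_field q P) \<and> dim_C (coker_space formal_field q P) = 0) \<and>
     (\<forall>P :: mero_germ qdiff_op.
        qd_order P = n \<and> pure_of_slope germ_field P \<mu> \<longrightarrow>
          fin_dim_C (ker_space germ_field q P) \<and> dim_C (ker_space germ_field q P) = 0 \<and>
          fin_dim_C (coker_space germ_field q P) \<and>
          of_nat (dim_C (coker_space germ_field q P)) = of_nat n * max 0 \<mu>) \<and>
     (\<forall>P :: mero_fun qdiff_op.
        qd_order P = n \<and> pure_of_slope mero_field P \<mu> \<longrightarrow>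
          fin_dim_C (ker_space mero_field q P) \<and> dim_C (ker_space mero_field q P) = 0 \<and>
          fin_dim_C (coker_space mero_field q P) \<and>
          of_nat (dim_C (coker_space mero_field q P)) = of_nat n * max 0 \<mu>)"
proof (intro conjI allI impI)
  fix P :: "complex fls qdiff_op"
  assume "qd_order P = n \<and> pure_of_slope formal_field P \<mu>"
  then have "pure_of_slope formal_field P \<mu>" by simp
  note dom = pure_of_slope_dominant[OF this assms(2)]
  show "fin_dim_C (ker_space formal_field q P)" "dim_C (ker_space formal_field q P) = 0"
    using laurent_embedding.ker_space_dominated[OF laurent_embedding_formal assms(1) dom] by blast+
  show "fin_dim_C (coker_space formal_field q P)" "dim_C (coker_space formal_field q P) = 0"
    using laurent_embedding.coker_space_trivial_if_surj[OF laurent_embedding_formal assms(1) dom surj_id[unfolded id_def]]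
    by blast+
next
  fix P :: "mero_germ qdiff_op"
  assume "qd_order P = n \<and> pure_of_slope germ_field P \<mu>"
  then show "fin_dim_C (ker_space germ_field q P)" "dim_C (ker_space germ_field q P) = 0"
    "fin_dim_C (coker_space germ_field q P)"
    "of_nat (dim_C (coker_space germ_field q P)) = of_nat n * max 0 \<mu>"
    using convergent_embedding.pure_of_slope_ker_coker[OF convergent_embedding_germ assms] by blast+
next
  fix P :: "mero_fun qdiff_op"
  assume "qd_order P = n \<and> pure_of_slope mero_field P \<mu>"
  then show "fin_dim_C (ker_space mero_field q P)" "dim_C (ker_space mero_field q P) = 0"
    "fin_dim_C (coker_space mero_field q P)"
    "of_nat (dim_C (coker_space mero_field q P)) = of_nat n * max 0 \<mu>"
    using convergent_embedding.pure_of_slope_ker_coker[OF convergent_embedding_mero assms] by blast+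
qed

end
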